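(* Let $m_1,m_2,n$ be positive integers such that $9(m_1 m_2)^2\log(m_1)\log(m_2) < \log n$. Then every complete $n$-vertex simple topological graph contains a topological subgraph that is weakly isomorphic to $C_{m_1}$ or to $T_{m_2}$.
   Context: A topological graph is a graph drawn in the plane with vertices as points and edges as non-self-intersecting arcs connecting the corresponding points; arcs do not pass through vertices other than their endpoints, and if two edges share an interior point they properly cross there. It is simple if every pair of edges intersect at most once, either at a common endpoint or at a proper crossing. Two simple topological graphs $G,H$ are weakly isomorphic if there is an incidence-preserving bijection between them such that two edges of $G$ cross if and only if the corresponding edges of $H$ cross. $C_m$ denotes a complete convex geometric graph on $m$ vertices (vertices in convex position, edges straight segments). The complete twisted graph $T_m$ is a complete simple topological graph on $m$ vertices whose vertices can be ordered $v_1,\dots,v_m$ so that edges $v_iv_j$ and $v_kv_\ell$ (with $i<j$, $k<\ell$) cross if and only if $i<k<\ell<j$ or $k<i<j<\ell$. Logarithms are base 2. *)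

theory Defs
  imports "HOL-Analysis.Analysis"
begin

text \<open>
  The plane is \<^typ>\<open>complex\<close>. An edge is the two-element set of its endpoints; its drawing is a
  parametrised arc whose direction is irrelevant.
\<close>

record topgraph =
  verts :: "complex set"
  edges :: "complex set set"
  curve :: "complex set \<Rightarrow> real \<Rightarrow> complex"

definition edge_interior :: "topgraph \<Rightarrow> complex set \<Rightarrow> complex set" where
  "edge_interior G e = path_image (curve G e) - e"

text \<open>
  Two curves cross properly at \<open>p\<close> if, up to a homeomorphism of a neighbourhood of \<open>p\<close> onto the
  open unit disc, they look like two perpendicular diameters meeting at the image of \<open>p\<close>; this
  excludes touchings and overlaps.
\<close>

definition proper_crossing :: "complex set \<Rightarrow> complex set \<Rightarrow> complex \<Rightarrow> bool" where
  "proper_crossing A B p \<longleftrightarrow>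
     (\<exists>U h k. open U \<and> p \<in> U \<and> homeomorphism U (ball 0 1) h k \<and> h p = 0 \<and>
        h ` (A \<inter> U) = {z \<in> ball 0 1. Im z = 0} \<and>
        h ` (B \<inter> U) = {z \<in> ball 0 1. Re z = 0})"

definition topological_graph :: "topgraph \<Rightarrow> bool" where
  "topological_graph G \<longleftrightarrow>
     finite (verts G) \<and>
     (\<forall>e\<in>edges G. e \<subseteq> verts G \<and> arc (curve G e) \<and>
        {pathstart (curve G e), pathfinish (curve G e)} = e \<and>
        edge_interior G e \<inter> verts G = {}) \<and>
     (\<forall>e\<in>edges G. \<forall>f\<in>edges G. e \<noteq> f \<longrightarrow>
        (\<forall>p\<in>edge_interior G e \<inter> edge_interior G f.
           proper_crossing (path_image (curve G e)) (path_image (curve G f)) p))"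

text \<open>
  In a topological graph any common point of two distinct edges is either a common endpoint or a
  proper crossing, so simplicity only has to bound the number of common points.
\<close>

definition simple_topological_graph :: "topgraph \<Rightarrow> bool" where
  "simple_topological_graph G \<longleftrightarrow>
     topological_graph G \<and>
     (\<forall>e\<in>edges G. \<forall>f\<in>edges G. e \<noteq> f \<longrightarrow>
        (\<forall>p\<in>path_image (curve G e) \<inter> path_image (curve G f).
         \<forall>q\<in>path_image (curve G e) \<inter> path_image (curve G f). p = q))"

definition edges_cross :: "topgraph \<Rightarrow> complex set \<Rightarrow> complex set \<Rightarrow> bool" where
  "edges_cross G e f \<longleftrightarrow>
     e \<noteq> f \<and>
     (\<exists>p\<in>edge_interior G e \<inter> edge_interior G f.
        proper_crossing (path_image (curve G e)) (path_image (curve G f)) p)"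

definition complete_graph :: "topgraph \<Rightarrow> bool" where
  "complete_graph G \<longleftrightarrow> edges G = {{u, v} | u v. u \<in> verts G \<and> v \<in> verts G \<and> u \<noteq> v}"

definition topological_subgraph :: "topgraph \<Rightarrow> topgraph \<Rightarrow> bool" where
  "topological_subgraph H G \<longleftrightarrow>
     topological_graph H \<and> verts H \<subseteq> verts G \<and> edges H \<subseteq> edges G \<and>
     (\<forall>e\<in>edges H. curve H e = curve G e)"

definition weakly_isomorphic :: "topgraph \<Rightarrow> topgraph \<Rightarrow> bool" where
  "weakly_isomorphic G H \<longleftrightarrow>
     simple_topological_graph G \<and> simple_topological_graph H \<and>
     (\<exists>\<phi> \<psi>. bij_betw \<phi> (verts G) (verts H) \<and> bij_betw \<psi> (edges G) (edges H) \<and>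
        (\<forall>v\<in>verts G. \<forall>e\<in>edges G. v \<in> e \<longleftrightarrow> \<phi> v \<in> \<psi> e) \<and>
        (\<forall>e\<in>edges G. \<forall>f\<in>edges G. edges_cross G e f \<longleftrightarrow> edges_cross H (\<psi> e) (\<psi> f)))"

definition convex_position :: "complex set \<Rightarrow> bool" where
  "convex_position V \<longleftrightarrow> (\<forall>v\<in>V. v \<notin> convex hull (V - {v}))"

definition complete_convex_geometric_graph :: "nat \<Rightarrow> topgraph \<Rightarrow> bool" where
  "complete_convex_geometric_graph m G \<longleftrightarrow>
     topological_graph G \<and> complete_graph G \<and> card (verts G) = m \<and>
     convex_position (verts G) \<and>
     (\<forall>u\<in>verts G. \<forall>v\<in>verts G. u \<noteq> v \<longrightarrow>
        path_image (curve G {u, v}) = closed_segment u v)"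

definition complete_twisted_graph :: "nat \<Rightarrow> topgraph \<Rightarrow> bool" where
  "complete_twisted_graph m G \<longleftrightarrow>
     simple_topological_graph G \<and> complete_graph G \<and> card (verts G) = m \<and>
     (\<exists>v. bij_betw v {1..m} (verts G) \<and>
        (\<forall>i\<in>{1..m}. \<forall>j\<in>{1..m}. \<forall>k\<in>{1..m}. \<forall>l\<in>{1..m}. i < j \<longrightarrow> k < l \<longrightarrow>
           (edges_cross G {v i, v j} {v k, v l} \<longleftrightarrow>
              (i < k \<and> k < l \<and> l < j) \<or> (k < i \<and> i < j \<and> j < l))))"

end

theory Submission
  imports Defs
begin

text \<open>
  The topology enters through three facts. If two edges ab and cd cross at p, then the arms pb and pd start on
  the same side of the Jordan curve formed by ap, pc and the edge ac, so for every further vertex e the edges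
  eb and ed cross that curve equally often modulo 2. Five vertices always span a crossing (Janiszewski's
  theorem), and vertex-disjoint triangles cross an even number of times. Propositional reasoning turns the first
  two facts into restrictions on the crossing patterns of five vertices.

  Fix a vertex v. The parity of the number of crossings between the triangles vij and vkl tells whether the
  edges vi, vj separate vk, vl in the rotation at v; cutting the resulting cyclic order gives a linear order on
  the other vertices. Color a triple i < j < k by 1, 2 or 3 if vi, vj or vk crosses the opposite edge, and
  by 0 otherwise. A homogeneous set of color 0 or 2 induces a convex graph and one of color 1 or 3 a twisted
  graph. As the colors 1, 2, 3 and the color class {0, 3} are transitive, a single comparison often decides
  for a whole chain. Hence vertices can be placed one by one into (m1 m2)^2 cells by nested binary searches,
  with about log m1 log m2 comparisons per vertex, each of which costs a factor 4 in the number of vertices left.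
\<close>

section \<open>Crossings with a Jordan curve\<close>

text \<open>The rotation at v is never built topologically. Alternation around v is defined by the
  parity \<open>sep\<close>, so nothing has to be known about arcs near a common endpoint. The
  obstacle in the search is that color 0 is transitive only together with 3. Hence colors 1 and 2
  are searched first; inside a cell that sees only {0, 3}, the rule \<open>col_0\<close> then tells
  0 from 3. As long as no wanted set exists, chains of colors 1, 2, 3 have fewer than m2, m1, m2
  vertices and a cell fewer than m1, so at most ((m1 - 1)(m2 - 1))^2 vertices can be placed. With
  p1, p2 the rounded-up logarithms, a placement takes p2 searches of p1 comparisons and then p2 more
  comparisons; removing the vertex costs a factor 2. For m1, m2 \<ge> 2, rounding up costs at most a
  factor 3/2, so the exponent of 2 per placement is at most (2 * 9/4 + 2 * 3/2 + 1) log m1 log m2,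
  which is 8.5 log m1 log m2. The constant 9 leaves room for cutting the cyclic order.\<close>

lemma proper_crossing_shrink:
  assumes "proper_crossing A B p" "open W" "p \<in> W"
  obtains U h k where "open U" "p \<in> U" "U \<subseteq> W" "homeomorphism U (ball 0 1) h k" "h p = 0"
    "h ` (A \<inter> U) = {z \<in> ball 0 1. Im z = 0}" "h ` (B \<inter> U) = {z \<in> ball 0 1. Re z = 0}"
proof -
  obtain U h k where U: "open U" "p \<in> U" and hom: "homeomorphism U (ball 0 1) h k" and hp: "h p = 0"
    and A: "h ` (A \<inter> U) = {z \<in> ball 0 1. Im z = 0}" and B: "h ` (B \<inter> U) = {z \<in> ball 0 1. Re z = 0}"
    using assms(1) unfolding proper_crossing_def by auto
  have contk: "continuous_on (ball 0 1) k" and conth: "continuous_on U h" using hom by (auto simp: homeomorphism_def)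
  have k0: "k 0 = p" using hom hp U by (metis homeomorphism_apply1)
  have "open (ball 0 1 \<inter> k -` W)"
    using assms(2) by (intro continuous_open_preimage contk) auto
  moreover have "0 \<in> ball 0 1 \<inter> k -` W" using k0 assms(3) by auto
  ultimately obtain r where r: "r > 0" "ball 0 r \<subseteq> ball 0 1 \<inter> k -` W"
    by (meson open_contains_ball)
  define U' where "U' = U \<inter> h -` ball 0 r"
  define h' where "h' = (\<lambda>x. h x /\<^sub>R r)"
  define k' where "k' = (\<lambda>y. k (r *\<^sub>R y))"
  have U': "open U'" unfolding U'_def
    using U by (intro continuous_open_preimage conth) auto
  have inball: "r *\<^sub>R y \<in> ball 0 r" if "y \<in> ball 0 1" for y :: complex using that r by simp
  then have inball1: "r *\<^sub>R y \<in> ball 0 1" if "y \<in> ball 0 1" for y :: complex using that r(2) by blast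
  have hk: "h (k z) = z" "k z \<in> U" if "z \<in> ball 0 1" for z
    using hom that by (auto simp: homeomorphism_def)
  have kh: "k (h x) = x" if "x \<in> U" for x using hom that by (auto simp: homeomorphism_def)
  have hom': "homeomorphism U' (ball 0 1) h' k'"
  proof (rule homeomorphismI)
    show "continuous_on U' h'" unfolding h'_def U'_def
      by (intro continuous_intros continuous_on_subset[OF conth]) auto
    show "continuous_on (ball 0 1) k'" unfolding k'_def
      using inball1 by (intro continuous_on_compose2[OF contk] continuous_intros) blast
    show "h' ` U' \<subseteq> ball 0 1" using r by (auto simp: h'_def U'_def divide_simps)
    show "k' ` ball 0 1 \<subseteq> U'" unfolding k'_def U'_def using hk inball inball1 by auto
    show "k' (h' x) = x" if "x \<in> U'" for x using that kh r by (auto simp: k'_def h'_def U'_def)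
    show "h' (k' y) = y" if "y \<in> ball 0 1" for y using hk[OF inball1[OF that]] r by (simp add: h'_def k'_def)
  qed
  have "U' \<subseteq> W"
  proof
    fix x assume "x \<in> U'"
    then have "h x \<in> ball 0 r" "x \<in> U" by (auto simp: U'_def)
    then show "x \<in> W" using r(2) kh[of x] by auto
  qed
  \<comment> \<open>Both diameters are zero sets of a real-linear function, \<open>Im\<close> or
    \<open>Re\<close>, so rescaling a smaller concentric disc to the unit disc preserves them. One
    argument with a homogeneous \<open>f\<close> serves for both.\<close>
  moreover have img: "h' ` (Y \<inter> U') = {z \<in> ball 0 1. f z = 0}" if Y: "h ` (Y \<inter> U) = {z \<in> ball 0 1. f z = 0}"
    and f: "\<And>s z. f (s *\<^sub>R z) = s * f z" for Y and f :: "complex \<Rightarrow> real"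
  proof (intro equalityI subsetI)
    fix z assume "z \<in> h' ` (Y \<inter> U')"
    then obtain y where y: "y \<in> Y" "y \<in> U'" "z = h' y" by auto
    then have "h y \<in> {z \<in> ball 0 1. f z = 0}" unfolding Y[symmetric] by (auto simp: U'_def)
    then show "z \<in> {z \<in> ball 0 1. f z = 0}" using y f r by (auto simp: h'_def U'_def divide_simps)
  next
    fix z assume z: "z \<in> {z \<in> ball 0 1. f z = 0}"
    then have "r *\<^sub>R z \<in> {z \<in> ball 0 1. f z = 0}" using inball1[of z] f by auto
    then obtain y where y: "y \<in> Y" "y \<in> U" "h y = r *\<^sub>R z" unfolding Y[symmetric] by auto
    then have "y \<in> U'" using inball[of z] z by (auto simp: U'_def)
    then show "z \<in> h' ` (Y \<inter> U')" using y r by (intro image_eqI[of _ _ y]) (auto simp: h'_def)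
  qed
  moreover have "p \<in> U'" "h' p = 0" using U hp r by (auto simp: U'_def h'_def)
  ultimately show ?thesis using U' hom' img[OF A] img[OF B] by (intro that) auto
qed

text \<open>A chart can be shrunk into W, where the sets agree. The lemma transfers crossings from
  whole edges to subarcs, and from an arc to a closed curve containing it.\<close>

lemma proper_crossing_local:
  assumes "proper_crossing A B p" "open W" "p \<in> W" "A \<inter> W = A' \<inter> W" "B \<inter> W = B' \<inter> W"
  shows "proper_crossing A' B' p"
proof -
  obtain U h k where *: "open U" "p \<in> U" "U \<subseteq> W" "homeomorphism U (ball 0 1) h k" "h p = 0"
    "h ` (A \<inter> U) = {z \<in> ball 0 1. Im z = 0}" "h ` (B \<inter> U) = {z \<in> ball 0 1. Re z = 0}"
    by (rule proper_crossing_shrink[OF assms(1-3)])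
  moreover have "A' \<inter> U = A \<inter> U" "B' \<inter> U = B \<inter> U" using assms(4,5) *(3) by auto
  ultimately show ?thesis unfolding proper_crossing_def by (intro exI[of _ U] exI[of _ h] exI[of _ k]) simp
qed

section \<open>Sides of a Jordan curve and the parity of crossings\<close>

definition jordan_curve :: "complex set \<Rightarrow> bool" where
  "jordan_curve \<Gamma> \<longleftrightarrow> (\<exists>c. simple_path c \<and> pathfinish c = pathstart c \<and> path_image c = \<Gamma>)"

lemma jordan_curveD:
  assumes "jordan_curve \<Gamma>"
  shows "inside \<Gamma> \<noteq> {}" "open (inside \<Gamma>)" "connected (inside \<Gamma>)"
    "outside \<Gamma> \<noteq> {}" "open (outside \<Gamma>)" "connected (outside \<Gamma>)"
    "inside \<Gamma> \<inter> outside \<Gamma> = {}" "inside \<Gamma> \<union> outside \<Gamma> = - \<Gamma>"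
    "frontier (inside \<Gamma>) = \<Gamma>" "frontier (outside \<Gamma>) = \<Gamma>" "compact \<Gamma>"
  using assms Jordan_inside_outside unfolding jordan_curve_def
  by (metis compact_simple_path_image)+

lemma connected_same_side:
  assumes "jordan_curve \<Gamma>" "connected S" "S \<inter> \<Gamma> = {}" "x \<in> S" "y \<in> S"
  shows "x \<in> inside \<Gamma> \<longleftrightarrow> y \<in> inside \<Gamma>"
proof -
  note J = jordan_curveD[OF assms(1)]
  have "S \<subseteq> inside \<Gamma> \<union> outside \<Gamma>" using J(8) assms(3) by auto
  then have "inside \<Gamma> \<inter> S = {} \<or> outside \<Gamma> \<inter> S = {}"
    using J(7) by (intro connectedD[OF assms(2) J(2,5)]) auto
  then show ?thesis using \<open>S \<subseteq> inside \<Gamma> \<union> outside \<Gamma>\<close> assms(4,5) J(7) by blast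
qed

lemma half_disc_connected:
  "connected {z \<in> ball 0 1. Im z > 0}" "connected {z \<in> ball 0 1. Im z < 0}"
proof -
  have "convex (ball (0::complex) 1 \<inter> {z. Im z > 0})" "convex (ball (0::complex) 1 \<inter> {z. Im z < 0})"
    by (intro convex_Int convex_ball convex_halfspace_Im_gt convex_halfspace_Im_lt)+
  moreover have "{z \<in> ball 0 1. Im z > 0} = ball (0::complex) 1 \<inter> {z. Im z > 0}"
     "{z \<in> ball 0 1. Im z < 0} = ball (0::complex) 1 \<inter> {z. Im z < 0}" by auto
  ultimately show "connected {z \<in> ball 0 1. Im z > 0}" "connected {z \<in> ball 0 1. Im z < 0}"
    by (metis convex_connected)+
qed

text \<open>In the chart the curve is the horizontal diameter, so each open half disc lies on one
  side. Both sides have p in their frontier, hence the half discs lie on different sides, and g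
  passes from one to the other along the vertical diameter.\<close>

lemma single_crossing_separates:
  assumes J: "jordan_curve \<Gamma>" and g: "arc g" and gp: "path_image g \<inter> \<Gamma> = {p}"
    and ends: "g 0 \<notin> \<Gamma>" "g 1 \<notin> \<Gamma>" and pc: "proper_crossing \<Gamma> (path_image g) p"
  shows "g 0 \<in> inside \<Gamma> \<longleftrightarrow> g 1 \<notin> inside \<Gamma>"
proof -
  note JD = jordan_curveD[OF J]
  obtain U h k where U: "open U" "p \<in> U" and hom: "homeomorphism U (ball 0 1) h k" and hp: "h p = 0"
    and A: "h ` (\<Gamma> \<inter> U) = {z \<in> ball 0 1. Im z = 0}" and B: "h ` (path_image g \<inter> U) = {z \<in> ball 0 1. Re z = 0}"
    using pc unfolding proper_crossing_def by auto
  have hk: "h (k z) = z" "k z \<in> U" if "z \<in> ball 0 1" for z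
    using hom that by (auto simp: homeomorphism_def)
  have kh: "k (h x) = x" "h x \<in> ball 0 1" if "x \<in> U" for x using hom that by (auto simp: homeomorphism_def)
  define H1 where "H1 = k ` {z \<in> ball 0 1. Im z > 0}"
  define H2 where "H2 = k ` {z \<in> ball 0 1. Im z < 0}"
  have contk: "continuous_on (ball 0 1) k" and conth: "continuous_on U h" using hom by (auto simp: homeomorphism_def)
  have con: "connected H1" "connected H2" unfolding H1_def H2_def
    by (intro connected_continuous_image half_disc_connected continuous_on_subset[OF contk]; auto)+
  have off: "H1 \<inter> \<Gamma> = {}" "H2 \<inter> \<Gamma> = {}"
  proof -
    have "Im z = 0" if "z \<in> ball 0 1" "k z \<in> \<Gamma>" for z
    proof -
      have "h (k z) \<in> {z \<in> ball 0 1. Im z = 0}" unfolding A[symmetric] using that hk(2) by auto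
      then show ?thesis using hk(1) that by auto
    qed
    then show "H1 \<inter> \<Gamma> = {}" "H2 \<inter> \<Gamma> = {}" by (auto simp: H1_def H2_def)
  qed
  have cover: "U \<subseteq> \<Gamma> \<union> H1 \<union> H2"
  proof
    fix x assume x: "x \<in> U"
    consider "Im (h x) = 0" | "Im (h x) > 0" | "Im (h x) < 0" by linarith
    then show "x \<in> \<Gamma> \<union> H1 \<union> H2"
    proof cases
      case 1
      then have "h x \<in> h ` (\<Gamma> \<inter> U)" unfolding A using kh x by auto
      then obtain y where "y \<in> \<Gamma>" "y \<in> U" "h x = h y" by auto
      then have "x = y" using kh x by metis
      then show ?thesis using \<open>y \<in> \<Gamma>\<close> by simp
    next
      case 2
      then show ?thesis unfolding H1_def using kh[OF x] by (auto simp: image_iff intro!: bexI[of _ "h x"])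
    next
      case 3
      then show ?thesis unfolding H2_def using kh[OF x] by (auto simp: image_iff intro!: bexI[of _ "h x"])
    qed
  qed
  have pG: "p \<in> \<Gamma>" using gp by auto
  have meets: "U \<inter> inside \<Gamma> \<noteq> {}" "U \<inter> outside \<Gamma> \<noteq> {}"
    using JD(9,10) pG U open_Int_closure_eq_empty[OF U(1)] unfolding frontier_def by blast+
  have opp: "x \<in> inside \<Gamma> \<longleftrightarrow> y \<notin> inside \<Gamma>" if "x \<in> H1" "y \<in> H2" for x y
  proof
    assume x: "x \<in> inside \<Gamma>"
    show "y \<notin> inside \<Gamma>"
    proof
      assume y: "y \<in> inside \<Gamma>"
      have "z \<in> inside \<Gamma>" if "z \<in> U" "z \<notin> \<Gamma>" for z
        using cover that connected_same_side[OF J con(1) off(1) \<open>x \<in> H1\<close>] connected_same_side[OF J con(2) off(2) \<open>y \<in> H2\<close>] x y by blast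
      then show False using meets(2) JD(7,8) by blast
    qed
  next
    assume y: "y \<notin> inside \<Gamma>"
    show "x \<in> inside \<Gamma>"
    proof (rule ccontr)
      assume x: "x \<notin> inside \<Gamma>"
      have "z \<notin> inside \<Gamma>" if "z \<in> U" "z \<notin> \<Gamma>" for z
        using cover that connected_same_side[OF J con(1) off(1) \<open>x \<in> H1\<close>] connected_same_side[OF J con(2) off(2) \<open>y \<in> H2\<close>] x y by blast
      then show False using meets(1) JD(7,8) by blast
    qed
  qed
  have "p \<in> g ` {0..1}" using gp unfolding path_image_def by blast
  then obtain t where t: "t \<in> {0..1}" "g t = p" by blast
  have t01: "0 < t" "t < 1" using t ends pG by (auto simp: order.strict_iff_order)
  have contg: "continuous_on {0..1} g" and injg: "inj_on g {0..1}" using g by (auto simp: arc_def path_def)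
  have "open ({0<..<1} \<inter> g -` U)"
    using contg U by (intro continuous_open_preimage) (auto intro: continuous_on_subset)
  moreover have "t \<in> {0<..<1} \<inter> g -` U" using t t01 U by auto
  ultimately obtain d where d: "d > 0" "cball t d \<subseteq> {0<..<1} \<inter> g -` U"
    by (meson open_contains_cball)
  then have dU: "{t-d..t+d} \<subseteq> {0<..<1}" "\<And>s. s \<in> {t-d..t+d} \<Longrightarrow> g s \<in> U"
    by (auto simp: cball_eq_atLeastAtMost)
  define f where "f s = Im (h (g s))" for s
  have Re0: "Re (h (g s)) = 0" if "s \<in> {t-d..t+d}" for s
  proof -
    have "g s \<in> path_image g \<inter> U" using dU that by (force simp: path_image_def)
    then show ?thesis using B by blast
  qed
  have "continuous_on {t-d..t+d} f" unfolding f_def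
    using dU by (intro continuous_intros continuous_on_compose2[OF conth] continuous_on_subset[OF contg]) force+
  moreover have "inj_on f {t-d..t+d}"
  proof (rule inj_onI)
    fix x y assume xy: "x \<in> {t-d..t+d}" "y \<in> {t-d..t+d}" "f x = f y"
    then have "h (g x) = h (g y)" using Re0 by (simp add: f_def complex_eq_iff)
    then have "g x = g y" using kh dU xy by metis
    moreover have "x \<in> {0..1}" "y \<in> {0..1}" using xy dU(1) by force+
    ultimately show "x = y" using inj_onD[OF injg] by blast
  qed
  \<comment> \<open>A continuous injective real function is strictly monotone, so the height
    \<open>f\<close> changes sign at t instead of merely touching 0.\<close>
  ultimately have "f (t-d) < f t \<and> f t < f (t+d) \<or> f (t+d) < f t \<and> f t < f (t-d)"
    using d by (intro continuous_inj_imp_mono) auto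
  moreover have "f t = 0" using t hp by (simp add: f_def)
  moreover have inH: "g s \<in> H1" if "s \<in> {t-d..t+d}" "f s > 0" for s
    unfolding H1_def using that kh[OF dU(2)[OF that(1)]] by (auto simp: f_def image_iff intro!: bexI[of _ "h (g s)"])
  moreover have "g s \<in> H2" if "s \<in> {t-d..t+d}" "f s < 0" for s
    unfolding H2_def using that kh[OF dU(2)[OF that(1)]] by (auto simp: f_def image_iff intro!: bexI[of _ "h (g s)"])
  ultimately have near: "g (t-d) \<in> inside \<Gamma> \<longleftrightarrow> g (t+d) \<notin> inside \<Gamma>"
    using opp d by (metis atLeastAtMost_iff diff_add_cancel le_add_same_cancel1 less_eq_real_def add_increasing2 diff_le_eq)
  have avoid: "g s \<notin> \<Gamma>" if "s \<in> {0..1}" "s \<noteq> t" for s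
  proof
    assume "g s \<in> \<Gamma>"
    then have "g s \<in> path_image g \<inter> \<Gamma>" using that by (simp add: path_image_def)
    then have "g s = g t" using gp t by blast
    then show False using inj_onD[OF injg] that t by blast
  qed
  have sub: "t - d \<in> {0<..<1}" "t + d \<in> {0<..<1}" by (rule subsetD[OF dU(1)]; use d in simp)+
  have "connected (g ` {0..t-d})" "connected (g ` {t+d..1})"
    using sub by (intro connected_continuous_image continuous_on_subset[OF contg]; auto)+
  moreover have "g ` {0..t-d} \<inter> \<Gamma> = {}" "g ` {t+d..1} \<inter> \<Gamma> = {}" using avoid sub d by auto
  ultimately have "g 0 \<in> inside \<Gamma> \<longleftrightarrow> g (t-d) \<in> inside \<Gamma>" "g (t+d) \<in> inside \<Gamma> \<longleftrightarrow> g 1 \<in> inside \<Gamma>"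
    using sub connected_same_side[OF J, of "g ` {0..t-d}" "g 0" "g (t-d)"]
      connected_same_side[OF J, of "g ` {t+d..1}" "g (t+d)" "g 1"] by simp_all
  then show ?thesis using near by blast
qed

text \<open>Induction on the number of crossings: cut g just after its first crossing. The initial
  piece changes sides once, and the rest has one crossing fewer.\<close>

lemma crossing_parity:
  assumes J: "jordan_curve \<Gamma>"
  shows "\<lbrakk>arc g; finite (path_image g \<inter> \<Gamma>); card (path_image g \<inter> \<Gamma>) = n; g 0 \<notin> \<Gamma>; g 1 \<notin> \<Gamma>;
    \<And>p. p \<in> path_image g \<inter> \<Gamma> \<Longrightarrow> proper_crossing \<Gamma> (path_image g) p\<rbrakk>
    \<Longrightarrow> (g 0 \<in> inside \<Gamma> \<longleftrightarrow> g 1 \<in> inside \<Gamma>) \<longleftrightarrow> even n"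
proof (induction n arbitrary: g)
  case 0
  then have "path_image g \<inter> \<Gamma> = {}" by simp
  moreover have "connected (path_image g)" using 0 by (simp add: arc_imp_path connected_path_image)
  moreover have "g 0 \<in> path_image g" "g 1 \<in> path_image g" by (auto simp: path_image_def)
  ultimately have "g 0 \<in> inside \<Gamma> \<longleftrightarrow> g 1 \<in> inside \<Gamma>" by (intro connected_same_side[OF J])
  then show ?case by simp
next
  case (Suc n)
  note g = \<open>arc g\<close>
  have contg: "continuous_on {0..1} g" and injg: "inj_on g {0..1}" using g by (auto simp: arc_def path_def)
  define T where "T = {s \<in> {0..1}. g s \<in> \<Gamma>}"
  have gT: "g ` T = path_image g \<inter> \<Gamma>" by (auto simp: T_def path_image_def)
  have "inj_on g T" using injg by (rule inj_on_subset) (auto simp: T_def)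
  then have finT: "finite T" and cardT: "card T = Suc n"
    using Suc.prems(2,3) gT finite_imageD card_image by metis+
  define t where "t = Min T"
  have "T \<noteq> {}" using cardT by auto
  then have tT: "t \<in> T" and tmin: "\<And>s. s \<in> T \<Longrightarrow> t \<le> s" using finT by (auto simp: t_def)
  have t01: "0 < t" "t < 1" using tT Suc.prems(4,5) by (auto simp: T_def order.strict_iff_order)
  \<comment> \<open>Halfway between the first crossing time t and the next one; inserting 1 supplies
    an upper end when no further crossing follows, and keeps u below 1.\<close>
  define u where "u = (t + Min (insert 1 (T - {t}))) / 2"
  have mn: "t < Min (insert 1 (T - {t}))"
    using finT t01 tmin by (subst Min_gr_iff) (auto simp: order.strict_iff_order)
  have mle: "Min (insert 1 (T - {t})) \<le> 1" "\<And>s. s \<in> T - {t} \<Longrightarrow> Min (insert 1 (T - {t})) \<le> s" using finT by auto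
  have u: "t < u" "u < 1" using mn mle(1) by (auto simp: u_def)
  have uT: "u < s" if "s \<in> T" "s \<noteq> t" for s using mle(2)[of s] that mn by (auto simp: u_def)
  have gu: "g u \<notin> \<Gamma>" using uT[of u] u t01 by (auto simp: T_def)
  let ?g1 = "subpath 0 u g" and ?g2 = "subpath u 1 g"
  have arcs: "arc ?g1" "arc ?g2" using g u t01 by (auto intro!: arc_subpath_arc)
  have im: "path_image ?g1 = g ` {0..u}" "path_image ?g2 = g ` {u..1}" using u t01 by (auto simp: path_image_subpath)
  have split: "path_image g = g ` {0..u} \<union> g ` {u..1}"
    unfolding path_image_def image_Un[symmetric] using u t01 by (simp add: ivl_disj_un)
  have clo: "closed (g ` {0..u})" "closed (g ` {u..1})"
    using u t01 by (intro compact_imp_closed compact_continuous_image continuous_on_subset[OF contg]; auto)+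
  have F1: "path_image ?g1 \<inter> \<Gamma> = {g t}"
  proof -
    have *: "s = t" if "s \<in> {0..u}" "g s \<in> \<Gamma>" for s using uT[of s] that u by (force simp: T_def)
    have "t \<in> {0..u}" "g t \<in> \<Gamma>" using tT u t01 by (auto simp: T_def)
    then have "{g t} \<subseteq> path_image ?g1 \<inter> \<Gamma>" unfolding im by blast
    moreover have "path_image ?g1 \<inter> \<Gamma> \<subseteq> {g t}" unfolding im
    proof
      fix y assume "y \<in> g ` {0..u} \<inter> \<Gamma>"
      then obtain s where "s \<in> {0..u}" "y = g s" "g s \<in> \<Gamma>" by blast
      then show "y \<in> {g t}" using *[of s] by simp
    qed
    ultimately show ?thesis by (rule equalityI[rotated])
  qed
  have F2: "path_image ?g2 \<inter> \<Gamma> = g ` (T - {t})"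
  proof -
    have "{s \<in> {u..1}. g s \<in> \<Gamma>} = T - {t}" using u uT t01 by (auto simp: T_def less_imp_le)
    then show ?thesis unfolding im by blast
  qed
  have gtu: "g t \<notin> g ` {u..1}"
  proof
    assume "g t \<in> g ` {u..1}"
    then obtain s where "s \<in> {u..1}" "g t = g s" by auto
    then show False using inj_onD[OF injg, of t s] u t01 by auto
  qed
  have "proper_crossing \<Gamma> (path_image g) (g t)" using Suc.prems(6) gT tT by blast
  then have "proper_crossing \<Gamma> (path_image ?g1) (g t)"
    by (rule proper_crossing_local[where W = "- g ` {u..1}"]) (use clo gtu split im in auto)
  then have side1: "g 0 \<in> inside \<Gamma> \<longleftrightarrow> g u \<notin> inside \<Gamma>"
    using single_crossing_separates[OF J arcs(1) F1] Suc.prems(4) gu by (simp add: subpath_def)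
  have pc2: "proper_crossing \<Gamma> (path_image ?g2) p" if p: "p \<in> path_image ?g2 \<inter> \<Gamma>" for p
  proof -
    obtain s where s: "s \<in> T" "s \<noteq> t" "p = g s" using p unfolding F2 by blast
    have "p \<notin> g ` {0..u}"
    proof
      assume "p \<in> g ` {0..u}"
      then obtain r where "r \<in> {0..u}" "g s = g r" using s by auto
      then show False using inj_onD[OF injg, of s r] uT[OF s(1,2)] u t01 s by (auto simp: T_def)
    qed
    then have "p \<in> - g ` {0..u}" by blast
    moreover have "proper_crossing \<Gamma> (path_image g) p" using Suc.prems(6) gT s by blast
    moreover have "path_image g \<inter> - g ` {0..u} = path_image ?g2 \<inter> - g ` {0..u}" unfolding split im by blast
    ultimately show ?thesis using proper_crossing_local open_Compl[OF clo(1)] by blast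
  qed
  have "card (path_image ?g2 \<inter> \<Gamma>) = n"
    unfolding F2 using cardT finT tT injg by (subst card_image) (auto simp: T_def intro: inj_on_subset)
  moreover have "finite (path_image ?g2 \<inter> \<Gamma>)" unfolding F2 using finT by auto
  ultimately have "(?g2 0 \<in> inside \<Gamma> \<longleftrightarrow> ?g2 1 \<in> inside \<Gamma>) \<longleftrightarrow> even n"
    using arcs(2) pc2 gu Suc.prems(5) by (intro Suc.IH) (simp_all add: subpath_def)
  then show ?case using side1 by (auto simp: subpath_def)
qed

section \<open>Arcs as point sets, and closed curves assembled from them\<close>

definition arc_between :: "complex set \<Rightarrow> complex \<Rightarrow> complex \<Rightarrow> bool" where
  "arc_between S x y \<longleftrightarrow> (\<exists>g. arc g \<and> path_image g = S \<and> pathstart g = x \<and> pathfinish g = y)"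

lemma arc_between_sym: "arc_between S x y \<Longrightarrow> arc_between S y x"
  unfolding arc_between_def using arc_reversepath path_image_reversepath pathstart_reversepath pathfinish_reversepath
  by metis

lemma arc_between_ends:
  assumes "arc_between S x y"
  shows "x \<in> S" "y \<in> S" "x \<noteq> y" "compact S" "closed S" "connected S"
  using assms unfolding arc_between_def
  by (auto simp: arc_imp_path connected_path_image compact_arc_image closed_arc_image dest: arc_distinct_ends)

lemma arc_between_punctured:
  assumes "arc_between S x y"
  shows "connected (S - {x})" "connected (S - {y})" "connected (S - {x, y})" "S - {x, y} \<noteq> {}"
proof -
  obtain g where g: "arc g" "path_image g = S" "g 0 = x" "g 1 = y"
    using assms by (auto simp: arc_between_def pathstart_def pathfinish_def)
  have contg: "continuous_on {0..1} g" and injg: "inj_on g {0..1}" using g by (auto simp: arc_def path_def)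
  have diff: "S - g ` B = g ` ({0..1} - B)" if "B \<subseteq> {0..1}" for B
    using inj_on_image_set_diff[OF injg _ that, of "{0..1}"] g(2) by (auto simp: path_image_def)
  have "{0..1} - {0} = {0<..1::real}" "{0..1} - {1} = {0..<1::real}" "{0..1} - {0,1} = {0<..<1::real}" by auto
  then have "S - {x} = g ` {0<..1}" "S - {y} = g ` {0..<1}" "S - {x,y} = g ` {0<..<1}"
    using diff[of "{0}"] diff[of "{1}"] diff[of "{0,1}"] g(3,4) by auto
  then show "connected (S - {x})" "connected (S - {y})" "connected (S - {x, y})" "S - {x, y} \<noteq> {}"
    by (simp_all, (intro connected_continuous_image continuous_on_subset[OF contg]; auto)+)
qed

lemma arc_between_join:
  assumes "arc_between S x y" "arc_between T y z" "S \<inter> T = {y}"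
  shows "arc_between (S \<union> T) x z"
proof -
  obtain g h where "arc g" "path_image g = S" "pathstart g = x" "pathfinish g = y"
    "arc h" "path_image h = T" "pathstart h = y" "pathfinish h = z"
    using assms by (auto simp: arc_between_def)
  then show ?thesis unfolding arc_between_def using assms(3)
    by (intro exI[of _ "g +++ h"]) (auto simp: arc_join path_image_join)
qed

lemma arc_between_split:
  assumes "arc_between S x y" "p \<in> S" "p \<noteq> x" "p \<noteq> y"
  obtains S1 S2 where "S = S1 \<union> S2" "S1 \<inter> S2 = {p}" "arc_between S1 x p" "arc_between S2 p y"
proof -
  obtain g where g: "arc g" "path_image g = S" "g 0 = x" "g 1 = y"
    using assms by (auto simp: arc_between_def pathstart_def pathfinish_def)
  have injg: "inj_on g {0..1}" using g by (auto simp: arc_def)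
  obtain t where t: "t \<in> {0..1}" "g t = p" using assms(2) g by (auto simp: path_image_def)
  have t01: "0 < t" "t < 1" using t assms g by (auto simp: order.strict_iff_order)
  have "arc_between (g ` {0..t}) x p" unfolding arc_between_def
    using t t01 g by (intro exI[of _ "subpath 0 t g"]) (auto intro!: arc_subpath_arc simp: path_image_subpath)
  moreover have "arc_between (g ` {t..1}) p y" unfolding arc_between_def
    using t t01 g by (intro exI[of _ "subpath t 1 g"]) (auto intro!: arc_subpath_arc simp: path_image_subpath)
  moreover have "S = g ` {0..t} \<union> g ` {t..1}"
    unfolding g(2)[symmetric] path_image_def image_Un[symmetric] using t01 by (simp add: ivl_disj_un)
  moreover have "g ` {0..t} \<inter> g ` {t..1} = g ` ({0..t} \<inter> {t..1})"
    using t01 by (intro inj_on_image_Int[OF injg, symmetric]) auto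
  then have "g ` {0..t} \<inter> g ` {t..1} = {p}" using t t01 by auto
  ultimately show ?thesis by (intro that)
qed

lemma jordan_curve_two_arcs:
  assumes "arc_between S x y" "arc_between T x y" "S \<inter> T = {x, y}"
  shows "jordan_curve (S \<union> T)"
proof -
  obtain g h where "arc g" "path_image g = S" "pathstart g = x" "pathfinish g = y"
    "arc h" "path_image h = T" "pathstart h = y" "pathfinish h = x"
    using assms arc_between_sym[OF assms(2)] by (auto simp: arc_between_def)
  then show ?thesis unfolding jordan_curve_def using assms(3)
    by (intro exI[of _ "g +++ h"]) (auto simp: simple_path_join_loop path_image_join)
qed

lemma jordan_curve_three_arcs:
  assumes "arc_between A x y" "arc_between B y z" "arc_between C x z" "A \<inter> B = {y}" "B \<inter> C = {z}" "A \<inter> C = {x}"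
  shows "jordan_curve (A \<union> B \<union> C)"
  using assms by (intro jordan_curve_two_arcs[of _ x z] arc_between_join) auto

text \<open>S meets each of the three arcs at most once and never where two of them meet, so its
  number of crossings with the closed curve is a sum of three indicators. The arcs may be edges or
  pieces of edges: the lemma serves triangles of edges as well as closed curves through a crossing
  point.\<close>

lemma side_parity:
  assumes J: "jordan_curve (A \<union> B \<union> C)" and S: "arc_between S d e" "d \<notin> A \<union> B \<union> C" "e \<notin> A \<union> B \<union> C"
    and closed: "closed A" "closed B" "closed C"
    and disj: "S \<inter> A \<inter> B = {}" "S \<inter> A \<inter> C = {}" "S \<inter> B \<inter> C = {}"
    and unique: "\<And>p q. p \<in> S \<inter> A \<Longrightarrow> q \<in> S \<inter> A \<Longrightarrow> p = q" "\<And>p q. p \<in> S \<inter> B \<Longrightarrow> q \<in> S \<inter> B \<Longrightarrow> p = q"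
       "\<And>p q. p \<in> S \<inter> C \<Longrightarrow> q \<in> S \<inter> C \<Longrightarrow> p = q"
    and proper: "\<And>p. p \<in> S \<inter> A \<Longrightarrow> proper_crossing A S p" "\<And>p. p \<in> S \<inter> B \<Longrightarrow> proper_crossing B S p"
       "\<And>p. p \<in> S \<inter> C \<Longrightarrow> proper_crossing C S p"
  shows "((d \<in> inside (A \<union> B \<union> C)) \<noteq> (e \<in> inside (A \<union> B \<union> C))) \<longleftrightarrow>
     ((S \<inter> A \<noteq> {}) \<noteq> ((S \<inter> B \<noteq> {}) \<noteq> (S \<inter> C \<noteq> {})))"
proof -
  obtain g where g: "arc g" "path_image g = S" "g 0 = d" "g 1 = e"
    using S by (auto simp: arc_between_def pathstart_def pathfinish_def)
  have single: "finite Y \<and> card Y = of_bool (Y \<noteq> {})" if "\<And>p q. p \<in> Y \<Longrightarrow> q \<in> Y \<Longrightarrow> p = q" for Y :: "complex set"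
  proof (cases "Y = {}")
    case False
    then obtain p where "p \<in> Y" by auto
    then have "Y = {p}" using that by blast
    then show ?thesis by simp
  qed simp
  have "finite (S \<inter> A) \<and> card (S \<inter> A) = of_bool (S \<inter> A \<noteq> {})"
    "finite (S \<inter> B) \<and> card (S \<inter> B) = of_bool (S \<inter> B \<noteq> {})"
    "finite (S \<inter> C) \<and> card (S \<inter> C) = of_bool (S \<inter> C \<noteq> {})"
    by (rule single, erule (1) unique)+
  then have fin: "finite (S \<inter> A)" "finite (S \<inter> B)" "finite (S \<inter> C)"
    and card: "card (S \<inter> A) = of_bool (S \<inter> A \<noteq> {})" "card (S \<inter> B) = of_bool (S \<inter> B \<noteq> {})" "card (S \<inter> C) = of_bool (S \<inter> C \<noteq> {})" by blast+
  have eq: "path_image g \<inter> (A \<union> B \<union> C) = (S \<inter> A) \<union> (S \<inter> B) \<union> (S \<inter> C)" using g by auto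
  have "card ((S \<inter> A) \<union> (S \<inter> B) \<union> (S \<inter> C)) = card ((S \<inter> A) \<union> (S \<inter> B)) + card (S \<inter> C)"
    by (rule card_Un_disjoint) (use fin disj in \<open>simp_all, blast\<close>)
  also have "card ((S \<inter> A) \<union> (S \<inter> B)) = card (S \<inter> A) + card (S \<inter> B)"
    by (rule card_Un_disjoint) (use fin disj in \<open>simp_all, blast\<close>)
  finally have "card ((S \<inter> A) \<union> (S \<inter> B) \<union> (S \<inter> C)) = card (S \<inter> A) + card (S \<inter> B) + card (S \<inter> C)" .
  then have n: "card (path_image g \<inter> (A \<union> B \<union> C)) = of_bool (S \<inter> A \<noteq> {}) + of_bool (S \<inter> B \<noteq> {}) + of_bool (S \<inter> C \<noteq> {})"
    using eq card by simp
  have "proper_crossing (A \<union> B \<union> C) (path_image g) p" if p: "p \<in> path_image g \<inter> (A \<union> B \<union> C)" for p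
  proof -
    consider "p \<in> S \<inter> A" | "p \<in> S \<inter> B" | "p \<in> S \<inter> C" using p unfolding eq by blast
    then show ?thesis
    proof cases
      case 1
      have "open (- (B \<union> C))" using closed by (intro open_Compl closed_Un)
      moreover have "p \<in> - (B \<union> C)" using 1 disj by blast
      moreover have "A \<inter> - (B \<union> C) = (A \<union> B \<union> C) \<inter> - (B \<union> C)" by blast
      ultimately show ?thesis using proper_crossing_local[OF proper(1)[OF 1]] g(2) by blast
    next
      case 2
      have "open (- (A \<union> C))" using closed by (intro open_Compl closed_Un)
      moreover have "p \<in> - (A \<union> C)" using 2 disj by blast
      moreover have "B \<inter> - (A \<union> C) = (A \<union> B \<union> C) \<inter> - (A \<union> C)" by blast
      ultimately show ?thesis using proper_crossing_local[OF proper(2)[OF 2]] g(2) by blast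
    next
      case 3
      have "open (- (A \<union> B))" using closed by (intro open_Compl closed_Un)
      moreover have "p \<in> - (A \<union> B)" using 3 disj by blast
      moreover have "C \<inter> - (A \<union> B) = (A \<union> B \<union> C) \<inter> - (A \<union> B)" by blast
      ultimately show ?thesis using proper_crossing_local[OF proper(3)[OF 3]] g(2) by blast
    qed
  qed
  moreover have "finite (path_image g \<inter> (A \<union> B \<union> C))" unfolding eq using fin by blast
  moreover have "g 0 \<notin> A \<union> B \<union> C" "g 1 \<notin> A \<union> B \<union> C" using g S by simp_all
  ultimately have "(g 0 \<in> inside (A \<union> B \<union> C) \<longleftrightarrow> g 1 \<in> inside (A \<union> B \<union> C)) \<longleftrightarrow>
     even (of_bool (S \<inter> A \<noteq> {}) + of_bool (S \<inter> B \<noteq> {}) + of_bool (S \<inter> C \<noteq> {}) :: nat)"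
    using crossing_parity[OF J g(1) _ n] by blast
  then show ?thesis unfolding g(3,4)
    by (cases "S \<inter> A = {}"; cases "S \<inter> B = {}"; cases "S \<inter> C = {}") simp_all
qed

text \<open>Near p the arms B and D bound a quadrant of the chart. A segment from a point of B to a
  point of D meets the axes only at its ends, so it misses A and C, and the chart is chosen off K.
  Away from p the arms do not meet the curve.\<close>

lemma crossing_arms_same_side:
  assumes J: "jordan_curve (A \<union> C \<union> K)" and pc: "proper_crossing (A \<union> B) (C \<union> D) p"
    and B: "arc_between B p b" "(B - {p}) \<inter> (A \<union> C \<union> K) = {}"
    and D: "arc_between D p d" "(D - {p}) \<inter> (A \<union> C \<union> K) = {}"
    and K: "closed K" "p \<notin> K"
  shows "b \<in> inside (A \<union> C \<union> K) \<longleftrightarrow> d \<in> inside (A \<union> C \<union> K)"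
proof -
  let ?\<Gamma> = "A \<union> C \<union> K"
  have W: "open (- K)" "p \<in> - K" using K by auto
  obtain U h k where U: "open U" "p \<in> U" "U \<subseteq> - K" and hom: "homeomorphism U (ball 0 1) h k" and hp: "h p = 0"
    and AB: "h ` ((A \<union> B) \<inter> U) = {z \<in> ball 0 1. Im z = 0}" and CD: "h ` ((C \<union> D) \<inter> U) = {z \<in> ball 0 1. Re z = 0}"
    by (rule proper_crossing_shrink[OF pc W])
  have hk: "h (k z) = z" "k z \<in> U" if "z \<in> ball 0 1" for z
    using hom that by (auto simp: homeomorphism_def)
  have kh: "k (h x) = x" "h x \<in> ball 0 1" if "x \<in> U" for x using hom that by (auto simp: homeomorphism_def)
  have contk: "continuous_on (ball 0 1) k" using hom by (auto simp: homeomorphism_def)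
  \<comment> \<open>A connected set with more than one point has no isolated points, so each arm has
    points other than p inside the chart.\<close>
  have near: "\<exists>y. y \<in> Y \<and> y \<in> U \<and> y \<noteq> p" if Y: "arc_between Y p q" for Y q
  proof -
    have "p \<in> Y" "q \<in> Y" "p \<noteq> q" "connected Y" using arc_between_ends[OF Y] by blast+
    then have "p islimpt Y" by (intro connected_imp_perfect) blast+
    then show ?thesis using U(1,2) unfolding islimpt_def by blast
  qed
  obtain b' where b': "b' \<in> B" "b' \<in> U" "b' \<noteq> p" using near[OF B(1)] by blast
  obtain d' where d': "d' \<in> D" "d' \<in> U" "d' \<noteq> p" using near[OF D(1)] by blast
  have ne: "h b' \<noteq> 0" "h d' \<noteq> 0" using kh b' d' U hp by metis+
  have axis: "Im (h b') = 0" "Re (h d') = 0" using AB CD b' d' by blast+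
  define L where "L = closed_segment (h b') (h d')"
  have Lball: "L \<subseteq> ball 0 1" unfolding L_def
    using kh b' d' by (intro closed_segment_subset) auto
  have Laxis: "(Im z = 0 \<longrightarrow> z = h b') \<and> (Re z = 0 \<longrightarrow> z = h d')" if z: "z \<in> L" for z
  proof -
    obtain u where u: "z = (1 - u) *\<^sub>R h b' + u *\<^sub>R h d'" using z unfolding L_def in_segment by blast
    have "Re (h b') \<noteq> 0" "Im (h d') \<noteq> 0" using ne axis by (auto simp: complex_eq_iff)
    moreover have "Im z = u * Im (h d')" "Re z = (1 - u) * Re (h b')" using u axis by auto
    ultimately show ?thesis using u by auto
  qed
  have "k ` L \<inter> ?\<Gamma> = {}"
  proof (rule ccontr)
    assume "\<not> ?thesis"
    then obtain z where z: "z \<in> L" "k z \<in> ?\<Gamma>" by blast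
    have zb: "z \<in> ball 0 1" using z Lball by blast
    have kU: "k z \<in> U" "h (k z) = z" using hk[OF zb] by auto
    then consider "k z \<in> A" | "k z \<in> C" using z U by blast
    then show False
    proof cases
      case 1
      then have "z \<in> h ` ((A \<union> B) \<inter> U)" using kU by force
      then have "z = h b'" using Laxis[OF z(1)] unfolding AB by blast
      then have "k z = b'" using kh b' by simp
      then show False using 1 B(2) b' by blast
    next
      case 2
      then have "z \<in> h ` ((C \<union> D) \<inter> U)" using kU by force
      then have "z = h d'" using Laxis[OF z(1)] unfolding CD by blast
      then have "k z = d'" using kh d' by simp
      then show False using 2 D(2) d' by blast
    qed
  qed
  moreover have "connected (k ` L)" unfolding L_def
    using Lball L_def by (intro connected_continuous_image continuous_on_subset[OF contk] connected_segment) auto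
  moreover have "b' \<in> k ` L" "d' \<in> k ` L"
    using kh(1)[OF b'(2)] kh(1)[OF d'(2)] unfolding L_def by (metis ends_in_segment imageI)+
  ultimately have "b' \<in> inside ?\<Gamma> \<longleftrightarrow> d' \<in> inside ?\<Gamma>" by (intro connected_same_side[OF J])
  moreover have "b' \<in> inside ?\<Gamma> \<longleftrightarrow> b \<in> inside ?\<Gamma>"
    using arc_between_punctured(1)[OF B(1)] arc_between_ends(2,3)[OF B(1)] b' B(2)
    by (intro connected_same_side[OF J, of "B - {p}"]) auto
  moreover have "d' \<in> inside ?\<Gamma> \<longleftrightarrow> d \<in> inside ?\<Gamma>"
    using arc_between_punctured(1)[OF D(1)] arc_between_ends(2,3)[OF D(1)] d' D(2)
    by (intro connected_same_side[OF J, of "D - {p}"]) auto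
  ultimately show ?thesis by blast
qed

lemma connected_insert_closure:
  assumes "connected S" "x \<in> closure S"
  shows "connected (insert x S)"
  by (rule connected_intermediate_closure[OF assms(1)]) (use assms(2) closure_subset in auto)

text \<open>Were both chords on one side, the curve would fail to separate its other side from them.
  Only the closures of the sides and Janiszewski's theorem are used; the theorem applies because C
  \<union> P and C \<union> P' meet exactly in the connected set C.\<close>

lemma interleaved_chords_opposite_sides:
  assumes P: "arc_between P x y" "arc_between P' x y" "P \<inter> P' = {x, y}"
    and C: "arc_between C x y" "C \<inter> (P \<union> P') = {x, y}"
    and C': "arc_between C' z w" "C' \<inter> (P \<union> P') = {z, w}" "z \<in> P - P'" "w \<in> P' - P"
    and disj: "C \<inter> C' = {}" and u: "u \<in> C - {x, y}" and u': "u' \<in> C' - {z, w}"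
  shows "u \<in> inside (P \<union> P') \<longleftrightarrow> u' \<notin> inside (P \<union> P')"
proof (rule ccontr)
  assume same: "\<not> ?thesis"
  let ?\<Gamma> = "P \<union> P'"
  have J: "jordan_curve ?\<Gamma>" using jordan_curve_two_arcs[OF P] .
  note JD = jordan_curveD[OF J]
  \<comment> \<open>R is the side without u', and by the assumption \<open>same\<close> it does not
    contain u either; so both chords avoid R.\<close>
  define R where "R = (if u' \<in> inside ?\<Gamma> then outside ?\<Gamma> else inside ?\<Gamma>)"
  have R: "R \<noteq> {}" "connected R" "R \<inter> ?\<Gamma> = {}" "frontier R = ?\<Gamma>" "R = inside ?\<Gamma> \<or> R = outside ?\<Gamma>"
    unfolding R_def using JD by (auto split: if_splits)
  have side: "v \<in> R \<longleftrightarrow> v' \<in> R" if "connected S" "S \<inter> ?\<Gamma> = {}" "v \<in> S" "v' \<in> S" for S v v'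
    using connected_same_side[OF J that] R(5) JD(7,8) that by blast
  have u'R: "u' \<notin> R"
  proof (cases "u' \<in> inside ?\<Gamma>")
    case True
    then have "R = outside ?\<Gamma>" by (simp add: R_def)
    then show ?thesis using True JD(7) by blast
  qed (simp add: R_def)
  have uR: "u \<notin> R"
  proof (cases "u' \<in> inside ?\<Gamma>")
    case True
    then have "R = outside ?\<Gamma>" by (simp add: R_def)
    then show ?thesis using True same JD(7) by blast
  qed (use same in \<open>simp add: R_def\<close>)
  have CR: "C \<inter> R = {}"
  proof -
    have "v \<notin> R" if "v \<in> C - {x,y}" for v
      using side[OF arc_between_punctured(3)[OF C(1)] _ that u] C(2) uR by blast
    then show ?thesis using C(2) R(3) by blast
  qed
  obtain r where r: "r \<in> R" using R(1) by blast
  have clo: "v \<in> closure R" if "v \<in> ?\<Gamma>" for v using that R(4) by (auto simp: frontier_def)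
  have wz: "w \<in> ?\<Gamma>" "z \<in> ?\<Gamma>" "w \<notin> C" "z \<notin> C" "w \<in> C'" "z \<in> C'"
    using C'(3,4) disj arc_between_ends(1,2)[OF C'(1)] by auto
  \<comment> \<open>The side R avoiding both chords reaches u' through w off C and P, and through z off C and P';
    by Janiszewski's theorem it reaches u' off their union.\<close>
  have 1: "connected_component (- (C \<union> P)) r u'"
  proof -
    have "connected (insert w R)" using connected_insert_closure[OF R(2) clo[OF wz(1)]] .
    moreover have "insert w R \<subseteq> - (C \<union> P)" using CR R(3) wz C'(4) by blast
    ultimately have "connected_component (- (C \<union> P)) r w" using r unfolding connected_component_def by blast
    moreover have "connected (C' - {z})" using arc_between_punctured(1)[OF C'(1)] .
    moreover have "C' - {z} \<subseteq> - (C \<union> P)" using disj C'(2,4) by blast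
    ultimately show ?thesis
      using u' wz arc_between_ends(3)[OF C'(1)] connected_component_trans[of "- (C \<union> P)" r w u']
      unfolding connected_component_def[of _ w u'] by blast
  qed
  have 2: "connected_component (- (C \<union> P')) r u'"
  proof -
    have "connected (insert z R)" using connected_insert_closure[OF R(2) clo[OF wz(2)]] .
    moreover have "insert z R \<subseteq> - (C \<union> P')" using CR R(3) wz C'(3) by blast
    ultimately have "connected_component (- (C \<union> P')) r z" using r unfolding connected_component_def by blast
    moreover have "connected (C' - {w})" using arc_between_punctured(2)[OF C'(1)] .
    moreover have "C' - {w} \<subseteq> - (C \<union> P')"
    proof
      fix q assume q: "q \<in> C' - {w}"
      have "q \<notin> P'"
      proof
        assume "q \<in> P'"
        then have "q \<in> {z, w}" using C'(2) q by blast
        then show False using q \<open>q \<in> P'\<close> C'(3) by simp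
      qed
      then show "q \<in> - (C \<union> P')" using disj q by blast
    qed
    ultimately show ?thesis
      using u' wz arc_between_ends(3)[OF C'(1)] connected_component_trans[of "- (C \<union> P')" r z u']
      unfolding connected_component_def[of _ z u'] by blast
  qed
  have "(C \<union> P) \<inter> (C \<union> P') = C \<union> (P \<inter> P')" by blast
  also have "\<dots> = C" unfolding P(3) using arc_between_ends(1,2)[OF C(1)] by blast
  finally have "connected_component (- ((C \<union> P) \<union> (C \<union> P'))) r u'"
    using arc_between_ends(4,5,6)[OF C(1)] arc_between_ends(4,5)[OF P(1)] arc_between_ends(4,5)[OF P(2)]
    by (intro Janiszewski 1 2) (auto intro: compact_Un closed_Un)
  then obtain T where "connected T" "T \<subseteq> - ((C \<union> P) \<union> (C \<union> P'))" "r \<in> T" "u' \<in> T"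
    unfolding connected_component_def by blast
  then show False using side[of T r u'] r u'R by blast
qed

section \<open>Crossing patterns of five and six vertices\<close>

text \<open>
  Read \<open>X a b c d\<close> as ``the edges ab and cd cross''. The Boolean \<open>ac\<close> says that the edge ea crosses cd
  between c and the point p common to ab and cd, and similarly for the other Booleans. Each of the last four
  equations belongs to one of the Jordan curves through p, such as a-p-c-a: it has b and d on the same side.
\<close>

definition quadrant_parities :: "('a \<Rightarrow> 'a \<Rightarrow> 'a \<Rightarrow> 'a \<Rightarrow> bool) \<Rightarrow> 'a \<Rightarrow> 'a \<Rightarrow> 'a \<Rightarrow> 'a \<Rightarrow> 'a \<Rightarrow> bool"
  where "quadrant_parities X a b c d e \<longleftrightarrow>
   (\<exists>ac ad bc bd ca cb da db.
      (X e a c d \<longleftrightarrow> ac \<or> ad) \<and> \<not> (ac \<and> ad) \<and> (X e b c d \<longleftrightarrow> bc \<or> bd) \<and> \<not> (bc \<and> bd) \<and>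
      (X e c a b \<longleftrightarrow> ca \<or> cb) \<and> \<not> (ca \<and> cb) \<and> (X e d a b \<longleftrightarrow> da \<or> db) \<and> \<not> (da \<and> db) \<and>
      ((X e b a c \<noteq> bc) \<longleftrightarrow> (X e d a c \<noteq> da)) \<and>
      ((X e b a d \<noteq> bd) \<longleftrightarrow> (X e c a d \<noteq> ca)) \<and>
      ((X e a b c \<noteq> ac) \<longleftrightarrow> (X e d b c \<noteq> db)) \<and>
      ((X e a b d \<noteq> ad) \<longleftrightarrow> (X e c b d \<noteq> cb)))"

text \<open>The cyclic order around a vertex and the color rules are derived from these properties
  alone. \<open>K5\<close> lists all fifteen pairs of disjoint edges. In
  \<open>disjoint_triangles\<close> the nine terms count, mod 2, the crossings between the triangles
  abc and def.\<close>

locale crossing_system =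
  fixes V :: "'a set" and X :: "'a \<Rightarrow> 'a \<Rightarrow> 'a \<Rightarrow> 'a \<Rightarrow> bool"
  assumes X_left: "X a b c d = X b a c d"
    and X_swap: "X a b c d = X c d a b"
    and K4: "\<lbrakk>{a,b,c,d} \<subseteq> V; distinct [a,b,c,d]; X a b c d\<rbrakk> \<Longrightarrow> \<not> X a c b d"
    and quadrants: "\<lbrakk>{a,b,c,d,e} \<subseteq> V; distinct [a,b,c,d,e]; X a b c d\<rbrakk> \<Longrightarrow> quadrant_parities X a b c d e"
    and K5: "\<lbrakk>{a,b,c,d,e} \<subseteq> V; distinct [a,b,c,d,e]\<rbrakk> \<Longrightarrow>
       X a b c d \<or> X a c b d \<or> X a d b c \<or> X a b c e \<or> X a c b e \<or> X a e b c \<or>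
       X a b e d \<or> X a e b d \<or> X a d b e \<or> X a e c d \<or> X a c e d \<or> X a d e c \<or>
       X e b c d \<or> X e c b d \<or> X e d b c"
    and disjoint_triangles: "\<lbrakk>{a,b,c,d,e,f} \<subseteq> V; distinct [a,b,c,d,e,f]\<rbrakk> \<Longrightarrow>
       (X a b d e \<noteq> (X b c d e \<noteq> X a c d e)) =
      ((X a b d f \<noteq> (X b c d f \<noteq> X a c d f)) \<noteq> (X a b e f \<noteq> (X b c e f \<noteq> X a c e f)))"
begin

lemma X_right: "X a b c d = X a b d c"
  by (metis X_left X_swap)

lemmas X_sym = X_left X_right X_swap

text \<open>
  The closed curves vij and vkl meet in v and at crossings, so they cross an odd number of times iff
  vi, vj and vk, vl alternate around v.
\<close>

definition sep :: "'a \<Rightarrow> 'a \<Rightarrow> 'a \<Rightarrow> 'a \<Rightarrow> 'a \<Rightarrow> bool" where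
  "sep v i j k l \<longleftrightarrow> (X i j k l \<noteq> (X v i k l \<noteq> (X v j k l \<noteq> (X v k i j \<noteq> X v l i j))))"

lemma X_forms:
  "X b a c d = X a b c d" "X a b d c = X a b c d" "X b a d c = X a b c d"
  "X c d a b = X a b c d" "X d c a b = X a b c d" "X c d b a = X a b c d" "X d c b a = X a b c d"
  by (metis X_sym)+

lemma at_most_one_crossing:
  assumes "{a,b,c,d} \<subseteq> V" "distinct [a,b,c,d]"
  shows "\<not> (X a b c d \<and> X a c b d)" (is ?G1) "\<not> (X a b c d \<and> X a d b c)" (is ?G2) "\<not> (X a c b d \<and> X a d b c)" (is ?G3)
proof -
  show ?G1 using assms K4 by blast
  show ?G2 using assms K4[of a b d c] X_sym by (metis distinct_length_2_or_more insert_commute)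
  show ?G3 using assms K4[of a c d b] X_sym by (metis distinct_length_2_or_more insert_commute)
qed

text \<open>At most one of the three pairs of opposite edges crosses, so the disjunction is a sum
  mod 2. This makes the later parity arguments linear.\<close>

lemma crossed_iff_xor:
  assumes "{a,b,c,d} \<subseteq> V" "distinct [a,b,c,d]"
  shows "(X a b c d \<or> X a c b d \<or> X a d b c) = (X a b c d \<noteq> (X a c b d \<noteq> X a d b c))"
  using at_most_one_crossing[OF assms] by argo

definition crossed :: "'a \<Rightarrow> 'a \<Rightarrow> 'a \<Rightarrow> 'a \<Rightarrow> bool" where
  "crossed a b c d \<longleftrightarrow> X a b c d \<or> X a c b d \<or> X a d b c"

lemma crossed_sym: "crossed a b c d = crossed b a c d" "crossed a b c d = crossed a c b d" "crossed a b c d = crossed a b d c"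
  unfolding crossed_def by (metis X_sym)+

text \<open>Add up the twelve crossings of the four quadruples consisting of e and three of a, b, c,
  d. After substituting the eight equations of \<open>quadrant_parities\<close>, every half-edge
  Boolean and every remaining crossing occurs exactly twice.\<close>

lemma quadrant_parity:
  assumes V: "{a,b,c,d,e} \<subseteq> V" and d: "distinct [a,b,c,d,e]" and x: "X a b c d"
  shows "\<not> (crossed e a b c \<noteq> (crossed e a b d \<noteq> (crossed e a c d \<noteq> crossed e b c d)))"
proof -
  \<comment> \<open>Hiding the exclusive or behind a constant lets rewriting treat it as the
    addition of a commutative group of exponent 2.\<close>
  define xor where "xor = (\<lambda>a b::bool. a \<noteq> b)"
  have xor: "xor a b = xor b a" "xor (xor a b) c = xor a (xor b c)" "xor a (xor b c) = xor b (xor a c)"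
    "xor a (xor a b) = b" "xor a a = False" "xor False a = a" "xor a False = a" for a b c
    unfolding xor_def by argo+
  obtain ac ad bc bd ca cb da db where q:
    "X e a c d \<longleftrightarrow> ac \<or> ad" "\<not> (ac \<and> ad)" "X e b c d \<longleftrightarrow> bc \<or> bd" "\<not> (bc \<and> bd)"
    "X e c a b \<longleftrightarrow> ca \<or> cb" "\<not> (ca \<and> cb)" "X e d a b \<longleftrightarrow> da \<or> db" "\<not> (da \<and> db)"
    "(X e b a c \<noteq> bc) \<longleftrightarrow> (X e d a c \<noteq> da)" "(X e b a d \<noteq> bd) \<longleftrightarrow> (X e c a d \<noteq> ca)"
    "(X e a b c \<noteq> ac) \<longleftrightarrow> (X e d b c \<noteq> db)" "(X e a b d \<noteq> ad) \<longleftrightarrow> (X e c b d \<noteq> cb)"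
    using quadrants[OF V d x] unfolding quadrant_parities_def by (elim exE conjE) (rule that)
  have q': "X e a c d = xor ac ad" "X e b c d = xor bc bd" "X e c a b = xor ca cb" "X e d a b = xor da db"
    "X e b a c = xor (X e d a c) (xor da bc)" "X e b a d = xor (X e c a d) (xor ca bd)"
    "X e a b c = xor (X e d b c) (xor db ac)" "X e a b d = xor (X e c b d) (xor cb ad)"
    unfolding xor_def using q by argo+
  have s: "{e,a,b,c} \<subseteq> V" "distinct [e,a,b,c]" "{e,a,b,d} \<subseteq> V" "distinct [e,a,b,d]"
    "{e,a,c,d} \<subseteq> V" "distinct [e,a,c,d]" "{e,b,c,d} \<subseteq> V" "distinct [e,b,c,d]"
    using V d by auto
  have c: "crossed e a b c = xor (X e a b c) (xor (X e b a c) (X e c a b))"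
    "crossed e a b d = xor (X e a b d) (xor (X e b a d) (X e d a b))"
    "crossed e a c d = xor (X e a c d) (xor (X e c a d) (X e d a c))"
    "crossed e b c d = xor (X e b c d) (xor (X e c b d) (X e d b c))"
    unfolding crossed_def xor_def using crossed_iff_xor[OF s(1,2)] crossed_iff_xor[OF s(3,4)]
      crossed_iff_xor[OF s(5,6)] crossed_iff_xor[OF s(7,8)] by argo+
  have "xor (crossed e a b c) (xor (crossed e a b d) (xor (crossed e a c d) (crossed e b c d))) = False"
    unfolding c q' by (simp only: xor)
  then show ?thesis unfolding xor_def by argo
qed

lemma crossed_parity:
  assumes V: "{a,b,c,d,e} \<subseteq> V" and d: "distinct [a,b,c,d,e]" and x: "crossed a b c d"
  shows "\<not> (crossed e a b c \<noteq> (crossed e a b d \<noteq> (crossed e a c d \<noteq> crossed e b c d)))"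
proof -
  have "X a b c d \<or> X a c b d \<or> X a d b c" using x by (simp add: crossed_def)
  then show ?thesis
  proof (elim disjE)
    assume "X a b c d" then show ?thesis using quadrant_parity[OF V d] by blast
  next
    assume "X a c b d"
    then have "\<not> (crossed e a c b \<noteq> (crossed e a c d \<noteq> (crossed e a b d \<noteq> crossed e c b d)))"
      by (intro quadrant_parity) (use V d in auto)
    then show ?thesis using crossed_sym(2)[of e b c d] crossed_sym(3)[of e a b c] by argo
  next
    assume "X a d b c"
    then have "\<not> (crossed e a d b \<noteq> (crossed e a d c \<noteq> (crossed e a b c \<noteq> crossed e d b c)))"
      by (intro quadrant_parity) (use V d in auto)
    then show ?thesis using crossed_sym(3)[of e a b d] crossed_sym(3)[of e a c d] crossed_sym(2)[of e b d c] crossed_sym(3)[of e b c d] by argo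
  qed
qed

text \<open>\<open>K5\<close> yields one crossed quadruple, and \<open>crossed_parity\<close> makes
  the number of crossed ones among the other four even. This is the classical fact that a simple
  drawing of the complete graph on five vertices has an odd number of crossings.\<close>

lemma crossed_odd:
  assumes V: "{a,b,c,d,e} \<subseteq> V" and d: "distinct [a,b,c,d,e]"
  shows "crossed a b c d \<noteq> (crossed a b c e \<noteq> (crossed a b d e \<noteq> (crossed a c d e \<noteq> crossed b c d e)))"
proof -
  have F: "crossed e a b c = crossed a b c e" "crossed e a b d = crossed a b d e" "crossed e a c d = crossed a c d e"
     "crossed e b c d = crossed b c d e"
     "crossed d a b c = crossed a b c d" "crossed d a b e = crossed a b d e" "crossed d a c e = crossed a c d e"
     "crossed d b c e = crossed b c d e"
     "crossed c a b d = crossed a b c d" "crossed c a b e = crossed a b c e" "crossed c a d e = crossed a c d e"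
     "crossed c b d e = crossed b c d e"
     "crossed b a c d = crossed a b c d" "crossed b a c e = crossed a b c e" "crossed b a d e = crossed a b d e"
    by (metis crossed_sym)+
  have "crossed a b c d \<or> crossed a b c e \<or> crossed a b d e \<or> crossed a c d e \<or> crossed b c d e"
    using K5[OF V d] unfolding crossed_def by (metis X_sym)
  moreover have
    "crossed a b c d \<Longrightarrow> \<not> (crossed e a b c \<noteq> (crossed e a b d \<noteq> (crossed e a c d \<noteq> crossed e b c d)))"
    "crossed a b c e \<Longrightarrow> \<not> (crossed d a b c \<noteq> (crossed d a b e \<noteq> (crossed d a c e \<noteq> crossed d b c e)))"
    "crossed a b d e \<Longrightarrow> \<not> (crossed c a b d \<noteq> (crossed c a b e \<noteq> (crossed c a d e \<noteq> crossed c b d e)))"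
    "crossed a c d e \<Longrightarrow> \<not> (crossed b a c d \<noteq> (crossed b a c e \<noteq> (crossed b a d e \<noteq> crossed b c d e)))"
    "crossed b c d e \<Longrightarrow> \<not> (crossed a b c d \<noteq> (crossed a b c e \<noteq> (crossed a b d e \<noteq> crossed a c d e)))"
    by (rule crossed_parity; use V d in auto)+
  ultimately show ?thesis unfolding F by argo
qed

text \<open>The half-edge Booleans are eliminated here. What remains are clauses in X alone, simple
  enough to be instantiated for all crossings among five vertices at once.\<close>

lemma quadrant_consequences:
  assumes V: "{a,b,c,d,e} \<subseteq> V" and d: "distinct [a,b,c,d,e]" and x: "X a b c d"
  shows "(X e a b c \<longrightarrow> X e a c d \<or> X e d b c \<or> X e d a b) \<and>
     (X e a b d \<longrightarrow> X e a c d \<or> X e c b d \<or> X e c a b) \<and>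
     (X e b a c \<longrightarrow> X e b c d \<or> X e d a c \<or> X e d a b) \<and>
     (X e b a d \<longrightarrow> X e b c d \<or> X e c a d \<or> X e c a b) \<and>
     (X e c a d \<longrightarrow> X e c a b \<or> X e b a d \<or> X e b c d) \<and>
     (X e c b d \<longrightarrow> X e c a b \<or> X e a b d \<or> X e a c d) \<and>
     (X e d a c \<longrightarrow> X e d a b \<or> X e b a c \<or> X e b c d) \<and>
     (X e d b c \<longrightarrow> X e d a b \<or> X e a b c \<or> X e a c d)" (is ?A)
    "(X e a c d \<and> X e b c d \<longrightarrow> X e a b c \<or> X e b a c \<or> X e c a b) \<and>
     (X e c a b \<and> X e d a b \<longrightarrow> X e c a d \<or> X e d a c \<or> X e a c d)" (is ?B)
    "(X e a b c \<and> X e a b d \<longrightarrow> X e c b d \<or> X e d b c) \<and>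
     (X e b a c \<and> X e b a d \<longrightarrow> X e c a d \<or> X e d a c) \<and>
     (X e c a d \<and> X e c b d \<longrightarrow> X e a b d \<or> X e b a d) \<and>
     (X e d a c \<and> X e d b c \<longrightarrow> X e a b c \<or> X e b a c)" (is ?C)
proof -
  obtain ac ad bc bd ca cb da db where q:
    "X e a c d \<longleftrightarrow> ac \<or> ad" "\<not> (ac \<and> ad)" "X e b c d \<longleftrightarrow> bc \<or> bd" "\<not> (bc \<and> bd)"
    "X e c a b \<longleftrightarrow> ca \<or> cb" "\<not> (ca \<and> cb)" "X e d a b \<longleftrightarrow> da \<or> db" "\<not> (da \<and> db)"
    "(X e b a c \<noteq> bc) \<longleftrightarrow> (X e d a c \<noteq> da)" "(X e b a d \<noteq> bd) \<longleftrightarrow> (X e c a d \<noteq> ca)"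
    "(X e a b c \<noteq> ac) \<longleftrightarrow> (X e d b c \<noteq> db)" "(X e a b d \<noteq> ad) \<longleftrightarrow> (X e c b d \<noteq> cb)"
    using quadrants[OF V d x] unfolding quadrant_parities_def by (elim exE conjE) (rule that)
  have s: "{e,a,b,c} \<subseteq> V" "distinct [e,a,b,c]" "{e,a,b,d} \<subseteq> V" "distinct [e,a,b,d]"
    "{e,a,c,d} \<subseteq> V" "distinct [e,a,c,d]" "{e,b,c,d} \<subseteq> V" "distinct [e,b,c,d]"
    using V d by auto
  note t = at_most_one_crossing[OF s(1,2)] at_most_one_crossing[OF s(3,4)]
     at_most_one_crossing[OF s(5,6)] at_most_one_crossing[OF s(7,8)]
  show ?A
    using q by argo
  show ?B
    using q t by argo
  show ?C
    using q t by argo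
qed

text \<open>The three values of \<open>sep\<close> together contain each of the fifteen pairs of
  disjoint edges exactly once, so the first claim is \<open>crossed_odd\<close>. The last five
  claims become the color rules: their premise, that vi, vk alternate with vj, vl, expresses the
  cyclic order i, j, k, l around v.\<close>

lemma K5_color_rules:
  assumes V: "{v,i,j,k,l} \<subseteq> V" and d: "distinct [v,i,j,k,l]"
  shows "sep v i j k l \<noteq> (sep v i k j l \<noteq> sep v i l j k)" (is ?T1) and "\<not> (sep v i j k l \<and> sep v i k j l)" (is ?T2)
    and "sep v i k j l \<Longrightarrow> X v i j k \<Longrightarrow> X v i j l \<Longrightarrow> X v j k l \<Longrightarrow> X v i k l" (is "PROP ?R1")
    and "sep v i k j l \<Longrightarrow> X v j i k \<Longrightarrow> X v j i l \<Longrightarrow> X v k j l \<Longrightarrow> X v k i l" (is "PROP ?R2")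
    and "sep v i k j l \<Longrightarrow> X v k i j \<Longrightarrow> X v l i j \<Longrightarrow> X v l j k \<Longrightarrow> X v l i k" (is "PROP ?R3")
    and "sep v i k j l \<Longrightarrow> \<not> (X v i j k \<or> X v j i k) \<Longrightarrow> \<not> (X v i j l \<or> X v j i l) \<Longrightarrow> \<not> (X v j k l \<or> X v k j l) \<Longrightarrow> \<not> (X v i k l \<or> X v k i l)" (is "PROP ?R4")
    and "sep v i k j l \<Longrightarrow> \<not> (X v i j k \<or> X v j i k \<or> X v k i j) \<Longrightarrow> \<not> (X v i j l \<or> X v j i l \<or> X v l i j) \<Longrightarrow>
       \<not> (X v i k l \<or> X v k i l \<or> X v l i k) \<Longrightarrow> \<not> (X v j k l \<or> X v k j l) \<Longrightarrow> \<not> X v l j k" (is "PROP ?R5")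
proof -
  have s: "{v,i,j,k} \<subseteq> V" "distinct [v,i,j,k]" "{v,i,j,l} \<subseteq> V" "distinct [v,i,j,l]"
    "{v,i,k,l} \<subseteq> V" "distinct [v,i,k,l]" "{v,j,k,l} \<subseteq> V" "distinct [v,j,k,l]" "{i,j,k,l} \<subseteq> V" "distinct [i,j,k,l]"
    using V d by auto
  note t = at_most_one_crossing[OF s(1,2)] at_most_one_crossing[OF s(3,4)]
     at_most_one_crossing[OF s(5,6)] at_most_one_crossing[OF s(7,8)] at_most_one_crossing[OF s(9,10)]
  have ds: "v \<noteq> i" "v \<noteq> j" "v \<noteq> k" "v \<noteq> l" "i \<noteq> v" "i \<noteq> j" "i \<noteq> k" "i \<noteq> l" "j \<noteq> v" "j \<noteq> i" "j \<noteq> k" "j \<noteq> l" "k \<noteq> v" "k \<noteq> i" "k \<noteq> j" "k \<noteq> l" "l \<noteq> v" "l \<noteq> i" "l \<noteq> j" "l \<noteq> k" "v \<in> V" "i \<in> V" "j \<in> V" "k \<in> V" "l \<in> V"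
    using V d by auto
  \<comment> \<open>One instance for each choice of the fifth vertex and of the pairing of the other
    four: fifteen in all.\<close>
  note Q = quadrant_consequences[of v i j k l]
    quadrant_consequences[of v j i k l]
    quadrant_consequences[of v k i j l]
    quadrant_consequences[of v i j l k]
    quadrant_consequences[of v j i l k]
    quadrant_consequences[of v l i j k]
    quadrant_consequences[of v i k l j]
    quadrant_consequences[of v k i l j]
    quadrant_consequences[of v l i k j]
    quadrant_consequences[of v j k l i]
    quadrant_consequences[of v k j l i]
    quadrant_consequences[of v l j k i]
    quadrant_consequences[of i j k l v]
    quadrant_consequences[of i k j l v]
    quadrant_consequences[of i l j k v]
  note Q' = Q[unfolded insert_subset distinct.simps list.set insert_iff empty_iff, simplified ds simp_thms empty_subsetI]
  note F = X_forms[of i v j k]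
    X_forms[of j v i k]
    X_forms[of k v i j]
    X_forms[of i v j l]
    X_forms[of j v i l]
    X_forms[of l v i j]
    X_forms[of i v k l]
    X_forms[of k v i l]
    X_forms[of l v i k]
    X_forms[of j v k l]
    X_forms[of k v j l]
    X_forms[of l v j k]
    X_forms[of j i k l]
    X_forms[of k i j l]
    X_forms[of l i j k]
  note o = crossed_odd[OF V d, unfolded crossed_def crossed_iff_xor[OF s(1,2)] crossed_iff_xor[OF s(3,4)]
     crossed_iff_xor[OF s(5,6)] crossed_iff_xor[OF s(7,8)] crossed_iff_xor[OF s(9,10)]]
  note all = t Q' F o
  show ?T1 unfolding sep_def using o F by argo
  show ?T2 unfolding sep_def using all by (smt (verit))
  show "PROP ?R1"
    unfolding sep_def using all by (smt (verit))
  show "PROP ?R2"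
    unfolding sep_def using all by (smt (verit))
  show "PROP ?R3"
    unfolding sep_def using all by (smt (verit))
  show "PROP ?R4"
    unfolding sep_def using all by (smt (verit))
  show "PROP ?R5"
    unfolding sep_def using all by (smt (verit))
qed

section \<open>The cyclic order around a vertex\<close>

lemma sep_sym: "sep v i j k l = sep v j i k l" "sep v i j k l = sep v k l i j" "sep v i j k l = sep v i j l k"
  unfolding sep_def using X_forms[of i j k l] X_forms[of v i k l] X_forms[of v j k l] X_forms[of v k i j] X_forms[of v l i j]
    X_forms[of i v k l] X_forms[of j v k l] X_forms[of k v i j] X_forms[of l v i j]
  by argo+

text \<open>The triangles vij, vim and vjm add up mod 2 to the triangle ijm, which crosses vkl
  evenly by \<open>disjoint_triangles\<close>.\<close>

lemma sep_additive:
  assumes V: "{v,i,j,m,k,l} \<subseteq> V" and d: "distinct [v,i,j,m,k,l]"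
  shows "sep v i j k l = (sep v i m k l \<noteq> sep v j m k l)"
proof -
  have "{i,j,m,v,k,l} \<subseteq> V" "distinct [i,j,m,v,k,l]" using V d by auto
  note t = disjoint_triangles[OF this]
  note F = X_forms[of v k i j] X_forms[of v l i j] X_forms[of v k i m] X_forms[of v l i m] X_forms[of v k j m] X_forms[of v l j m]
  show ?thesis unfolding sep_def using t F by argo
qed

text \<open>Cutting a cyclic order at b makes it linear, and of three points in a linear order
  exactly one lies between the others. Here this follows from the first two claims of
  \<open>K5_color_rules\<close>.\<close>

lemma exactly_one_between:
  assumes V: "{v,b,x,y,z} \<subseteq> V" and d: "distinct [v,b,x,y,z]"
  shows "sep v x z b y \<noteq> (sep v y z b x \<noteq> sep v x y b z)" (is ?G1)
    "\<not> (sep v x z b y \<and> sep v y z b x)" (is ?G2) "\<not> (sep v x z b y \<and> sep v x y b z)" (is ?G3) "\<not> (sep v y z b x \<and> sep v x y b z)" (is ?G4)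
proof -
  have s: "{v,x,y,z,b} \<subseteq> V" "distinct [v,x,y,z,b]" using V d by auto
  note s2 = sep_sym(3)[of v x y z b] sep_sym(2)[of v x b y z] sep_sym(2)[of v y z x b] sep_sym(3)[of v y z x b] sep_sym(3)[of v x z y b]
  note f = K5_color_rules(1,2)[OF s]
  show ?G1
    ?G2 ?G3 ?G4
    using f s2 by argo+
qed

text \<open>The assumption \<open>side\<close> says that R lies on one of the two arcs into which b
  and e cut the circle around v. Reading this arc from e to b gives a linear order, and f enumerates
  R by rank.\<close>

lemma sep_order_aux:
  assumes R: "finite R" "R \<subseteq> V - {v,b,e}" and v: "{v,b,e} \<subseteq> V" "distinct [v,b,e]"
    and side: "\<And>x y. x \<in> R \<Longrightarrow> y \<in> R \<Longrightarrow> x \<noteq> y \<Longrightarrow> \<not> sep v x y b e"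
  shows "\<exists>f. bij_betw f {..<card R} R \<and>
    (\<forall>i j k l. i < j \<longrightarrow> j < k \<longrightarrow> k < l \<longrightarrow> l < card R \<longrightarrow> sep v (f i) (f k) (f j) (f l))"
proof -
  \<comment> \<open>Alternation of ve, vy with vb, vx places y between x and b on the arc.\<close>
  define lt where "lt x y \<longleftrightarrow> x \<in> R \<and> y \<in> R \<and> x \<noteq> y \<and> sep v e y b x" for x y
  have total: "lt x y \<noteq> lt y x" if "x \<in> R" "y \<in> R" "x \<noteq> y" for x y
  proof -
    have "{v,b,e,x,y} \<subseteq> V" "distinct [v,b,e,x,y]" using that R v by auto
    note exactly_one_between[OF this]
    then show ?thesis using side[OF that] that unfolding lt_def by metis
  qed
  have between: "sep v x z b y \<and> lt x z" if "lt x y" "lt y z" for x y z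
  proof -
    have ne: "x \<noteq> y" "y \<noteq> z" "x \<noteq> z" and xyz: "x \<in> R" "y \<in> R" "z \<in> R"
      using that total unfolding lt_def by metis+
    have V5: "{v,b,e,x,y} \<subseteq> V" "distinct [v,b,e,x,y]" "{v,b,e,y,z} \<subseteq> V" "distinct [v,b,e,y,z]"
        "{v,b,x,y,z} \<subseteq> V" "distinct [v,b,x,y,z]"
      using ne xyz R v by auto
    have V6: "{v,e,z,x,b,y} \<subseteq> V" "distinct [v,e,z,x,b,y]" "{v,e,z,y,b,x} \<subseteq> V" "distinct [v,e,z,y,b,x]"
      using ne xyz R v by auto
    have "\<not> lt y x" using total that ne xyz by metis
    then have "\<not> sep v e x b y" using ne xyz by (auto simp: lt_def)
    moreover have "sep v e z b y" "sep v e y b x" using that by (auto simp: lt_def)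
    moreover note sep_additive[OF V6(1,2)] sep_additive[OF V6(3,4)] exactly_one_between[OF V5(5,6)]
      sep_sym(1)[of v z x b y] sep_sym(1)[of v z y b x]
    ultimately have "sep v x z b y" "sep v e z b x" by smt+
    then show ?thesis using ne xyz unfolding lt_def by blast
  qed
  define r where "r x = card {y \<in> R. lt y x}" for x
  have fin: "finite {y \<in> R. lt y x}" for x using R by auto
  have r_mono: "r x < r y" if "lt x y" for x y
  proof -
    have "{z \<in> R. lt z x} \<subset> {z \<in> R. lt z y}"
    proof
      show "{z \<in> R. lt z x} \<subseteq> {z \<in> R. lt z y}" using between that by auto
      have "x \<in> {z \<in> R. lt z y}" "x \<notin> {z \<in> R. lt z x}" using that by (auto simp: lt_def)
      then show "{z \<in> R. lt z x} \<noteq> {z \<in> R. lt z y}" by blast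
    qed
    then show ?thesis unfolding r_def by (intro psubset_card_mono fin)
  qed
  have inj: "inj_on r R"
    by (rule inj_onI) (metis less_irrefl r_mono total)
  have "r x < card R" if "x \<in> R" for x
  proof -
    have "{y \<in> R. lt y x} \<subset> R" using that by (auto simp: lt_def)
    then show ?thesis unfolding r_def using R by (intro psubset_card_mono) auto
  qed
  then have im: "r ` R = {..<card R}"
    using inj R by (intro card_subset_eq) (auto simp: card_image)
  define f where "f = inv_into R r"
  have bij: "bij_betw f {..<card R} R"
    unfolding f_def using inj im by (simp add: bij_betw_inv_into bij_betw_imageI)
  have fR: "f i \<in> R" if "i < card R" for i using bij that by (auto simp: bij_betw_def)
  have rf: "r (f i) = i" if "i < card R" for i using im that unfolding f_def by (auto intro!: f_inv_into_f)
  have f_lt: "lt (f i) (f j)" if "i < j" "j < card R" for i j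
  proof -
    have "f i \<noteq> f j" using rf[of i] rf[of j] that by auto
    moreover have "\<not> lt (f j) (f i)" using r_mono[of "f j" "f i"] rf[of i] rf[of j] that by auto
    ultimately show ?thesis using total fR that by (meson less_trans)
  qed
  have "sep v (f i) (f k) (f j) (f l)" if h: "i < j" "j < k" "k < l" "l < card R" for i j k l
  proof -
    have lts: "lt (f i) (f j)" "lt (f j) (f k)" "lt (f i) (f k)" "lt (f k) (f l)" "lt (f j) (f l)" "lt (f i) (f l)"
      using h by (auto intro!: f_lt)
    have in4: "f i \<in> R" "f j \<in> R" "f k \<in> R" "f l \<in> R" using h by (auto intro!: fR)
    have ne: "distinct [f i, f j, f k, f l]" using lts by (auto simp: lt_def)
    have "{v, f j, f l, b, f i, f k} \<subseteq> V" "distinct [v, f j, f l, b, f i, f k]"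
      "{v,b,f i, f k, f l} \<subseteq> V" "distinct [v,b,f i, f k, f l]"
      using in4 ne R v by auto
    note sep_additive[OF this(1,2)] exactly_one_between[OF this(3,4)]
    moreover have "sep v (f i) (f k) b (f j)" using between lts by blast
    moreover have "sep v (f i) (f l) b (f k)" using between lts by blast
    moreover note sep_sym(2)[of v "f i" "f k" "f j" "f l"] sep_sym(2)[of v "f i" "f k" b "f j"] sep_sym(1)[of v "f j" b "f i" "f k"]
      sep_sym(2)[of v "f i" "f k" b "f l"] sep_sym(1)[of v "f l" b "f i" "f k"]
    ultimately show ?thesis by smt
  qed
  then show ?thesis using bij by blast
qed

text \<open>By additivity, lying on the same side of the cut at b and e is an equivalence with at
  most two classes, told apart by comparison with x0. The larger class is kept, hence the factor 2;
  the summand 3 accounts for v, b and e.\<close>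

lemma sep_order:
  assumes fin: "finite V" and v: "v \<in> V" and card: "2 * N + 3 \<le> card V"
  shows "\<exists>f. inj_on f {..<N} \<and> f ` {..<N} \<subseteq> V - {v} \<and>
    (\<forall>i j k l. i < j \<longrightarrow> j < k \<longrightarrow> k < l \<longrightarrow> l < N \<longrightarrow> sep v (f i) (f k) (f j) (f l))"
proof (cases "N = 0")
  case False
  have "card (V - {v}) \<ge> 2" using card v fin by simp
  then obtain b where b: "b \<in> V - {v}" by (metis card.empty ex_in_conv not_numeral_le_zero)
  have "card (V - {v,b}) \<ge> 1" using card v b fin by (auto simp: card_Diff_subset)
  then obtain e where e: "e \<in> V - {v,b}" by (metis card.empty ex_in_conv not_one_le_zero)
  define W where "W = V - {v,b,e}"
  have W: "card W \<ge> 2 * N" "finite W" using card v b e fin unfolding W_def by (auto simp: card_Diff_subset)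
  then obtain x0 where x0: "x0 \<in> W" using False by fastforce
  define R1 where "R1 = {x \<in> W. x = x0 \<or> \<not> sep v x0 x b e}"
  define R2 where "R2 = W - R1"
  have d: "distinct [v,b,e]" and V3: "{v,b,e} \<subseteq> V" using v b e by auto
  have add: "sep v x y b e = (sep v x0 x b e \<noteq> sep v x0 y b e)"
    if "x \<in> W" "y \<in> W" "x \<noteq> y" "x \<noteq> x0" "y \<noteq> x0" for x y
  proof -
    have "{v,x,y,x0,b,e} \<subseteq> V" "distinct [v,x,y,x0,b,e]" using that x0 d V3 unfolding W_def by auto
    from sep_additive[OF this] show ?thesis using sep_sym by metis
  qed
  have side1: "\<not> sep v x y b e" if "x \<in> R1" "y \<in> R1" "x \<noteq> y" for x y
    using that add[of x y] sep_sym(1)[of v x0 x b e] sep_sym(1)[of v x0 y b e] unfolding R1_def by auto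
  have side2: "\<not> sep v x y b e" if "x \<in> R2" "y \<in> R2" "x \<noteq> y" for x y
    using that add[of x y] x0 unfolding R1_def R2_def by auto
  have "card W = card R1 + card R2" unfolding R2_def R1_def using W(2)
    by (subst card_Un_disjoint[symmetric]) (auto intro: arg_cong[where f=card])
  then obtain R where R: "R = R1 \<or> R = R2" "card R \<ge> N" using W(1) by (metis add_le_mono less_imp_le_nat linorder_not_le mult_2 nat_less_le add_less_mono)
  have "finite R" "R \<subseteq> V - {v,b,e}" using R W unfolding R1_def R2_def W_def by auto
  moreover have "\<not> sep v x y b e" if "x \<in> R" "y \<in> R" "x \<noteq> y" for x y using that R side1 side2 by metis
  ultimately obtain f where f: "bij_betw f {..<card R} R"
    "\<forall>i j k l. i < j \<longrightarrow> j < k \<longrightarrow> k < l \<longrightarrow> l < card R \<longrightarrow> sep v (f i) (f k) (f j) (f l)"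
    using sep_order_aux[OF _ _ V3 d, of R] by metis
  have sub: "{..<N} \<subseteq> {..<card R}" using R by auto
  have "inj_on f {..<N}" using f(1) sub by (meson bij_betw_def inj_on_subset)
  moreover have "f ` {..<N} \<subseteq> V - {v}"
    using f(1) sub \<open>R \<subseteq> V - {v,b,e}\<close> by (auto simp: bij_betw_def)
  moreover have "\<forall>i j k l. i < j \<longrightarrow> j < k \<longrightarrow> k < l \<longrightarrow> l < N \<longrightarrow> sep v (f i) (f k) (f j) (f l)"
    using f(2) R(2) by (meson less_le_trans)
  ultimately show ?thesis by blast
qed auto
end

section \<open>Simple drawings of complete graphs\<close>

locale simple_complete_drawing =
  fixes G :: topgraph
  assumes simple: "simple_topological_graph G" and complete: "complete_graph G"
begin

abbreviation "V \<equiv> verts G"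

definition E :: "complex \<Rightarrow> complex \<Rightarrow> complex set" where
  "E u v = path_image (curve G {u, v})"

lemma E_sym: "E u v = E v u"
  by (simp add: E_def insert_commute)

lemma topological: "topological_graph G"
  using simple by (simp add: simple_topological_graph_def)

lemma finite_V: "finite V"
  using topological by (simp add: topological_graph_def)

lemma edge_iff: "{u, v} \<in> edges G \<longleftrightarrow> u \<in> V \<and> v \<in> V \<and> u \<noteq> v"
  using complete unfolding complete_graph_def by (auto simp: doubleton_eq_iff)

lemma edge_props:
  assumes "{u, v} \<in> edges G"
  shows "arc (curve G {u,v})" "{pathstart (curve G {u,v}), pathfinish (curve G {u,v})} = {u,v}" (is ?G2)
    "edge_interior G {u,v} \<inter> V = {}" (is ?G3)
proof -
  have "\<forall>e\<in>edges G. e \<subseteq> V \<and> arc (curve G e) \<and> {pathstart (curve G e), pathfinish (curve G e)} = e \<and>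
      edge_interior G e \<inter> V = {}"
    using topological unfolding topological_graph_def by (elim conjE)
  from bspec[OF this assms] show "arc (curve G {u,v})" ?G2
    ?G3 by blast+
qed

lemma E_arc: assumes "u \<in> V" "v \<in> V" "u \<noteq> v" shows "arc_between (E u v) u v"
proof -
  have "arc (curve G {u,v})" "{pathstart (curve G {u,v}), pathfinish (curve G {u,v})} = {u,v}"
    using edge_props[of u v] assms by (simp_all add: edge_iff)
  then have "arc_between (E u v) u v \<or> arc_between (E u v) v u"
    unfolding arc_between_def E_def by (auto simp: doubleton_eq_iff)
  then show ?thesis using arc_between_sym by blast
qed

lemma E_ends: assumes "u \<in> V" "v \<in> V" "u \<noteq> v" shows "u \<in> E u v" "v \<in> E u v"
  using arc_between_ends[OF E_arc[OF assms]] by auto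

lemma E_closed: assumes "u \<in> V" "v \<in> V" "u \<noteq> v" shows "closed (E u v)"
  using arc_between_ends[OF E_arc[OF assms]] by auto

lemma E_verts: assumes "u \<in> V" "v \<in> V" "u \<noteq> v" "w \<in> V" "w \<in> E u v" shows "w = u \<or> w = v"
proof -
  have "edge_interior G {u,v} \<inter> V = {}"
    using edge_props[of u v] assms by (simp add: edge_iff)
  then show ?thesis using assms unfolding edge_interior_def E_def by blast
qed

lemma E_unique:
  assumes "u \<in> V" "v \<in> V" "u \<noteq> v" "w \<in> V" "x \<in> V" "w \<noteq> x" "{u,v} \<noteq> {w,x}"
    "p \<in> E u v" "p \<in> E w x" "q \<in> E u v" "q \<in> E w x"
  shows "p = q"
proof -
  have "{u,v} \<in> edges G" "{w,x} \<in> edges G" using assms by (simp_all add: edge_iff)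
  then show ?thesis using simple assms(7-) unfolding simple_topological_graph_def E_def by simp
qed

lemma E_adjacent:
  assumes "a \<in> V" "b \<in> V" "c \<in> V" "distinct [a,b,c]"
  shows "E a b \<inter> E a c = {a}"
proof -
  have "a \<in> E a b" "a \<in> E a c" using assms E_ends by auto
  moreover have "{a,b} \<noteq> {a,c}" using assms by (auto simp: doubleton_eq_iff)
  then have "p = a" if "p \<in> E a b" "p \<in> E a c" for p
    using E_unique[of a b a c p a] assms that calculation by simp
  ultimately show ?thesis by blast
qed

lemma disjoint_edges:
  assumes "{a,b,c,d} \<subseteq> V" "distinct [a,b,c,d]" "p \<in> E a b" "p \<in> E c d"
  shows "p \<notin> V" "proper_crossing (E a b) (E c d) p" "q \<in> E a b \<Longrightarrow> q \<in> E c d \<Longrightarrow> p = q"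
proof -
  show notV: "p \<notin> V" using E_verts[of a b p] E_verts[of c d p] assms by auto
  have ne: "{a,b} \<noteq> {c,d}" using assms by (auto simp: doubleton_eq_iff)
  have "{a,b} \<in> edges G" "{c,d} \<in> edges G" using assms by (simp_all add: edge_iff)
  moreover note ne
  moreover have "p \<in> edge_interior G {a,b} \<inter> edge_interior G {c,d}"
    using notV assms unfolding edge_interior_def E_def by auto
  ultimately show "proper_crossing (E a b) (E c d) p"
    using topological unfolding topological_graph_def E_def by simp
  show "q \<in> E a b \<Longrightarrow> q \<in> E c d \<Longrightarrow> p = q"
    using E_unique[of a b c d p q] assms ne by simp
qed

definition X :: "complex \<Rightarrow> complex \<Rightarrow> complex \<Rightarrow> complex \<Rightarrow> bool" where
  "X a b c d \<longleftrightarrow> E a b \<inter> E c d \<noteq> {}"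

text \<open>X is a bare intersection and therefore also holds for edges with a common vertex. Such
  edges never cross, because in a simple drawing the common vertex is already their only common
  point.\<close>

lemma edges_cross_iff:
  assumes "u \<in> V" "v \<in> V" "u \<noteq> v" "w \<in> V" "x \<in> V" "w \<noteq> x"
  shows "edges_cross G {u,v} {w,x} \<longleftrightarrow> distinct [u,v,w,x] \<and> X u v w x"
proof (cases "distinct [u,v,w,x]")
  case True
  have ne: "{u,v} \<noteq> {w,x}" using True by (simp add: doubleton_eq_iff)
  have s: "{u,v,w,x} \<subseteq> V" using assms by simp
  have "edges_cross G {u,v} {w,x}" if p: "p \<in> E u v" "p \<in> E w x" for p
  proof -
    note de = disjoint_edges(1,2)[OF s True p]
    have "p \<notin> {u,v}" "p \<notin> {w,x}" using de(1) assms by auto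
    then have "p \<in> edge_interior G {u,v} \<inter> edge_interior G {w,x}" using p unfolding edge_interior_def E_def by simp
    then show ?thesis unfolding edges_cross_def using de(2) ne unfolding E_def by blast
  qed
  moreover have "\<exists>p. p \<in> E u v \<and> p \<in> E w x" if "edges_cross G {u,v} {w,x}"
    using that unfolding edges_cross_def edge_interior_def E_def by blast
  ultimately show ?thesis using True unfolding X_def by blast
next
  case False
  have "\<not> edges_cross G {u,v} {w,x}"
  proof
    assume "edges_cross G {u,v} {w,x}"
    then obtain p where p: "p \<in> E u v" "p \<in> E w x" "p \<notin> {u,v}" "p \<notin> {w,x}"
      unfolding edges_cross_def edge_interior_def E_def by blast
    have ne: "{u,v} \<noteq> {w,x}" using \<open>edges_cross G {u,v} {w,x}\<close> by (simp add: edges_cross_def)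
    obtain r where r: "r \<in> {u,v}" "r \<in> {w,x}" using False assms by auto
    then have "r \<in> E u v" "r \<in> E w x" using E_ends assms by auto
    then have "p = r" using E_unique[OF assms ne p(1,2)] by blast
    then show False using r p by blast
  qed
  then show ?thesis using False by blast
qed

lemma triangle_side_parity:
  assumes V: "{a,b,c,d,e} \<subseteq> V" and ds: "distinct [a,b,c,d,e]"
  shows "((d \<in> inside (E a b \<union> E b c \<union> E a c)) \<noteq> (e \<in> inside (E a b \<union> E b c \<union> E a c))) \<longleftrightarrow>
    (X a b d e \<noteq> (X b c d e \<noteq> X a c d e))" (is "?L \<longleftrightarrow> _")
proof -
  have in5: "a \<in> V" "b \<in> V" "c \<in> V" "d \<in> V" "e \<in> V" using V by auto
  have ne: "a \<noteq> b" "a \<noteq> c" "b \<noteq> c" "d \<noteq> e" "d \<notin> {a,b,c}" "e \<notin> {a,b,c}" using ds by auto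
  have adj: "E a b \<inter> E b c = {b}" "E b c \<inter> E a c = {c}" "E a b \<inter> E a c = {a}"
    using E_adjacent[of b a c] E_adjacent[of c b a] E_adjacent[of a b c] in5 ne by (auto simp: E_sym)
  have J: "jordan_curve (E a b \<union> E b c \<union> E a c)"
    by (rule jordan_curve_three_arcs[of _ a b _ c]) (use E_arc in5 ne adj in auto)
  have notin: "v \<notin> E a b \<union> E b c \<union> E a c" if "v \<in> V" "v \<notin> {a,b,c}" for v
    using E_verts in5 ne that by blast
  have notde: "v \<notin> E d e" if "v \<in> {a,b,c}" for v
    using E_verts[of d e v] in5 ne that by auto
  have pc: "proper_crossing (E x y) (E d e) p" "p \<in> E d e \<inter> E x y \<Longrightarrow> q \<in> E d e \<inter> E x y \<Longrightarrow> p = q"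
    if "{x,y} \<subseteq> {a,b,c}" "x \<noteq> y" "p \<in> E d e \<inter> E x y" for x y p q
    using disjoint_edges[of x y d e p] that in5 ne by auto
  have "?L \<longleftrightarrow>
    ((E d e \<inter> E a b \<noteq> {}) \<noteq> ((E d e \<inter> E b c \<noteq> {}) \<noteq> (E d e \<inter> E a c \<noteq> {})))"
  proof (rule side_parity[OF J E_arc[OF in5(4,5) ne(4)] notin[OF in5(4) ne(5)] notin[OF in5(5) ne(6)]])
    show "closed (E a b)" "closed (E b c)" "closed (E a c)" using E_closed in5 ne by auto
    show "E d e \<inter> E a b \<inter> E b c = {}" "E d e \<inter> E a b \<inter> E a c = {}" "E d e \<inter> E b c \<inter> E a c = {}"
      using adj notde by blast+
  qed (use pc ne in \<open>(blast | metis insert_subset insertCI subset_refl empty_subsetI)+\<close>)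
  then show ?thesis unfolding X_def by (simp add: Int_commute)
qed

text \<open>By \<open>triangle_side_parity\<close>, an edge of def crosses abc an odd number of
  times iff its ends lie on different sides, and walking once around def returns to the starting
  side.\<close>

lemma disjoint_triangles_even:
  assumes V: "{a,b,c,d,e,f} \<subseteq> V" and ds: "distinct [a,b,c,d,e,f]"
  shows "(X a b d e \<noteq> (X b c d e \<noteq> X a c d e)) =
      ((X a b d f \<noteq> (X b c d f \<noteq> X a c d f)) \<noteq> (X a b e f \<noteq> (X b c e f \<noteq> X a c e f)))"
  using triangle_side_parity[of a b c d e] triangle_side_parity[of a b c d f] triangle_side_parity[of a b c e f] V ds
  by auto

section \<open>The four quadrants at a crossing point\<close>

definition crossing_at :: "complex \<Rightarrow> complex \<Rightarrow> complex \<Rightarrow> complex \<Rightarrow> complex \<Rightarrow>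
    complex set \<Rightarrow> complex set \<Rightarrow> complex set \<Rightarrow> complex set \<Rightarrow> bool" where
  "crossing_at a b c d p A B C D \<longleftrightarrow> {a,b,c,d} \<subseteq> V \<and> distinct [a,b,c,d] \<and>
     E a b = A \<union> B \<and> A \<inter> B = {p} \<and> arc_between A a p \<and> arc_between B b p \<and>
     E c d = C \<union> D \<and> C \<inter> D = {p} \<and> arc_between C c p \<and> arc_between D d p"

lemma crossing_atD:
  assumes "crossing_at a b c d p A B C D"
  shows "{a,b,c,d} \<subseteq> V" "distinct [a,b,c,d]"
    "E a b = A \<union> B" "A \<inter> B = {p}" "arc_between A a p" "arc_between B b p"
    "E c d = C \<union> D" "C \<inter> D = {p}" "arc_between C c p" "arc_between D d p"
  using assms unfolding crossing_at_def by argo+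

text \<open>These symmetries carry the quadrant between a and c to the other three, so the closed
  curve a-p-c-a is the only one that has to be studied.\<close>

lemma crossing_at_swap:
  assumes "crossing_at a b c d p A B C D"
  shows "crossing_at b a c d p B A C D" (is ?G1) "crossing_at a b d c p A B D C" (is ?G2)
proof -
  note D = crossing_atD[OF assms]
  show ?G1 unfolding crossing_at_def using D(1,2)
    by (intro conjI D) (auto simp: E_sym[of b a] D(3) Int_commute[of B A] D(4) Un_commute)
  show ?G2 unfolding crossing_at_def using D(1,2)
    by (intro conjI D) (auto simp: E_sym[of d c] D(7) Int_commute[of D C] D(8) Un_commute)
qed

lemma crossing_at_exists:
  assumes "{a,b,c,d} \<subseteq> V" "distinct [a,b,c,d]" "X a b c d"
  shows "\<exists>p A B C D. crossing_at a b c d p A B C D"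
proof -
  obtain p where p: "p \<in> E a b" "p \<in> E c d" using assms(3) by (auto simp: X_def)
  have pV: "p \<notin> V" using disjoint_edges[OF assms(1,2) p] by blast
  have in4: "a \<in> V" "b \<in> V" "c \<in> V" "d \<in> V" and ne: "a \<noteq> b" "c \<noteq> d" using assms by auto
  obtain A B where AB: "E a b = A \<union> B" "A \<inter> B = {p}" "arc_between A a p" "arc_between B p b"
    by (rule arc_between_split[OF E_arc[OF in4(1,2) ne(1)] p(1)]) (use pV in4 in auto)
  obtain C D where CD: "E c d = C \<union> D" "C \<inter> D = {p}" "arc_between C c p" "arc_between D p d"
    by (rule arc_between_split[OF E_arc[OF in4(3,4) ne(2)] p(2)]) (use pV in4 in auto)
  have "crossing_at a b c d p A B C D" unfolding crossing_at_def
    by (intro conjI assms(1,2) AB(1-3) CD(1-3) arc_between_sym[OF AB(4)] arc_between_sym[OF CD(4)])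
  then show ?thesis by blast
qed

context
  fixes a b c d p A B C D
  assumes x: "crossing_at a b c d p A B C D"
begin

lemma crossing_at_facts:
  "a \<in> V" "b \<in> V" "c \<in> V" "d \<in> V" "distinct [a,b,c,d]" "p \<notin> V"
  "E a b \<inter> E c d = {p}" "A \<inter> E a c = {a}" "C \<inter> E a c = {c}" "A \<inter> C = {p}" "p \<notin> E a c"
proof -
  note x' = crossing_atD(1-5,7-9)[OF x]
  then show in4: "a \<in> V" "b \<in> V" "c \<in> V" "d \<in> V" and ds: "distinct [a,b,c,d]" by auto
  have p: "p \<in> E a b" "p \<in> E c d" using x' by auto
  show pV: "p \<notin> V" using disjoint_edges(1)[OF x'(1,2) p] .
  show eq: "E a b \<inter> E c d = {p}" using disjoint_edges(3)[OF x'(1,2) p] p by blast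
  have "E a b \<inter> E a c = {a}" "E c d \<inter> E a c = {c}"
    using E_adjacent[of a b c] E_adjacent[of c d a] in4 ds by (auto simp: E_sym)
  moreover have "a \<in> A" "c \<in> C" "p \<in> A" "p \<in> C" using x' arc_between_ends by blast+
  ultimately show "A \<inter> E a c = {a}" "C \<inter> E a c = {c}" "A \<inter> C = {p}" "p \<notin> E a c"
    using x' eq pV in4 by blast+
qed

lemma crossing_at_imps:
  "q \<in> A \<Longrightarrow> q \<in> B \<Longrightarrow> q = p" "q \<in> C \<Longrightarrow> q \<in> D \<Longrightarrow> q = p"
  "q \<in> A \<union> B \<Longrightarrow> q \<in> C \<union> D \<Longrightarrow> q = p"
  "q \<in> A \<union> B \<Longrightarrow> q \<in> E a c \<Longrightarrow> q = a" "q \<in> C \<union> D \<Longrightarrow> q \<in> E a c \<Longrightarrow> q = c"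
  "a \<notin> B" "b \<notin> A" "c \<notin> D" "d \<notin> C"
proof -
  note f = crossing_at_facts and x' = crossing_atD[OF x]
  show AB: "q \<in> A \<Longrightarrow> q \<in> B \<Longrightarrow> q = p" and CD: "q \<in> C \<Longrightarrow> q \<in> D \<Longrightarrow> q = p" for q using x'(4,8) by blast+
  show "q \<in> A \<union> B \<Longrightarrow> q \<in> C \<union> D \<Longrightarrow> q = p" using f(7) unfolding x'(3,7) by blast
  have ac: "E a b \<inter> E a c = {a}" "E c d \<inter> E a c = {c}"
    using E_adjacent[of a b c] E_adjacent[of c d a] f(1-5) by (auto simp: E_sym)
  then show "q \<in> A \<union> B \<Longrightarrow> q \<in> E a c \<Longrightarrow> q = a" "q \<in> C \<union> D \<Longrightarrow> q \<in> E a c \<Longrightarrow> q = c"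
    unfolding x'(3,7) by blast+
  have "a \<in> A" "b \<in> B" "c \<in> C" "d \<in> D" using x'(5,6,9,10) arc_between_ends(1) by blast+
  then show "a \<notin> B" "b \<notin> A" "c \<notin> D" "d \<notin> C" using AB CD f(1-6) by metis+
qed

lemma quadrant_jordan: "jordan_curve (A \<union> C \<union> E a c)"
proof (rule jordan_curve_three_arcs[of _ a p _ c])
  show "arc_between A a p" by (rule crossing_atD(5)[OF x])
  show "arc_between C p c" by (rule arc_between_sym[OF crossing_atD(9)[OF x]])
  show "arc_between (E a c) a c" using E_arc crossing_at_facts(1-5) by auto
qed (use crossing_at_facts in auto)

lemma quadrant_same_side:
  "b \<in> inside (A \<union> C \<union> E a c) \<longleftrightarrow> d \<in> inside (A \<union> C \<union> E a c)"
proof (rule crossing_arms_same_side[OF quadrant_jordan, of B D p])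
  note f = crossing_at_facts
  note x' = crossing_atD(3,4,7,8)[OF x]
  have "proper_crossing (E a b) (E c d) p"
    by (rule disjoint_edges(2)) (use f in auto)
  then show "proper_crossing (A \<union> B) (C \<union> D) p" using x' by simp
  show "arc_between B p b" by (rule arc_between_sym[OF crossing_atD(6)[OF x]])
  show "arc_between D p d" by (rule arc_between_sym[OF crossing_atD(10)[OF x]])
  show "(B - {p}) \<inter> (A \<union> C \<union> E a c) = {}" "(D - {p}) \<inter> (A \<union> C \<union> E a c) = {}"
    using crossing_at_imps(1-5) crossing_at_imps(6,8) by blast+
  show "closed (E a c)" using E_closed f(1-5) by auto
  show "p \<notin> E a c" using f by blast
qed

text \<open>The assumptions \<open>ab\<close> and \<open>cd\<close> admit an S that ends in b or d,
  provided it misses A or C respectively. Hence every point of S on A or C comes from two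
  vertex-disjoint edges and is a proper crossing.\<close>

lemma quadrant_parity_arc:
  assumes S: "S = E u v" "u \<in> V" "v \<in> V" "u \<noteq> v" "u \<notin> {a,c}" "v \<notin> {a,c}" "p \<notin> S"
    and ab: "{u,v} \<inter> {a,b} = {} \<or> S \<inter> A = {}" and cd: "{u,v} \<inter> {c,d} = {} \<or> S \<inter> C = {}"
  shows "((u \<in> inside (A \<union> C \<union> E a c)) \<noteq> (v \<in> inside (A \<union> C \<union> E a c))) \<longleftrightarrow>
    ((S \<inter> A \<noteq> {}) \<noteq> ((S \<inter> C \<noteq> {}) \<noteq> (S \<inter> E a c \<noteq> {})))"
proof -
  note f = crossing_at_facts
  note x' = crossing_atD(3,4,7,8,5,6,9,10)[OF x]
  have ne: "a \<noteq> b" "c \<noteq> d" "a \<noteq> c" using f(5) by auto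
  have notin: "w \<notin> A \<union> C \<union> E a c" if "w \<in> V" "w \<notin> {a,c}" for w
  proof -
    have "w \<notin> A" using E_verts[OF f(1,2) ne(1) that(1)] crossing_at_imps(7) that(2) unfolding x'(1) by blast
    moreover have "w \<notin> C" using E_verts[OF f(3,4) ne(2) that(1)] crossing_at_imps(9) that(2) unfolding x'(3) by blast
    moreover have "w \<notin> E a c" using E_verts[OF f(1,3) ne(3) that(1)] that(2) by blast
    ultimately show ?thesis by blast
  qed
  have aS: "a \<notin> S" "c \<notin> S" using E_verts[OF S(2-4)] S f(1,3) by blast+
  have cl: "closed A" "closed B" "closed C" "closed D" using x' arc_between_ends(5) by blast+
  have crossA: "proper_crossing A S q \<and> (\<forall>r\<in>S \<inter> A. q = r)" if q: "q \<in> S \<inter> A" for q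
  proof -
    have d4: "{a,b,u,v} \<subseteq> V" "distinct [a,b,u,v]" using f S q ab by auto
    have qq: "q \<in> E a b" "q \<in> E u v" using q x' S by auto
    have "q \<notin> B" using q crossing_at_imps(1) S(7) by blast
    then have "q \<in> - B" by simp
    moreover have "E a b \<inter> - B = A \<inter> - B" "E u v \<inter> - B = S \<inter> - B" unfolding x'(1) S(1) by blast+
    ultimately have "proper_crossing A S q"
      using proper_crossing_local[OF disjoint_edges(2)[OF d4 qq] open_Compl[OF cl(2)]] by blast
    then show ?thesis using disjoint_edges(3)[OF d4 qq] unfolding x'(1) S(1) by blast
  qed
  have crossC: "proper_crossing C S q \<and> (\<forall>r\<in>S \<inter> C. q = r)" if q: "q \<in> S \<inter> C" for q
  proof -
    have d4: "{c,d,u,v} \<subseteq> V" "distinct [c,d,u,v]" using f S q cd by auto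
    have qq: "q \<in> E c d" "q \<in> E u v" using q x' S by auto
    have "q \<notin> D" using q crossing_at_imps(2) S(7) by blast
    then have "q \<in> - D" by simp
    moreover have "E c d \<inter> - D = C \<inter> - D" "E u v \<inter> - D = S \<inter> - D" unfolding x'(3) S(1) by blast+
    ultimately have "proper_crossing C S q"
      using proper_crossing_local[OF disjoint_edges(2)[OF d4 qq] open_Compl[OF cl(4)]] by blast
    then show ?thesis using disjoint_edges(3)[OF d4 qq] unfolding x'(3) S(1) by blast
  qed
  have crossE: "proper_crossing (E a c) S q \<and> (\<forall>r\<in>S \<inter> E a c. q = r)" if q: "q \<in> S \<inter> E a c" for q
  proof -
    have d4: "{a,c,u,v} \<subseteq> V" "distinct [a,c,u,v]" using f S by auto
    have qq: "q \<in> E a c" "q \<in> E u v" using q S by auto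
    show ?thesis using disjoint_edges(2,3)[OF d4 qq] S(1) by blast
  qed
  show ?thesis
  proof (rule side_parity[OF quadrant_jordan])
    show "arc_between S u v" using E_arc S by blast
    show "u \<notin> A \<union> C \<union> E a c" "v \<notin> A \<union> C \<union> E a c" using notin S by blast+
    show "closed A" "closed C" "closed (E a c)" using cl E_closed f(1,3) ne by blast+
    show "S \<inter> A \<inter> C = {}" "S \<inter> A \<inter> E a c = {}" "S \<inter> C \<inter> E a c = {}"
      using crossing_at_imps(3-5) aS S(7) by blast+
  qed (use crossA crossC crossE in blast)+
qed

text \<open>The edge bd meets ab only at b and cd only at d, so it avoids A and C. As b and d are on
  the same side of a-p-c-a, bd cannot cross the remaining arc ac a single time.\<close>

lemma K4_crossing: "\<not> X a c b d"
proof
  assume X: "X a c b d"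
  note f = crossing_at_facts
  note x' = crossing_atD(3,4,7,8,6,10)[OF x]
  have bd: "E b d \<inter> E a b = {b}" "E b d \<inter> E c d = {d}"
    using E_adjacent[of b d a] E_adjacent[of d b c] f(1-5) by (auto simp: E_sym)
  then have bd': "q = b" if "q \<in> E b d" "q \<in> A \<union> B" for q using that unfolding x'(1) by blast
  from bd have bd'': "q = d" if "q \<in> E b d" "q \<in> C \<union> D" for q using that unfolding x'(3) by blast
  have p: "p \<noteq> b" "p \<noteq> d" "p \<in> A" using f arc_between_ends(2)[OF crossing_atD(5)[OF x]] by auto
  have no: "E b d \<inter> A = {}" "E b d \<inter> C = {}" "p \<notin> E b d"
    using bd' bd'' p crossing_at_imps(7,9) by blast+
  have "((b \<in> inside (A \<union> C \<union> E a c)) \<noteq> (d \<in> inside (A \<union> C \<union> E a c))) \<longleftrightarrow>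
    ((E b d \<inter> A \<noteq> {}) \<noteq> ((E b d \<inter> C \<noteq> {}) \<noteq> (E b d \<inter> E a c \<noteq> {})))"
    by (rule quadrant_parity_arc) (use f no in auto)
  then show False using quadrant_same_side no X unfolding X_def by blast
qed

text \<open>Since b and d are on the same side of a-p-c-a, the edges eb and ed cross this curve
  equally often mod 2. Of the two arms on the curve, eb can only meet C and ed can only meet
  A.\<close>

lemma quadrant_equation:
  assumes e: "e \<in> V" "e \<notin> {a,b,c,d}"
  shows "(X e b a c \<noteq> (E e b \<inter> C \<noteq> {})) \<longleftrightarrow> (X e d a c \<noteq> (E e d \<inter> A \<noteq> {}))"
proof -
  note f = crossing_at_facts
  note x' = crossing_atD(3,4,7,8,6,10)[OF x]
  have eb: "E e b \<inter> E a b = {b}" "E e d \<inter> E c d = {d}"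
    using E_adjacent[of b e a] E_adjacent[of d e c] f(1-5) e by (auto simp: E_sym)
  then have eb': "q = b" if "q \<in> E e b" "q \<in> A \<union> B" for q using that unfolding x'(1) by blast
  from eb have ed': "q = d" if "q \<in> E e d" "q \<in> C \<union> D" for q using that unfolding x'(3) by blast
  have p: "p \<noteq> b" "p \<noteq> d" "p \<in> A" "p \<in> C"
    using f arc_between_ends(2)[OF crossing_atD(5)[OF x]] arc_between_ends(2)[OF crossing_atD(9)[OF x]] by auto
  have no: "E e b \<inter> A = {}" "E e d \<inter> C = {}" "p \<notin> E e b" "p \<notin> E e d"
    using eb' ed' p crossing_at_imps(7,9) by blast+
  have "((e \<in> inside (A \<union> C \<union> E a c)) \<noteq> (b \<in> inside (A \<union> C \<union> E a c))) \<longleftrightarrow>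
    ((E e b \<inter> A \<noteq> {}) \<noteq> ((E e b \<inter> C \<noteq> {}) \<noteq> (E e b \<inter> E a c \<noteq> {})))"
    by (rule quadrant_parity_arc) (use f no e in auto)
  moreover have "((e \<in> inside (A \<union> C \<union> E a c)) \<noteq> (d \<in> inside (A \<union> C \<union> E a c))) \<longleftrightarrow>
    ((E e d \<inter> A \<noteq> {}) \<noteq> ((E e d \<inter> C \<noteq> {}) \<noteq> (E e d \<inter> E a c \<noteq> {})))"
    by (rule quadrant_parity_arc) (use f no e in auto)
  ultimately show ?thesis using quadrant_same_side no(1,2) unfolding X_def by argo
qed

end

lemma crossing_at_commute:
  assumes "crossing_at a b c d p A B C D"
  shows "crossing_at c d a b p C D A B"
  unfolding crossing_at_def using crossing_atD(1,2)[OF assms]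
  by (intro conjI crossing_atD[OF assms]) auto

text \<open>The edge ea meets ab only at a, so it avoids p; as it meets cd at most once, it cannot
  meet both arms of cd.\<close>

lemma half_edges:
  assumes x: "crossing_at a b c d p A B C D" and e: "e \<in> V" "e \<notin> {a,b,c,d}"
  shows "X e a c d \<longleftrightarrow> E e a \<inter> C \<noteq> {} \<or> E e a \<inter> D \<noteq> {}" (is ?G1) "\<not> (E e a \<inter> C \<noteq> {} \<and> E e a \<inter> D \<noteq> {})" (is ?G2)
proof -
  note f = crossing_at_facts[OF x]
  note x' = crossing_atD(3,7,8)[OF x] arc_between_ends(2)[OF crossing_atD(5)[OF x]]
  show ?G1 unfolding X_def x' by blast
  have "E e a \<inter> E a b = {a}" using E_adjacent[of a e b] f(1-5) e by (auto simp: E_sym)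
  then have "p = a" if "p \<in> E e a" using x'(1,4) that by blast
  then have pe: "p \<notin> E e a" using f(1,6) by blast
  have d4: "{e,a,c,d} \<subseteq> V" "distinct [e,a,c,d]" using f(1-5) e by auto
  show ?G2
  proof
    assume "E e a \<inter> C \<noteq> {} \<and> E e a \<inter> D \<noteq> {}"
    then obtain q r where qr: "q \<in> E e a" "q \<in> C" "r \<in> E e a" "r \<in> D" by blast
    then have "q = r" by (intro disjoint_edges(3)[OF d4]) (auto simp: x'(2))
    then have "q \<in> C \<inter> D" using qr by simp
    then show False using qr(1) pe x'(3) by simp
  qed
qed

end

context simple_complete_drawing
begin

lemma quadrant_parities_X:
  assumes V: "{a,b,c,d,e} \<subseteq> V" and d: "distinct [a,b,c,d,e]" and X: "X a b c d"
  shows "quadrant_parities X a b c d e"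
proof -
  have "{a,b,c,d} \<subseteq> V" "distinct [a,b,c,d]" using V d by auto
  from crossing_at_exists[OF this X] obtain p A B C D where x: "crossing_at a b c d p A B C D" by blast
  note x1 = crossing_at_swap(1)[OF x] and x2 = crossing_at_swap(2)[OF x]
  note x3 = crossing_at_swap(2)[OF x1] and x4 = crossing_at_commute[OF x]
  note x5 = crossing_at_swap(1)[OF x4]
  have e: "e \<in> V" "e \<notin> {a,b,c,d}" using V d by auto
  have e': "e \<notin> {b,a,c,d}" "e \<notin> {a,b,d,c}" "e \<notin> {b,a,d,c}" "e \<notin> {c,d,a,b}" "e \<notin> {d,c,a,b}" using e(2) by auto
  show ?thesis unfolding quadrant_parities_def
  \<comment> \<open>The eight Booleans stay schematic until the claims fix them: \<open>ac\<close>
    becomes \<open>E e a \<inter> C \<noteq> {}\<close>, and so on.\<close>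
  proof (intro exI conjI)
    show "X e a c d \<longleftrightarrow> E e a \<inter> C \<noteq> {} \<or> E e a \<inter> D \<noteq> {}" "\<not> (E e a \<inter> C \<noteq> {} \<and> E e a \<inter> D \<noteq> {})"
      by (rule half_edges[OF x e])+
    show "X e b c d \<longleftrightarrow> E e b \<inter> C \<noteq> {} \<or> E e b \<inter> D \<noteq> {}" "\<not> (E e b \<inter> C \<noteq> {} \<and> E e b \<inter> D \<noteq> {})"
      by (rule half_edges[OF x1 e(1) e'(1)])+
    show "X e c a b \<longleftrightarrow> E e c \<inter> A \<noteq> {} \<or> E e c \<inter> B \<noteq> {}" "\<not> (E e c \<inter> A \<noteq> {} \<and> E e c \<inter> B \<noteq> {})"
      by (rule half_edges[OF x4 e(1) e'(4)])+
    show "X e d a b \<longleftrightarrow> E e d \<inter> A \<noteq> {} \<or> E e d \<inter> B \<noteq> {}" "\<not> (E e d \<inter> A \<noteq> {} \<and> E e d \<inter> B \<noteq> {})"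
      by (rule half_edges[OF x5 e(1) e'(5)])+
    show "(X e b a c \<noteq> (E e b \<inter> C \<noteq> {})) \<longleftrightarrow> (X e d a c \<noteq> (E e d \<inter> A \<noteq> {}))" by (rule quadrant_equation[OF x e])
    show "(X e b a d \<noteq> (E e b \<inter> D \<noteq> {})) \<longleftrightarrow> (X e c a d \<noteq> (E e c \<inter> A \<noteq> {}))" by (rule quadrant_equation[OF x2 e(1) e'(2)])
    show "(X e a b c \<noteq> (E e a \<inter> C \<noteq> {})) \<longleftrightarrow> (X e d b c \<noteq> (E e d \<inter> B \<noteq> {}))" by (rule quadrant_equation[OF x1 e(1) e'(1)])
    show "(X e a b d \<noteq> (E e a \<inter> D \<noteq> {})) \<longleftrightarrow> (X e c b d \<noteq> (E e c \<inter> B \<noteq> {}))" by (rule quadrant_equation[OF x3 e(1) e'(3)])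
  qed
qed

text \<open>Without crossings, a-c-b-d-a is a closed curve. The chords ab and cd, a-e-b and cd, ab
  and c-e-d are three pairs of disjoint chords with interleaved ends. So the interiors of ab and cd
  and the vertex e would lie on mutually different sides, of which there are only two.\<close>

lemma K5_has_crossing:
  assumes V: "{a,b,c,d,e} \<subseteq> V" and ds: "distinct [a,b,c,d,e]"
    and no: "\<And>s t u v. {s,t,u,v} \<subseteq> {a,b,c,d,e} \<Longrightarrow> distinct [s,t,u,v] \<Longrightarrow> \<not> X s t u v"
  shows False
proof -
  have in5: "a \<in> V" "b \<in> V" "c \<in> V" "d \<in> V" "e \<in> V" using V by auto
  have adj: "q = s" if "q \<in> E s t" "q \<in> E s u" "{s,t,u} \<subseteq> {a,b,c,d,e}" "distinct [s,t,u]" for q s t u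
  proof -
    have "E s t \<inter> E s u = {s}" using that(3,4) in5 by (intro E_adjacent) auto
    then show ?thesis using that(1,2) by blast
  qed
  have disj: "q \<notin> E u v" if "q \<in> E s t" "{s,t,u,v} \<subseteq> {a,b,c,d,e}" "distinct [s,t,u,v]" for q s t u v
    using no[OF that(2,3)] that(1) unfolding X_def by blast
  have arc: "arc_between (E s t) s t" if "{s,t} \<subseteq> {a,b,c,d,e}" "s \<noteq> t" for s t
    using that in5 by (intro E_arc) auto
  have ends: "s \<in> E s t" "t \<in> E s t" if "{s,t} \<subseteq> {a,b,c,d,e}" "s \<noteq> t" for s t
    using arc_between_ends[OF arc[OF that]] by auto
  have vert: "w = s \<or> w = t" if "w \<in> E s t" "{s,t,w} \<subseteq> {a,b,c,d,e}" "s \<noteq> t" for w s t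
    using that in5 by (intro E_verts) auto
  have join: "arc_between (E s t \<union> E t u) s u" if "{s,t,u} \<subseteq> {a,b,c,d,e}" "distinct [s,t,u]" for s t u
  proof (rule arc_between_join)
    show "E s t \<inter> E t u = {t}" using E_adjacent[of t s u] that in5 E_sym[of s t] by auto
  qed (use arc that in auto)
  let ?P = "E a c \<union> E c b" and ?P' = "E a d \<union> E d b"
  have P: "arc_between ?P a b" "arc_between ?P' a b" using join ds by auto
  have Ps: "q \<in> ?P \<Longrightarrow> q \<in> ?P' \<Longrightarrow> q = a \<or> q = b" for q
    using adj[of q a c d] adj[of q b c d] disj[of q a c d b] disj[of q c b a d] ds E_sym[of c b] E_sym[of d b] by auto
  have ab: "a \<in> ?P" "a \<in> ?P'" "b \<in> ?P" "b \<in> ?P'" using arc_between_ends P by blast+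
  have PP: "?P \<inter> ?P' = {a,b}" using Ps ab by blast
  have c: "c \<in> ?P - ?P'" and d: "d \<in> ?P' - ?P"
    using ends[of a c] ends[of a d] vert[of c a d] vert[of c d b] vert[of d a c] vert[of d c b] ds by auto
  have chord1: "E a b \<inter> (?P \<union> ?P') = {a,b}"
  proof -
    have "q = a \<or> q = b" if "q \<in> E a b" "q \<in> ?P \<union> ?P'" for q
      using that adj[of q a b c] adj[of q b a c] adj[of q a b d] adj[of q b a d] ds E_sym[of c b] E_sym[of d b] E_sym[of a b] by auto
    moreover have "a \<in> E a b" "b \<in> E a b" using ends[of a b] ds by auto
    ultimately show ?thesis using ab by blast
  qed
  have chord2: "E c d \<inter> (?P \<union> ?P') = {c,d}"
  proof -
    have "q = c \<or> q = d" if "q \<in> E c d" "q \<in> ?P \<union> ?P'" for q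
      using that adj[of q c d a] adj[of q c d b] adj[of q d c a] adj[of q d c b] ds E_sym[of a c] E_sym[of a d] E_sym[of c d] by auto
    moreover have "c \<in> E c d" "d \<in> E c d" using ends[of c d] ds by auto
    ultimately show ?thesis using c d by blast
  qed
  have spoke: "q = s" if "q \<in> E s e" "q \<in> E t u" "{s,t,u} \<subseteq> {a,b,c,d}" "t \<noteq> u" for q s t u
  proof (cases "s \<in> {t,u}")
    case True
    then show ?thesis using adj[of q s e t] adj[of q s e u] that ds E_sym[of t u] by auto
  next
    case False
    then show ?thesis using disj[of q s e t u] that ds by auto
  qed
  have chord3: "(E a e \<union> E e b) \<inter> (?P \<union> ?P') = {a,b}"
  proof -
    have "q = a \<or> q = b" if "q \<in> E a e \<union> E e b" "q \<in> ?P \<union> ?P'" for q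
      using that spoke[of q a] spoke[of q b] ds E_sym[of e b] by auto
    moreover have "a \<in> E a e \<union> E e b" "b \<in> E a e \<union> E e b" using ends[of a e] ends[of e b] ds by auto
    ultimately show ?thesis using ab by blast
  qed
  have chord4: "(E c e \<union> E e d) \<inter> (?P \<union> ?P') = {c,d}"
  proof -
    have "q = c \<or> q = d" if "q \<in> E c e \<union> E e d" "q \<in> ?P \<union> ?P'" for q
      using that spoke[of q c] spoke[of q d] ds E_sym[of e d] by auto
    moreover have "c \<in> E c e \<union> E e d" "d \<in> E c e \<union> E e d" using ends[of c e] ends[of e d] ds by auto
    ultimately show ?thesis using c d by blast
  qed
  obtain u where u: "u \<in> E a b - {a,b}" using arc_between_punctured(4)[OF arc[of a b]] ds by auto
  obtain u' where u': "u' \<in> E c d - {c,d}" using arc_between_punctured(4)[OF arc[of c d]] ds by auto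
  have arcs: "arc_between (E a b) a b" "arc_between (E c d) c d" "arc_between (E a e \<union> E e b) a b" "arc_between (E c e \<union> E e d) c d"
    using arc join ds by auto
  have e1: "e \<in> (E a e \<union> E e b) - {a,b}" "e \<in> (E c e \<union> E e d) - {c,d}" using ends[of a e] ends[of c e] ds by auto
  have "E a b \<inter> E c d = {}" using no[of a b c d] ds by (auto simp: X_def)
  from interleaved_chords_opposite_sides[OF P PP arcs(1) chord1 arcs(2) chord2 c d this u u']
  have 1: "u \<in> inside (?P \<union> ?P') \<longleftrightarrow> u' \<notin> inside (?P \<union> ?P')" .
  have "(E a e \<union> E e b) \<inter> E c d = {}" using disj[of _ a e c d] disj[of _ e b c d] ds by auto
  from interleaved_chords_opposite_sides[OF P PP arcs(3) chord3 arcs(2) chord2 c d this e1(1) u']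
  have 2: "e \<in> inside (?P \<union> ?P') \<longleftrightarrow> u' \<notin> inside (?P \<union> ?P')" .
  have "E a b \<inter> (E c e \<union> E e d) = {}" using disj[of _ a b c e] disj[of _ a b e d] ds by auto
  from interleaved_chords_opposite_sides[OF P PP arcs(1) chord1 arcs(4) chord4 c d this u e1(2)]
  have 3: "u \<in> inside (?P \<union> ?P') \<longleftrightarrow> e \<notin> inside (?P \<union> ?P')" .
  show False using 1 2 3 by blast
qed

lemma not_X_forms:
  assumes "\<not> X a b c d"
  shows "\<not> X a b c d \<and> \<not> X b a c d \<and> \<not> X a b d c \<and> \<not> X b a d c \<and> \<not> X c d a b \<and> \<not> X d c a b \<and> \<not> X c d b a \<and> \<not> X d c b a"
  using assms unfolding X_def E_sym[of b a] E_sym[of d c] by (simp add: Int_commute)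

lemma crossing_system: "crossing_system V X"
proof
  show "X a b c d = X b a c d" for a b c d by (simp add: X_def E_sym)
  show "X a b c d = X c d a b" for a b c d by (simp add: X_def Int_commute)
  show "\<not> X a c b d" if "{a,b,c,d} \<subseteq> V" "distinct [a,b,c,d]" "X a b c d" for a b c d
    using crossing_at_exists[OF that] K4_crossing by blast
  show "quadrant_parities X a b c d e" if "{a,b,c,d,e} \<subseteq> V" "distinct [a,b,c,d,e]" "X a b c d" for a b c d e
    using quadrant_parities_X[OF that] .
  show "(X a b d e \<noteq> (X b c d e \<noteq> X a c d e)) =
      ((X a b d f \<noteq> (X b c d f \<noteq> X a c d f)) \<noteq> (X a b e f \<noteq> (X b c e f \<noteq> X a c e f)))"
    if "{a,b,c,d,e,f} \<subseteq> V" "distinct [a,b,c,d,e,f]" for a b c d e f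
    using disjoint_triangles_even[OF that] .
  show "X a b c d \<or> X a c b d \<or> X a d b c \<or> X a b c e \<or> X a c b e \<or> X a e b c \<or>
       X a b e d \<or> X a e b d \<or> X a d b e \<or> X a e c d \<or> X a c e d \<or> X a d e c \<or>
       X e b c d \<or> X e c b d \<or> X e d b c"
    if V: "{a,b,c,d,e} \<subseteq> V" and ds: "distinct [a,b,c,d,e]" for a b c d e
  proof (rule ccontr)
    assume "\<not> ?thesis"
    then have no: "\<not> X a b c d" "\<not> X a c b d" "\<not> X a d b c" "\<not> X a b c e" "\<not> X a c b e" "\<not> X a e b c"
       "\<not> X a b e d" "\<not> X a e b d" "\<not> X a d b e" "\<not> X a e c d" "\<not> X a c e d" "\<not> X a d e c"
       "\<not> X e b c d" "\<not> X e c b d" "\<not> X e d b c" by blast+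
    have "\<not> X s t u v" if "{s,t,u,v} \<subseteq> {a,b,c,d,e}" "distinct [s,t,u,v]" for s t u v
    proof -
      note N = not_X_forms[OF no(1)] not_X_forms[OF no(2)] not_X_forms[OF no(3)] not_X_forms[OF no(4)] not_X_forms[OF no(5)] not_X_forms[OF no(6)] not_X_forms[OF no(7)] not_X_forms[OF no(8)] not_X_forms[OF no(9)] not_X_forms[OF no(10)] not_X_forms[OF no(11)] not_X_forms[OF no(12)] not_X_forms[OF no(13)] not_X_forms[OF no(14)] not_X_forms[OF no(15)]
      have "s = a \<or> s = b \<or> s = c \<or> s = d \<or> s = e" "t = a \<or> t = b \<or> t = c \<or> t = d \<or> t = e"
        "u = a \<or> u = b \<or> u = c \<or> u = d \<or> u = e" "v = a \<or> v = b \<or> v = c \<or> v = d \<or> v = e"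
        "s \<noteq> t" "s \<noteq> u" "s \<noteq> v" "t \<noteq> u" "t \<noteq> v" "u \<noteq> v" using that by auto
      then show ?thesis by (elim disjE; simp only: N not_False_eq_True; fail)
    qed
    then show False using K5_has_crossing[OF V ds] by blast
  qed
qed

end

section \<open>Homogeneous sets for triple colorings\<close>

text \<open>Binary search in which every query at some x may shrink S by the factor K before it is
  answered by P or Q. Both answers are inherited by subsets, so earlier ones persist. Starting from
  P at the lower and Q at the upper end, halving reaches neighbors x and x + 1.\<close>

lemma bisection_refining:
  fixes P Q :: "nat \<Rightarrow> 'a set \<Rightarrow> bool"
  assumes P_mono: "\<And>x S S'. P x S \<Longrightarrow> S' \<subseteq> S \<Longrightarrow> P x S'"
    and Q_mono: "\<And>x S S'. Q x S \<Longrightarrow> S' \<subseteq> S \<Longrightarrow> Q x S'"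
    and split: "\<And>x S. S \<subseteq> S_all \<Longrightarrow> \<exists>S'\<subseteq>S. card S \<le> K * card S' \<and> (P x S' \<or> Q x S')"
    and "K \<ge> 1" and "S \<subseteq> S_all" "P lo S" "Q hi S" "lo < hi" "hi \<le> lo + 2 ^ r"
  shows "\<exists>S'\<subseteq>S. card S \<le> K ^ r * card S' \<and> (\<exists>x\<ge>lo. x < hi \<and> P x S' \<and> Q (Suc x) S')"
  using assms(5-)
proof (induction r arbitrary: lo hi S)
  case 0
  then have "hi = Suc lo" by simp
  then show ?case using 0 by (intro exI[of _ S]) auto
next
  case (Suc r)
  show ?case
  proof (cases "hi = Suc lo")
    case True
    \<comment> \<open>The search is over before its r steps are spent; the remaining factors K only
      weaken the bound.\<close>
    have "1 * card S \<le> K ^ Suc r * card S" using \<open>K \<ge> 1\<close> by (intro mult_le_mono1) simp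
    then show ?thesis using Suc True by (intro exI[of _ S]) auto
  next
    case False
    define mid where "mid = (lo + hi) div 2"
    have mid: "lo < mid" "mid < hi" "mid \<le> lo + 2 ^ r" "hi \<le> mid + 2 ^ r"
      using Suc.prems False unfolding mid_def by auto
    obtain S' where S': "S' \<subseteq> S" "card S \<le> K * card S'" "P mid S' \<or> Q mid S'"
      using split[OF Suc.prems(1)] by blast
    have sub: "S' \<subseteq> S_all" using S' Suc.prems by auto
    have "\<exists>S''\<subseteq>S'. card S' \<le> K ^ r * card S'' \<and> (\<exists>x\<ge>lo. x < hi \<and> P x S'' \<and> Q (Suc x) S'')"
      using S'(3)
    proof
      assume "P mid S'"
      from Suc.IH[OF sub this Q_mono[OF Suc.prems(3) S'(1)] mid(2,4)] mid(1)
      show ?thesis by (meson dual_order.strict_implies_order order_trans)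
    next
      assume "Q mid S'"
      from Suc.IH[OF sub P_mono[OF Suc.prems(2) S'(1)] this mid(1,3)] mid(2)
      show ?thesis by (meson order_less_trans)
    qed
    then obtain S'' where S'': "S'' \<subseteq> S'" "card S' \<le> K ^ r * card S''" "\<exists>x\<ge>lo. x < hi \<and> P x S'' \<and> Q (Suc x) S''"
      by blast
    have "card S \<le> K * (K ^ r * card S'')" using S'(2) S''(2) by (meson le_trans mult_le_mono2)
    then show ?thesis using S' S'' by (intro exI[of _ S'']) auto
  qed
qed

text \<open>The rules \<open>col_1\<close> to \<open>col_03\<close> pass a color along a chain, from
  the pairs ij and jk to the pair ik. \<open>col_0\<close> works differently: inside the class {0,
  3} the earlier vertex i decides about the later pair jk. This is why the searches below compare
  once with the greatest and once with the least vertex of a cell.\<close>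

locale triple_coloring =
  fixes N :: nat and col :: "nat \<Rightarrow> nat \<Rightarrow> nat \<Rightarrow> nat"
  assumes col_le: "col i j k \<le> 3"
    and col_1: "\<lbrakk>i < j; j < k; k < l; l < N; col i j k = 1; col i j l = 1; col j k l = 1\<rbrakk> \<Longrightarrow> col i k l = 1"
    and col_2: "\<lbrakk>i < j; j < k; k < l; l < N; col i j k = 2; col i j l = 2; col j k l = 2\<rbrakk> \<Longrightarrow> col i k l = 2"
    and col_3: "\<lbrakk>i < j; j < k; k < l; l < N; col i j k = 3; col i j l = 3; col j k l = 3\<rbrakk> \<Longrightarrow> col i k l = 3"
    and col_03: "\<lbrakk>i < j; j < k; k < l; l < N; col i j k \<in> {0,3}; col i j l \<in> {0,3}; col j k l \<in> {0,3}\<rbrakk>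
       \<Longrightarrow> col i k l \<in> {0,3}"
    and col_0: "\<lbrakk>i < j; j < k; k < l; l < N; col i j k = 0; col i j l = 0; col i k l = 0; col j k l \<in> {0,3}\<rbrakk>
       \<Longrightarrow> col j k l = 0"
begin

definition homogeneous :: "nat set \<Rightarrow> nat \<Rightarrow> bool" where
  "homogeneous C \<kappa> \<longleftrightarrow> (\<forall>i\<in>C. \<forall>j\<in>C. \<forall>k\<in>C. i < j \<longrightarrow> j < k \<longrightarrow> col i j k = \<kappa>)"

text \<open>As in the Erdos-Rado argument, a pair commits itself to colors that hold for all later
  vertices of T, so that the coloring of triples behaves like one of pairs.\<close>

definition revealed :: "nat set \<Rightarrow> nat \<Rightarrow> nat \<Rightarrow> nat set \<Rightarrow> bool" where
  "revealed T w u K \<longleftrightarrow> (\<forall>x\<in>T. u < x \<longrightarrow> col w u x \<in> K)"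

lemma revealed_mono: "revealed T w u K \<Longrightarrow> T' \<subseteq> T \<Longrightarrow> revealed T' w u K"
  by (auto simp: revealed_def)

lemma revealedD: "revealed T w u K \<Longrightarrow> x \<in> T \<Longrightarrow> u < x \<Longrightarrow> col w u x \<in> K"
  by (auto simp: revealed_def)

lemma split_by_color:
  assumes "finite S"
  shows "\<exists>S'\<subseteq>S. card S \<le> 4 * card S' \<and> (\<exists>\<kappa>\<le>3. \<forall>x\<in>S'. col w v x = \<kappa>)"
proof (rule ccontr)
  assume neg: "\<not> ?thesis"
  let ?C = "\<lambda>\<kappa>. {x \<in> S. col w v x = \<kappa>}"
  have "4 * card (?C \<kappa>) < card S" if "\<kappa> \<le> 3" for \<kappa>
  proof (rule ccontr)
    assume "\<not> 4 * card (?C \<kappa>) < card S"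
    then have "\<exists>S'\<subseteq>S. card S \<le> 4 * card S' \<and> (\<exists>\<kappa>\<le>3. \<forall>x\<in>S'. col w v x = \<kappa>)"
      using that by (intro exI[of _ "?C \<kappa>"]) auto
    then show False using neg by simp
  qed
  from this[of 0] this[of 1] this[of 2] this[of 3]
  have "card (?C 0) + card (?C 1) + card (?C 2) + card (?C 3) < card S" by simp
  moreover have "S \<subseteq> ?C 0 \<union> ?C 1 \<union> ?C 2 \<union> ?C 3"
  proof
    fix x assume "x \<in> S"
    moreover have "col w v x = 0 \<or> col w v x = 1 \<or> col w v x = 2 \<or> col w v x = 3"
      using col_le[of w v x] by linarith
    ultimately show "x \<in> ?C 0 \<union> ?C 1 \<union> ?C 2 \<union> ?C 3" by auto
  qed
  then have "card S \<le> card (?C 0 \<union> ?C 1 \<union> ?C 2 \<union> ?C 3)" using assms by (intro card_mono) auto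
  also have "\<dots> \<le> card (?C 0) + card (?C 1) + card (?C 2) + card (?C 3)"
    by (meson add_mono card_Un_le le_refl order_trans)
  ultimately show False by simp
qed

text \<open>
  \<open>U\<close> is the set of placed vertices, \<open>S\<close> the reservoir of later ones. The labels \<open>a\<close>, \<open>b\<close>, \<open>c\<close> bound the
  lengths of chains in the colors 1, 2 and 3 from below; vertices with equal \<open>a\<close> and \<open>b\<close> see only the colors
  0 and 3, and those with equal labels only the color 0.
\<close>

definition valid :: "nat set \<Rightarrow> nat set \<Rightarrow> (nat \<Rightarrow> nat) \<Rightarrow> (nat \<Rightarrow> nat) \<Rightarrow> (nat \<Rightarrow> nat) \<Rightarrow> bool" where
  "valid U S a b c \<longleftrightarrow> U \<union> S \<subseteq> {..<N} \<and> (\<forall>u\<in>U. \<forall>s\<in>S. u < s) \<and>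
     (\<forall>u\<in>U. 1 \<le> a u \<and> 1 \<le> b u \<and> 1 \<le> c u \<and>
        (1 < a u \<longrightarrow> (\<exists>w\<in>U. w < u \<and> Suc (a w) = a u \<and> revealed (U \<union> S) w u {1})) \<and>
        (1 < b u \<longrightarrow> (\<exists>w\<in>U. w < u \<and> Suc (b w) = b u \<and> revealed (U \<union> S) w u {2})) \<and>
        (1 < c u \<longrightarrow> (\<exists>w\<in>U. w < u \<and> Suc (c w) = c u \<and> revealed (U \<union> S) w u {3})) \<and>
        (\<forall>w\<in>U. w < u \<longrightarrow> a w = a u \<longrightarrow> b w = b u \<longrightarrow> revealed (U \<union> S) w u {0,3} \<and>
             (c w = c u \<longrightarrow> revealed (U \<union> S) w u {0})))"

lemma validD:
  assumes "valid U S a b c"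
  shows "U \<subseteq> {..<N}" "S \<subseteq> {..<N}" "u \<in> U \<Longrightarrow> s \<in> S \<Longrightarrow> u < s"
    "u \<in> U \<Longrightarrow> 1 \<le> a u" "u \<in> U \<Longrightarrow> 1 \<le> b u" "u \<in> U \<Longrightarrow> 1 \<le> c u"
    "u \<in> U \<Longrightarrow> 1 < a u \<Longrightarrow> \<exists>w\<in>U. w < u \<and> Suc (a w) = a u \<and> revealed (U \<union> S) w u {1}"
    "u \<in> U \<Longrightarrow> 1 < b u \<Longrightarrow> \<exists>w\<in>U. w < u \<and> Suc (b w) = b u \<and> revealed (U \<union> S) w u {2}"
    "u \<in> U \<Longrightarrow> 1 < c u \<Longrightarrow> \<exists>w\<in>U. w < u \<and> Suc (c w) = c u \<and> revealed (U \<union> S) w u {3}"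
    "w \<in> U \<Longrightarrow> u \<in> U \<Longrightarrow> w < u \<Longrightarrow> a w = a u \<Longrightarrow> b w = b u \<Longrightarrow> revealed (U \<union> S) w u {0,3}"
    "w \<in> U \<Longrightarrow> u \<in> U \<Longrightarrow> w < u \<Longrightarrow> a w = a u \<Longrightarrow> b w = b u \<Longrightarrow> c w = c u \<Longrightarrow> revealed (U \<union> S) w u {0}"
  using assms unfolding valid_def by simp_all

text \<open>Following predecessors from u down to the label 1 produces a chain of
  \<open>lab u\<close> vertices. At first only consecutive pairs are revealed; transitivity extends
  this to all pairs of the chain, with any third vertex of T.\<close>

lemma chain_homogeneous:
  assumes T: "U \<subseteq> T" "T \<subseteq> {..<N}"
    and trans: "\<And>i j k l. \<lbrakk>i < j; j < k; k < l; l < N; col i j k = \<kappa>; col i j l = \<kappa>; col j k l = \<kappa>\<rbrakk> \<Longrightarrow> col i k l = \<kappa>"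
    and link: "\<And>u. u \<in> U \<Longrightarrow> 1 < lab u \<Longrightarrow> \<exists>w\<in>U. w < u \<and> Suc (lab w) = lab u \<and> revealed T w u {\<kappa>}"
    and "u \<in> U" "lab u = Suc n"
  shows "\<exists>C\<subseteq>U. card C = Suc n \<and> u \<in> C \<and> (\<forall>w\<in>C. w \<le> u) \<and> (\<forall>w\<in>C. \<forall>w'\<in>C. w < w' \<longrightarrow> revealed T w w' {\<kappa>})"
  using assms(5,6)
proof (induction n arbitrary: u)
  case 0
  then show ?case by (intro exI[of _ "{u}"]) auto
next
  case (Suc n)
  obtain w where w: "w \<in> U" "w < u" "Suc (lab w) = lab u" "revealed T w u {\<kappa>}"
    using link[OF Suc.prems(1)] Suc.prems(2) by auto
  then obtain C where C: "C \<subseteq> U" "card C = Suc n" "w \<in> C" "\<forall>z\<in>C. z \<le> w"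
    "\<forall>z\<in>C. \<forall>w'\<in>C. z < w' \<longrightarrow> revealed T z w' {\<kappa>}"
    using Suc.IH[of w] Suc.prems(2) by auto
  have fin: "finite C" using C(2) card.infinite by fastforce
  have new: "revealed T z u {\<kappa>}" if "z \<in> C" for z
  proof (cases "z = w")
    case False
    then have zw: "z < w" using C(4) that by force
    then have r: "revealed T z w {\<kappa>}" using C that by blast
    show ?thesis unfolding revealed_def
    proof (intro ballI impI)
      fix x assume x: "x \<in> T" "u < x"
      have "col z w u = \<kappa>" using revealedD[OF r, of u] w T Suc.prems by auto
      moreover have "col z w x = \<kappa>" using revealedD[OF r, of x] x w by auto
      moreover have "col w u x = \<kappa>" using revealedD[OF w(4), of x] x by auto
      ultimately show "col z u x \<in> {\<kappa>}" using trans[of z w u x] zw w x T by auto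
    qed
  qed (use w in auto)
  have "u \<notin> C" using C(4) w(2) by force
  then have "card (insert u C) = Suc (Suc n)" using fin C(2) by simp
  moreover have "\<forall>z\<in>insert u C. z \<le> u" using C(4) w(2) by force
  moreover have "\<forall>z\<in>insert u C. \<forall>w'\<in>insert u C. z < w' \<longrightarrow> revealed T z w' {\<kappa>}"
    using C(4,5) new w(2) by (metis insert_iff leD less_imp_le_nat order_less_le_trans)
  ultimately show ?case using C(1) Suc.prems(1) by (intro exI[of _ "insert u C"]) auto
qed

lemma revealed_homogeneous:
  assumes "C \<subseteq> T" "\<forall>w\<in>C. \<forall>w'\<in>C. w < w' \<longrightarrow> revealed T w w' {\<kappa>}"
  shows "homogeneous C \<kappa>"
  using assms unfolding homogeneous_def revealed_def by blast

definition found :: "nat \<Rightarrow> nat \<Rightarrow> bool" where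
  "found m1 m2 \<longleftrightarrow> (\<exists>C\<subseteq>{..<N}. card C = m1 \<and> (homogeneous C 0 \<or> homogeneous C 2) \<or>
       card C = m2 \<and> (homogeneous C 1 \<or> homogeneous C 3))"

text \<open>The chain behind a label that reaches its bound can be trimmed to a homogeneous set of
  exactly the wanted size.\<close>

lemma label_bounds:
  assumes v: "valid U S a b c" and nf: "\<not> found m1 m2" and m: "m1 > 0" "m2 > 0" and u: "u \<in> U"
  shows "a u < m2" "b u < m1" "c u < m2"
proof -
  have T: "U \<subseteq> U \<union> S" "U \<union> S \<subseteq> {..<N}" using v by (auto simp: valid_def)
  have *: "\<exists>C\<subseteq>{..<N}. card C = n \<and> homogeneous C \<kappa>"
    if trans: "\<And>i j k l. \<lbrakk>i < j; j < k; k < l; l < N; col i j k = \<kappa>; col i j l = \<kappa>; col j k l = \<kappa>\<rbrakk> \<Longrightarrow> col i k l = \<kappa>"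
    and link: "\<And>u. u \<in> U \<Longrightarrow> 1 < lab u \<Longrightarrow> \<exists>w\<in>U. w < u \<and> Suc (lab w) = lab u \<and> revealed (U \<union> S) w u {\<kappa>}"
    and n: "n \<le> lab u" "0 < n" for \<kappa> lab n
  proof -
    obtain k where k: "lab u = Suc k" using n by (cases "lab u") auto
    obtain C where C: "C\<subseteq>U" "card C = Suc k" "\<forall>w\<in>C. \<forall>w'\<in>C. w < w' \<longrightarrow> revealed (U \<union> S) w w' {\<kappa>}"
    proof -
      have "\<exists>C\<subseteq>U. card C = Suc k \<and> u \<in> C \<and> (\<forall>w\<in>C. w \<le> u) \<and>
          (\<forall>w\<in>C. \<forall>w'\<in>C. w < w' \<longrightarrow> revealed (U \<union> S) w w' {\<kappa>})"
        by (rule chain_homogeneous[where lab = lab and \<kappa> = \<kappa>, OF T _ _ u k]) (fact trans, fact link)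
      then show ?thesis using that by metis
    qed
    obtain C' where C': "C' \<subseteq> C" "card C' = n"
      using n C(2) k by (metis obtain_subset_with_card_n)
    have "homogeneous C' \<kappa>" using C C' by (intro revealed_homogeneous[of _ "U \<union> S"]) blast+
    moreover have "C' \<subseteq> {..<N}" using C(1) C'(1) T by (meson subset_trans)
    ultimately show ?thesis using C'(2) by (intro exI[of _ C'] conjI)
  qed
  show "a u < m2"
  proof (rule ccontr)
    assume "\<not> ?thesis"
    then have "\<exists>C\<subseteq>{..<N}. card C = m2 \<and> homogeneous C 1"
      using m(2) by (intro *[where lab = a]) (erule (6) col_1, erule (1) validD(7)[OF v], simp_all)
    then show False using nf unfolding found_def by metis
  qed
  show "b u < m1"
  proof (rule ccontr)
    assume "\<not> ?thesis"
    then have "\<exists>C\<subseteq>{..<N}. card C = m1 \<and> homogeneous C 2"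
      using m(1) by (intro *[where lab = b]) (erule (6) col_2, erule (1) validD(8)[OF v], simp_all)
    then show False using nf unfolding found_def by metis
  qed
  show "c u < m2"
  proof (rule ccontr)
    assume "\<not> ?thesis"
    then have "\<exists>C\<subseteq>{..<N}. card C = m2 \<and> homogeneous C 3"
      using m(2) by (intro *[where lab = c]) (erule (6) col_3, erule (1) validD(9)[OF v], simp_all)
    then show False using nf unfolding found_def by metis
  qed
qed

lemma cell_bound:
  assumes v: "valid U S a b c" and nf: "\<not> found m1 m2" and "m1 > 0"
  shows "card {u \<in> U. a u = A \<and> b u = B \<and> c u = C} < m1"
proof (rule ccontr)
  let ?D = "{u \<in> U. a u = A \<and> b u = B \<and> c u = C}"
  assume "\<not> ?thesis"
  then have "m1 \<le> card ?D" by simp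
  then obtain D where D: "D \<subseteq> ?D" "card D = m1" by (rule obtain_subset_with_card_n)
  have "revealed (U \<union> S) w w' {0}" if "w \<in> D" "w' \<in> D" "w < w'" for w w'
    using that D(1) by (intro validD(11)[OF v]) auto
  then have "homogeneous D 0" using D by (intro revealed_homogeneous[of _ "U \<union> S"]) auto
  moreover have "D \<subseteq> {..<N}" using D validD(1)[OF v] by auto
  ultimately show False using nf D unfolding found_def by metis
qed

text \<open>There are (m2 - 1)(m1 - 1)(m2 - 1) label triples, and each is shared by at most m1 - 1
  vertices, since vertices with equal labels form a set of color 0.\<close>

lemma placed_bound:
  assumes v: "valid U S a b c" and nf: "\<not> found m1 m2" and m: "m1 > 0" "m2 > 0"
  shows "card U \<le> ((m1 - 1) * (m2 - 1))\<^sup>2"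
proof -
  have fin: "finite U" using validD(1)[OF v] finite_subset by auto
  let ?L = "{1..m2 - 1} \<times> {1..m1 - 1} \<times> {1..m2 - 1}"
  let ?cell = "\<lambda>(A, B, C). {u \<in> U. a u = A \<and> b u = B \<and> c u = C}"
  have "u \<in> (\<Union>L\<in>?L. ?cell L)" if "u \<in> U" for u
  proof -
    note validD(4-6)[OF v that]
    moreover note label_bounds[OF v nf m that]
    ultimately have "(a u, b u, c u) \<in> ?L" by auto
    then show ?thesis using that by (intro UN_I[of "(a u, b u, c u)"]) auto
  qed
  then have "card U \<le> card (\<Union>L\<in>?L. ?cell L)" using fin by (intro card_mono) auto
  also have "\<dots> \<le> (\<Sum>L\<in>?L. card (?cell L))" by (rule card_UN_le) auto
  also have "\<dots> \<le> (\<Sum>L\<in>?L. m1 - 1)"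
  proof (rule sum_mono)
    fix L assume "L \<in> ?L"
    obtain A B C where L: "L = (A,B,C)" by (cases L)
    show "card (?cell L) \<le> m1 - 1" using cell_bound[OF v nf m(1), of A B C] unfolding L by simp
  qed
  also have "\<dots> = ((m1 - 1) * (m2 - 1))\<^sup>2"
    by (simp add: power2_eq_square mult_ac)
  finally show ?thesis .
qed

text \<open>The least vertex v of the reservoir is placed. \<open>F\<close> asks for a vertex of
  a-label A joined to v by color 1. \<open>P\<close> asks for color 2 from the cell (A, B), while
  \<open>Q\<close> states that the whole cell sees only {0, 3}; \<open>P3\<close> and
  \<open>Q3\<close> do the same for 3 and 0 once a and b are fixed. The search for b runs inside
  every query of the search for a, which gives the exponent p1 p2; the search for c runs once and
  adds p2.\<close>

lemma place_vertex:
  assumes val: "valid U S a b c" and nf: "\<not> found m1 m2" and m: "m1 > 0" "m2 > 0"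
    and p: "m1 \<le> 2 ^ p1" "m2 \<le> 2 ^ p2" and "S \<noteq> {}"
  shows "\<exists>v S' a' b' c'. v \<in> S \<and> valid (insert v U) S' a' b' c' \<and> card S - 1 \<le> 4 ^ (p1 * p2 + p2) * card S'"
proof -
  have bounds: "a u \<noteq> m2" "b u \<noteq> m1" "c u \<noteq> m2" if "u \<in> U" for u
    using label_bounds[OF val nf m that] by auto
  note UN = validD(1)[OF val] and SN = validD(2)[OF val]
  have fin: "finite S" "finite U" using SN UN finite_subset by auto
  define v where "v = Min S"
  define S1 where "S1 = S - {v}"
  have vS: "v \<in> S" unfolding v_def using fin \<open>S \<noteq> {}\<close> by simp
  have vlt: "v < x" if "x \<in> S1" for x
    using that fin unfolding S1_def v_def by (auto simp: order.strict_iff_order)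
  have ult: "u < v" if "u \<in> U" for u using validD(3)[OF val that vS] .
  have S1: "S1 \<subseteq> S" "card S1 = card S - 1" using vS fin by (auto simp: S1_def)
  define F where "F A S' \<longleftrightarrow> (\<exists>w\<in>U. a w = A \<and> (\<forall>x\<in>S'. col w v x = 1))" for A S'
  \<comment> \<open>Labels start at 1; 0 is a sentinel that makes \<open>P\<close> hold at the lower
    end of the search.\<close>
  define P where "P A B S' \<longleftrightarrow> B = 0 \<or> (\<exists>w\<in>U. a w = A \<and> b w = B \<and> (\<forall>x\<in>S'. col w v x = 2))" for A B S'
  define Q where "Q A B S' \<longleftrightarrow> (\<forall>w\<in>U. a w = A \<longrightarrow> b w = B \<longrightarrow> (\<forall>x\<in>S'. col w v x \<in> {0,3}))" for A B S'
  have compare: "\<exists>S''\<subseteq>S'. card S' \<le> 4 * card S'' \<and> ((F A S'' \<or> P A B S'') \<or> (F A S'' \<or> Q A B S''))"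
    if sub: "S' \<subseteq> S1" for A B S'
  proof (cases "{u\<in>U. a u = A \<and> b u = B} = {}")
    case True
    then show ?thesis by (intro exI[of _ S']) (auto simp: Q_def)
  next
    case False
    \<comment> \<open>By transitivity of the class {0, 3}, comparing with the largest element decides for the whole cell.\<close>
    define w where "w = Max {u\<in>U. a u = A \<and> b u = B}"
    have w: "w \<in> U" "a w = A" "b w = B" using Max_in[OF _ False] fin unfolding w_def by auto
    have wmax: "u \<le> w" if "u \<in> U" "a u = A" "b u = B" for u unfolding w_def using that fin by auto
    have "finite S'" using sub fin finite_subset S1 by metis
    from split_by_color[OF this, of w v]
    obtain S'' \<kappa> where S'': "S'' \<subseteq> S'" "card S' \<le> 4 * card S''" "\<kappa> \<le> 3" "\<And>x. x \<in> S'' \<Longrightarrow> col w v x = \<kappa>"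
      by blast
    have "F A S'' \<or> P A B S'' \<or> Q A B S''"
    proof -
      consider "\<kappa> = 1" | "\<kappa> = 2" | "\<kappa> \<in> {0,3}" using S''(3) by fastforce
      then show ?thesis
      proof cases
        case 1 then show ?thesis using w S'' by (auto simp: F_def)
      next
        case 2 then show ?thesis using w S'' by (auto simp: P_def)
      next
        case 3
        have "col u v x \<in> {0,3}" if u: "u \<in> U" "a u = A" "b u = B" and x: "x \<in> S''" for u x
        proof (cases "u = w")
          case False
          then have uw: "u < w" using wmax[OF u] by simp
          then have r: "revealed (U \<union> S) u w {0,3}" using u w by (intro validD(10)[OF val]) auto
          have xS: "x \<in> S1" using x S''(1) sub by auto
          have "col u w v \<in> {0,3}" "col u w x \<in> {0,3}"
            using revealedD[OF r] vS ult[OF w(1)] xS S1(1) vlt[OF xS] by (meson UnI2 order_less_trans subsetD)+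
          moreover have "col w v x \<in> {0,3}" using S''(4)[OF x] 3 by simp
          ultimately show ?thesis
            using col_03[of u w v x] uw ult[OF w(1)] vlt[OF xS] xS S1(1) SN by (meson lessThan_iff subsetD)
        qed (use S''(4)[OF x] 3 in simp)
        then have "Q A B S''" unfolding Q_def by blast
        then show ?thesis by blast
      qed
    qed
    then show ?thesis using S'' by blast
  qed
  have F_mono: "F A S''" if "F A S'" "S'' \<subseteq> S'" for A S' S'' using that unfolding F_def by blast
  have P_mono: "P A B S''" if "P A B S'" "S'' \<subseteq> S'" for A B S' S'' using that unfolding P_def by blast
  have Q_mono: "Q A B S''" if "Q A B S'" "S'' \<subseteq> S'" for A B S' S'' using that unfolding Q_def by blast
  \<comment> \<open>\<open>R A\<close> is the alternative to \<open>F A\<close>: among the vertices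
    of a-label A, a b-label \<open>Suc B\<close> is consistent for v.\<close>
  define R where "R A S' \<longleftrightarrow> (\<exists>B. P A B S' \<and> Q A (Suc B) S')" for A S'
  have search_b: "\<exists>S''\<subseteq>S'. card S' \<le> 4 ^ p1 * card S'' \<and> ((A = 0 \<or> F A S'') \<or> R A S'')"
    if sub: "S' \<subseteq> S1" for A S'
  proof -
    have "Q A m1 S'" unfolding Q_def using bounds(2) by blast
    moreover have "P A 0 S'" by (simp add: P_def)
    \<comment> \<open>Color 1 counts as either answer, so meeting it does not break the search. At
      the end either \<open>F A\<close> holds on what is left of the reservoir, or \<open>P\<close>
      and \<open>Q\<close> hold at neighboring labels.\<close>
    ultimately have "\<exists>S''\<subseteq>S'. card S' \<le> 4 ^ p1 * card S'' \<and>
        (\<exists>B\<ge>0. B < m1 \<and> (F A S'' \<or> P A B S'') \<and> (F A S'' \<or> Q A (Suc B) S''))"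
      using m p sub
      by (intro bisection_refining[where S_all = S1 and P = "\<lambda>B S'. F A S' \<or> P A B S'" and Q = "\<lambda>B S'. F A S' \<or> Q A B S'"] compare)
        (use F_mono P_mono Q_mono in \<open>auto; fail\<close>)+
    then show ?thesis unfolding R_def by blast
  qed
  have R_mono: "R A S''" if "R A S'" "S'' \<subseteq> S'" for A S' S'' using that P_mono Q_mono unfolding R_def by blast
  \<comment> \<open>No placed vertex has a-label m2, so this cell is empty and \<open>R\<close>
    holds at the upper end with B = 0.\<close>
  have "P m2 0 S1 \<and> Q m2 (Suc 0) S1" unfolding P_def Q_def using bounds(1) by blast
  then have "R m2 S1" unfolding R_def by blast
  then have "\<exists>S'\<subseteq>S1. card S1 \<le> (4 ^ p1) ^ p2 * card S' \<and> (\<exists>A\<ge>0. A < m2 \<and> (A = 0 \<or> F A S') \<and> R (Suc A) S')"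
    using m p
    by (intro bisection_refining[where S_all = S1 and P = "\<lambda>A S'. A = 0 \<or> F A S'" and Q = R] search_b)
      (use F_mono R_mono in \<open>auto; fail\<close>)+
  then obtain S2 A B where S2: "S2 \<subseteq> S1" "card S1 \<le> (4 ^ p1) ^ p2 * card S2"
    "A = 0 \<or> F A S2" "P (Suc A) B S2" "Q (Suc A) (Suc B) S2" unfolding R_def by blast
  define cell where "cell C = {u\<in>U. a u = Suc A \<and> b u = Suc B \<and> c u = C}" for C
  define P3 where "P3 C S' \<longleftrightarrow> C = 0 \<or> (\<exists>w\<in>cell C. \<forall>x\<in>S'. col w v x = 3)" for C S'
  define Q3 where "Q3 C S' \<longleftrightarrow> (\<forall>w\<in>cell C. \<forall>x\<in>S'. col w v x = 0)" for C S'
  have compare3: "\<exists>S''\<subseteq>S'. card S' \<le> 4 * card S'' \<and> (P3 C S'' \<or> Q3 C S'')"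
    if sub: "S' \<subseteq> S2" for C S'
  proof (cases "cell C = {}")
    case True
    then show ?thesis by (intro exI[of _ S']) (auto simp: Q3_def)
  next
    case False
    \<comment> \<open>By \<open>col_0\<close>, comparing with the smallest element decides for the whole cell.\<close>
    define w where "w = Min (cell C)"
    have fc: "finite (cell C)" using fin by (simp add: cell_def)
    have wc: "w \<in> cell C" using Min_in[OF fc False] unfolding w_def .
    then have w: "w \<in> U" "a w = Suc A" "b w = Suc B" "c w = C" unfolding cell_def by auto
    have wmin: "w \<le> u" if "u \<in> cell C" for u unfolding w_def using that fc by auto
    have "finite S'" using sub fin finite_subset S1 S2 by metis
    from split_by_color[OF this, of w v]
    obtain S'' \<kappa> where S'': "S'' \<subseteq> S'" "card S' \<le> 4 * card S''" "\<kappa> \<le> 3" "\<And>x. x \<in> S'' \<Longrightarrow> col w v x = \<kappa>"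
      by blast
    have rel: "col u v x \<in> {0,3}" if "u \<in> cell C" "x \<in> S''" for u x
      using that S2(5) S''(1) sub unfolding Q_def cell_def by blast
    have "P3 C S'' \<or> Q3 C S''"
    \<comment> \<open>For an empty S'' the answer \<open>Q3\<close> holds vacuously; otherwise the
      relation \<open>rel\<close>, which comes from \<open>Q\<close>, leaves only 0 and 3 for
      \<kappa>.\<close>
    proof (cases "S'' \<noteq> {} \<and> \<kappa> = 3")
      case True
      then show ?thesis using wc S''(4) by (auto simp: P3_def)
    next
      case False
      have "col u v x = 0" if u: "u \<in> cell C" and x: "x \<in> S''" for u x
      proof -
        have w0: "col w v x = 0" using False x S''(4)[OF x] rel[OF wc x] by auto
        show ?thesis
        proof (cases "u = w")
          case False
          then have wu: "w < u" using wmin[OF u] by simp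
          have u': "u \<in> U" "a u = Suc A" "b u = Suc B" "c u = C" using u unfolding cell_def by auto
          then have r: "revealed (U \<union> S) w u {0}" using w wu by (intro validD(11)[OF val]) auto
          have xS: "x \<in> S1" using x S''(1) sub S2(1) by auto
          have "col w u v = 0" "col w u x = 0"
            using revealedD[OF r, of v] revealedD[OF r, of x] vS ult[OF u'(1)] xS S1(1) vlt[OF xS] by auto
          then show ?thesis
            using col_0[of w u v x] wu ult[OF u'(1)] vlt[OF xS] xS S1(1) SN w0 rel[OF u x] by (meson lessThan_iff subsetD)
        qed (use w0 in simp)
      qed
      then show ?thesis unfolding Q3_def by blast
    qed
    then show ?thesis using S'' by blast
  qed
  have P3_mono: "P3 C S''" if "P3 C S'" "S'' \<subseteq> S'" for C S' S'' using that unfolding P3_def by blast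
  have Q3_mono: "Q3 C S''" if "Q3 C S'" "S'' \<subseteq> S'" for C S' S'' using that unfolding Q3_def by blast
  have "Q3 m2 S2" unfolding Q3_def cell_def using bounds(3) by blast
  moreover have "P3 0 S2" by (simp add: P3_def)
  ultimately have "\<exists>S'\<subseteq>S2. card S2 \<le> 4 ^ p2 * card S' \<and> (\<exists>C\<ge>0. C < m2 \<and> P3 C S' \<and> Q3 (Suc C) S')"
    using m p
    by (intro bisection_refining[where S_all = S2 and P = P3 and Q = Q3] compare3)
      (use P3_mono Q3_mono in \<open>auto; fail\<close>)+
  then obtain S3 C where S3: "S3 \<subseteq> S2" "card S2 \<le> 4 ^ p2 * card S3" "P3 C S3" "Q3 (Suc C) S3" by blast
  have "card S1 \<le> (4 ^ p1) ^ p2 * (4 ^ p2 * card S3)"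
    using S2(2) S3(2) by (meson le_trans mult_le_mono2)
  then have card: "card S - 1 \<le> 4 ^ (p1 * p2 + p2) * card S3"
    using S1 by (simp add: power_add power_mult algebra_simps)
  let ?U = "insert v U" and ?a = "a(v := Suc A)" and ?b = "b(v := Suc B)" and ?c = "c(v := Suc C)"
  have S3S: "S3 \<subseteq> S1" "S3 \<subseteq> S" using S3 S2 S1 by auto
  have vU: "v \<notin> U" using ult by blast
  have T: "?U \<union> S3 \<subseteq> U \<union> S" using S3S vS by auto
  have mono: "revealed (?U \<union> S3) w u K" if "revealed (U \<union> S) w u K" for w u K
    using revealed_mono[OF that T] .
  \<comment> \<open>The placed vertices precede v, so every third vertex after v lies in S3.\<close>
  have rv: "revealed (?U \<union> S3) w v K" if "\<forall>x\<in>S3. col w v x \<in> K" for w K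
    using that ult unfolding revealed_def by fastforce
  have lab_eq: "?a w = a w" "?b w = b w" "?c w = c w" if "w \<in> U" for w using that vU by auto
  have F3: "A = 0 \<or> F A S3" using S2(3) F_mono S3(1) by blast
  have P3': "P (Suc A) B S3" using P_mono[OF S2(4) S3(1)] .
  have Q3': "Q (Suc A) (Suc B) S3" using Q_mono[OF S2(5) S3(1)] .
  have "valid ?U S3 ?a ?b ?c"
    unfolding valid_def
  proof (intro conjI ballI)
    show "?U \<union> S3 \<subseteq> {..<N}" using T UN SN by auto
    show "u < s" if "u \<in> ?U" "s \<in> S3" for u s using that ult vlt S3S by (metis insert_iff order_less_trans subsetD)
    fix u assume u: "u \<in> ?U"
    show "1 \<le> ?a u" "1 \<le> ?b u" "1 \<le> ?c u" using u validD(4-6)[OF val] by auto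
    show "1 < ?a u \<longrightarrow> (\<exists>w\<in>?U. w < u \<and> Suc (?a w) = ?a u \<and> revealed (?U \<union> S3) w u {1})"
    proof (cases "u = v")
      case True
      have "\<exists>w\<in>U. a w = A \<and> revealed (?U \<union> S3) w v {1}" if "A \<noteq> 0"
      proof -
        obtain w where w: "w \<in> U" "a w = A" "\<forall>x\<in>S3. col w v x = 1" using F3 \<open>A \<noteq> 0\<close> unfolding F_def by blast
        then have "revealed (?U \<union> S3) w v {1}" by (intro rv) simp
        then show ?thesis using w by blast
      qed
      then have "\<exists>w\<in>?U. w < v \<and> ?a w = A \<and> revealed (?U \<union> S3) w v {1}" if "A \<noteq> 0"
        using that ult lab_eq by (metis insertCI)
      then show ?thesis using True by (cases "A = 0") auto
    next
      case False
      then have uU: "u \<in> U" using u by simp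
      show ?thesis
      proof
        assume "1 < ?a u"
        then obtain w where "w \<in> U" "w < u" "Suc (a w) = a u" "revealed (U \<union> S) w u {1}"
          using validD(7)[OF val uU] lab_eq[OF uU] by auto
        then show "\<exists>w\<in>?U. w < u \<and> Suc (?a w) = ?a u \<and> revealed (?U \<union> S3) w u {1}"
          using mono lab_eq uU by (intro bexI[of _ w]) auto
      qed
    qed
    show "1 < ?b u \<longrightarrow> (\<exists>w\<in>?U. w < u \<and> Suc (?b w) = ?b u \<and> revealed (?U \<union> S3) w u {2})"
    proof (cases "u = v")
      case True
      have "\<exists>w\<in>U. b w = B \<and> revealed (?U \<union> S3) w v {2}" if "B \<noteq> 0"
      proof -
        obtain w where w: "w \<in> U" "b w = B" "\<forall>x\<in>S3. col w v x = 2" using P3' \<open>B \<noteq> 0\<close> unfolding P_def by blast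
        then have "revealed (?U \<union> S3) w v {2}" by (intro rv) simp
        then show ?thesis using w by blast
      qed
      then have "\<exists>w\<in>?U. w < v \<and> ?b w = B \<and> revealed (?U \<union> S3) w v {2}" if "B \<noteq> 0"
        using that ult lab_eq by (metis insertCI)
      then show ?thesis using True by (cases "B = 0") auto
    next
      case False
      then have uU: "u \<in> U" using u by simp
      show ?thesis
      proof
        assume "1 < ?b u"
        then obtain w where "w \<in> U" "w < u" "Suc (b w) = b u" "revealed (U \<union> S) w u {2}"
          using validD(8)[OF val uU] lab_eq[OF uU] by auto
        then show "\<exists>w\<in>?U. w < u \<and> Suc (?b w) = ?b u \<and> revealed (?U \<union> S3) w u {2}"
          using mono lab_eq uU by (intro bexI[of _ w]) auto
      qed
    qed
    show "1 < ?c u \<longrightarrow> (\<exists>w\<in>?U. w < u \<and> Suc (?c w) = ?c u \<and> revealed (?U \<union> S3) w u {3})"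
    proof (cases "u = v")
      case True
      have "\<exists>w\<in>U. c w = C \<and> revealed (?U \<union> S3) w v {3}" if "C \<noteq> 0"
      proof -
        obtain w where w: "w \<in> cell C" "\<forall>x\<in>S3. col w v x = 3" using S3(3) \<open>C \<noteq> 0\<close> unfolding P3_def by blast
        then have "revealed (?U \<union> S3) w v {3}" by (intro rv) simp
        then show ?thesis using w(1) unfolding cell_def by blast
      qed
      then have "\<exists>w\<in>?U. w < v \<and> ?c w = C \<and> revealed (?U \<union> S3) w v {3}" if "C \<noteq> 0"
        using that ult lab_eq by (metis insertCI)
      then show ?thesis using True by (cases "C = 0") auto
    next
      case False
      then have uU: "u \<in> U" using u by simp
      show ?thesis
      proof
        assume "1 < ?c u"
        then obtain w where "w \<in> U" "w < u" "Suc (c w) = c u" "revealed (U \<union> S) w u {3}"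
          using validD(9)[OF val uU] lab_eq[OF uU] by auto
        then show "\<exists>w\<in>?U. w < u \<and> Suc (?c w) = ?c u \<and> revealed (?U \<union> S3) w u {3}"
          using mono lab_eq uU by (intro bexI[of _ w]) auto
      qed
    qed
    fix w assume w: "w \<in> ?U"
    show "w < u \<longrightarrow> ?a w = ?a u \<longrightarrow> ?b w = ?b u \<longrightarrow>
        revealed (?U \<union> S3) w u {0,3} \<and> (?c w = ?c u \<longrightarrow> revealed (?U \<union> S3) w u {0})"
    proof (cases "u = v")
      case True
      show ?thesis
      proof (intro impI conjI)
        assume wu: "w < u" and ab: "?a w = ?a u" "?b w = ?b u"
        have wU: "w \<in> U" using w wu True by auto
        then have ab': "a w = Suc A" "b w = Suc B" using ab True lab_eq by auto
        show "revealed (?U \<union> S3) w u {0,3}" unfolding True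
          by (rule rv) (use Q3' wU ab' in \<open>auto simp: Q_def\<close>)
        assume "?c w = ?c u"
        then have "c w = Suc C" using True lab_eq wU by auto
        then show "revealed (?U \<union> S3) w u {0}"  unfolding True
          by (intro rv) (use S3(4) wU ab' in \<open>auto simp: Q3_def cell_def\<close>)
      qed
    next
      case False
      then have uU: "u \<in> U" using u by auto
      show ?thesis
      proof (cases "w = v")
        case True
        then show ?thesis using ult[OF uU] by auto
      next
        case False
        then have "w \<in> U" using w by auto
        then show ?thesis using uU mono lab_eq validD(10,11)[OF val, of w u] by simp
      qed
    qed
  qed
  then show ?thesis using card vS by blast
qed

theorem homogeneous_subset:
  assumes m: "m1 > 0" "m2 > 0" and p: "m1 \<le> 2 ^ p1" "m2 \<le> 2 ^ p2"
    and N: "(2 * 4 ^ (p1 * p2 + p2)) ^ Suc (((m1 - 1) * (m2 - 1))\<^sup>2) \<le> N"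
  shows "found m1 m2"
proof (rule ccontr)
  assume nf: "\<not> ?thesis"
  \<comment> \<open>D is the price of one placement: the comparisons cost the power of 4, and the
    factor 2 absorbs the removal of v, since card S \<le> 2 (card S - 1) once card S \<ge> 2. M
    exceeds \<open>placed_bound\<close> by one, so M placements are contradictory.\<close>
  define D where "D = 2 * (4::nat) ^ (p1 * p2 + p2)"
  define M where "M = Suc (((m1 - 1) * (m2 - 1))\<^sup>2)"
  have "\<exists>U S a b c. valid U S a b c \<and> card U = t \<and> D ^ (M - t) \<le> card S" if "t \<le> M" for t
    using that
  proof (induction t)
    case 0
    have "valid {} {..<N} (\<lambda>_. 0) (\<lambda>_. 0) (\<lambda>_. 0)" by (simp add: valid_def)
    then show ?case using N unfolding D_def M_def by (metis card.empty card_lessThan diff_zero)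
  next
    case (Suc t)
    then obtain U S a b c where val: "valid U S a b c" and U: "card U = t" and S: "D ^ (M - t) \<le> card S" by auto
    have Dt: "D ^ (M - t) = D * D ^ (M - Suc t)" using Suc.prems
      by (metis Suc_diff_Suc Suc_le_lessD power_Suc)
    have D: "D \<ge> 2" unfolding D_def by simp
    then have "D ^ (M - Suc t) \<ge> 1" by simp
    then have "card S \<ge> 2" using S D Dt by (metis (no_types, lifting) le_trans mult.right_neutral mult_le_mono)
    then have "S \<noteq> {}" by auto
    from place_vertex[OF val nf m p this] obtain v S' a' b' c' where
      v: "v \<in> S" "valid (insert v U) S' a' b' c'" "card S - 1 \<le> 4 ^ (p1 * p2 + p2) * card S'" by blast
    have "v \<notin> U" using validD(3)[OF val] v(1) by blast
    moreover have "finite U" using validD(1)[OF val] finite_subset by auto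
    ultimately have "card (insert v U) = Suc t" using U by simp
    moreover have "D * D ^ (M - Suc t) \<le> D * card S'"
      using v(3) \<open>card S \<ge> 2\<close> S Dt unfolding D_def by linarith
    then have "D ^ (M - Suc t) \<le> card S'" using D by simp
    ultimately show ?case using v(2) by blast
  qed
  from this[of M] obtain U S a b c where "valid U S a b c" "card U = M" by auto
  then show False using placed_bound[of U S a b c, OF _ nf m] unfolding M_def by force
qed

end

section \<open>Complete convex geometric graphs on a parabola\<close>

definition parab :: "real \<Rightarrow> complex" where "parab x = Complex x (x\<^sup>2)"

text \<open>This parametrises the line through \<open>parab x\<close> and \<open>parab y\<close> by
  the real part, written as the parabola plus a height (t - x)(y - t) above it. Chords can then be
  compared by their heights.\<close>

definition chord :: "real \<Rightarrow> real \<Rightarrow> real \<Rightarrow> complex" where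
  "chord x y t = Complex t (t\<^sup>2 + (t - x) * (y - t))"

lemma chord_eq_iff: "chord x y t = chord c d s \<longleftrightarrow> t = s \<and> (t - x) * (y - t) = (t - c) * (d - t)"
  by (auto simp: chord_def complex_eq_iff)

lemma chord_alt: "chord x y t = Complex t ((x + y) * t - x * y)"
  by (simp add: chord_def complex_eq_iff power2_eq_square algebra_simps)

lemma parab_eq_iff [simp]: "parab x = parab y \<longleftrightarrow> x = y"
  by (auto simp: parab_def complex_eq_iff)

lemma parab_eq_chord: "parab s = chord x y t \<longleftrightarrow> t = s \<and> (s = x \<or> s = y)"
  by (auto simp: parab_def chord_def complex_eq_iff)

lemma segment_parab:
  assumes "x < y"
  shows "closed_segment (parab x) (parab y) = chord x y ` {x..y}"
proof (intro equalityI subsetI)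
  fix z assume "z \<in> closed_segment (parab x) (parab y)"
  then obtain u where u: "0 \<le> u" "u \<le> 1" "z = (1 - u) *\<^sub>R parab x + u *\<^sub>R parab y"
    by (auto simp: in_segment)
  let ?t = "(1 - u) * x + u * y"
  have "z = chord x y ?t" unfolding u(3) parab_def chord_alt
    by (simp add: complex_eq_iff power2_eq_square algebra_simps)
  moreover have "?t = x + u * (y - x)" "?t = y - (1 - u) * (y - x)" by (simp_all add: algebra_simps)
  moreover have "0 \<le> u * (y - x)" "0 \<le> (1 - u) * (y - x)" using u assms by simp_all
  ultimately have "z = chord x y ?t" "?t \<in> {x..y}" unfolding atLeastAtMost_iff by linarith+
  then show "z \<in> chord x y ` {x..y}" by blast
next
  fix z assume "z \<in> chord x y ` {x..y}"
  then obtain t where t: "t \<in> {x..y}" "z = chord x y t" by blast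
  define u where "u = (t - x) / (y - x)"
  have ut: "t = x + u * (y - x)" using assms by (simp add: u_def)
  have "z = (1 - u) *\<^sub>R parab x + u *\<^sub>R parab y" unfolding t(2) chord_alt parab_def ut
    by (simp add: complex_eq_iff power2_eq_square algebra_simps)
  moreover have "0 \<le> u" "u \<le> 1" using t assms by (auto simp: u_def)
  ultimately show "z \<in> closed_segment (parab x) (parab y)" unfolding in_segment by blast
qed

text \<open>An affine chart suffices: up to the factor r, its coordinates are the vertical distances
  from the two lines.\<close>

lemma proper_crossing_chords:
  assumes t: "x < t" "t < y" "c < t" "t < d" and eq: "chord x y t = chord c d t" and slope: "x + y \<noteq> c + d"
  shows "proper_crossing (chord x y ` {x..y}) (chord c d ` {c..d}) (chord x y t)"
proof -
  define \<alpha> where "\<alpha> = x + y"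
  define \<gamma> where "\<gamma> = c + d"
  define D where "D = \<alpha> - \<gamma>"
  define q where "q = \<alpha> * t - x * y"
  have q: "q = \<gamma> * t - c * d" using eq unfolding chord_alt q_def \<alpha>_def \<gamma>_def by simp
  have D: "D \<noteq> 0" using slope by (simp add: D_def \<alpha>_def \<gamma>_def)
  define \<delta> where "\<delta> = min (min (t - x) (y - t)) (min (t - c) (d - t))"
  have \<delta>: "\<delta> > 0" "\<delta> \<le> t - x" "\<delta> \<le> y - t" "\<delta> \<le> t - c" "\<delta> \<le> d - t" using t by (auto simp: \<delta>_def)
  \<comment> \<open>In the chart the offset from t is r (Re w - Im w) / D, which over the unit disc
    stays below 2 r / |D| in absolute value. This r turns that bound into \<delta>, so that near the
    crossing the chords agree with their lines.\<close>
  define r where "r = \<delta> * \<bar>D\<bar> / 2"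
  have r: "r > 0" using \<delta> D by (simp add: r_def)
  define h where "h z = Complex ((Im z - q - \<gamma> * (Re z - t)) / r) ((Im z - q - \<alpha> * (Re z - t)) / r)" for z
  define k where "k w = Complex (t + r * (Re w - Im w) / D) (q + r * Im w + \<alpha> * (r * (Re w - Im w) / D))" for w
  have hk: "h (k w) = w" for w
  proof -
    have "r * Im w + \<alpha> * (r * (Re w - Im w) / D) - \<gamma> * (r * (Re w - Im w) / D) = r * Re w"
    proof -
      have "\<alpha> * (r * (Re w - Im w) / D) - \<gamma> * (r * (Re w - Im w) / D) = D * (r * (Re w - Im w) / D)"
        by (simp only: D_def left_diff_distrib)
      also have "\<dots> = r * (Re w - Im w)" using D by simp
      finally show ?thesis by (simp add: algebra_simps)
    qed
    then show ?thesis using r by (simp add: h_def k_def complex_eq_iff)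
  qed
  have kh: "k (h z) = z" for z
  proof -
    have "r * (Re (h z) - Im (h z)) = D * (Re z - t)" using r by (simp add: h_def D_def field_simps)
    then have *: "r * (Re (h z) - Im (h z)) / D = Re z - t" using D by simp
    show ?thesis unfolding k_def * using r by (simp add: h_def complex_eq_iff)
  qed
  have conth: "continuous_on S h" for S unfolding h_def by (intro continuous_intros) (use r in auto)
  have contk: "continuous_on S k" for S unfolding k_def by (intro continuous_intros) (use D in auto)
  define U where "U = h -` ball 0 1"
  have U: "open U" unfolding U_def using conth by (simp add: open_vimage)
  have hom: "homeomorphism U (ball 0 1) h k"
    by (rule homeomorphismI) (use conth contk hk kh in \<open>auto simp: U_def\<close>)
  have hp: "h (chord x y t) = 0" unfolding h_def chord_alt by (simp add: q_def \<alpha>_def complex_eq_iff)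
  have near: "\<bar>r * (Re w - Im w) / D\<bar> < \<delta>" if "w \<in> ball 0 1" for w
  proof -
    have "\<bar>Re w - Im w\<bar> < 2" using that abs_Re_le_cmod[of w] abs_Im_le_cmod[of w] by (auto simp: abs_le_iff)
    then have "r * \<bar>Re w - Im w\<bar> / \<bar>D\<bar> < r * 2 / \<bar>D\<bar>" using r D by (intro divide_strict_right_mono mult_strict_left_mono) auto
    moreover have "\<bar>r * (Re w - Im w) / D\<bar> = r * \<bar>Re w - Im w\<bar> / \<bar>D\<bar>" using r by (simp add: abs_mult)
    moreover have "r * 2 / \<bar>D\<bar> = \<delta>" using D by (simp add: r_def)
    ultimately show ?thesis by (simp only:)
  qed
  have A: "h (chord x y s) = Complex (D * (s - t) / r) 0" for s
    unfolding h_def chord_alt by (simp add: complex_eq_iff q_def \<alpha>_def D_def algebra_simps)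
  have B: "h (chord c d s) = Complex 0 (- D * (s - t) / r)" for s
    unfolding h_def chord_alt q by (simp add: complex_eq_iff \<gamma>_def D_def algebra_simps)
  have kA: "k w = chord x y (t + r * (Re w - Im w) / D)" if "Im w = 0" for w
    unfolding k_def chord_alt using that by (simp add: q_def \<alpha>_def algebra_simps)
  have kB: "k w = chord c d (t + r * (Re w - Im w) / D)" if "Re w = 0" for w
  proof -
    have "r * Im w + \<alpha> * (r * (Re w - Im w) / D) = \<gamma> * (r * (Re w - Im w) / D)"
    proof -
      have "\<alpha> * (r * (Re w - Im w) / D) - \<gamma> * (r * (Re w - Im w) / D) = D * (r * (Re w - Im w) / D)"
        by (simp only: D_def left_diff_distrib)
      also have "\<dots> = - r * Im w" using D that by simp
      finally show ?thesis by simp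
    qed
    then show ?thesis unfolding k_def chord_alt q by (simp add: \<gamma>_def algebra_simps)
  qed
  have "h ` (chord x y ` {x..y} \<inter> U) = {z \<in> ball 0 1. Im z = 0}"
  proof (intro equalityI subsetI)
    fix w assume "w \<in> h ` (chord x y ` {x..y} \<inter> U)"
    then show "w \<in> {z \<in> ball 0 1. Im z = 0}" using A by (auto simp: U_def)
  next
    fix w :: complex assume w: "w \<in> {z \<in> ball 0 1. Im z = 0}"
    have "\<bar>r * (Re w - Im w) / D\<bar> < \<delta>" using near w by blast
    then have "t + r * (Re w - Im w) / D \<in> {x..y}" using \<delta> unfolding abs_less_iff atLeastAtMost_iff by linarith
    then have "k w \<in> chord x y ` {x..y}" using kA w by blast
    moreover have "k w \<in> U" using w hk by (simp add: U_def)
    ultimately show "w \<in> h ` (chord x y ` {x..y} \<inter> U)" using hk[of w] by (metis IntI imageI)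
  qed
  moreover have "h ` (chord c d ` {c..d} \<inter> U) = {z \<in> ball 0 1. Re z = 0}"
  proof (intro equalityI subsetI)
    fix w assume "w \<in> h ` (chord c d ` {c..d} \<inter> U)"
    then show "w \<in> {z \<in> ball 0 1. Re z = 0}" using B by (auto simp: U_def)
  next
    fix w :: complex assume w: "w \<in> {z \<in> ball 0 1. Re z = 0}"
    have "\<bar>r * (Re w - Im w) / D\<bar> < \<delta>" using near w by blast
    then have "t + r * (Re w - Im w) / D \<in> {c..d}" using \<delta> unfolding abs_less_iff atLeastAtMost_iff by linarith
    then have "k w \<in> chord c d ` {c..d}" using kB w by blast
    moreover have "k w \<in> U" using w hk by (simp add: U_def)
    ultimately show "w \<in> h ` (chord c d ` {c..d} \<inter> U)" using hk[of w] by (metis IntI imageI)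
  qed
  moreover have "chord x y t \<in> U" using hp by (simp add: U_def)
  ultimately show ?thesis unfolding proper_crossing_def using U hom hp by blast
qed

text \<open>An edge is an unordered pair, so its segment is directed by increasing real part to make
  the curve well defined.\<close>

definition parabola_graph :: "real set \<Rightarrow> topgraph" where
  "parabola_graph S = \<lparr>verts = parab ` S, edges = {{u, v} | u v. u \<in> parab ` S \<and> v \<in> parab ` S \<and> u \<noteq> v},
     curve = (\<lambda>e. linepath (parab (Min (Re ` e))) (parab (Max (Re ` e))))\<rparr>"

lemma parabola_edgeE:
  assumes "e \<in> edges (parabola_graph S)"
  obtains x y where "x \<in> S" "y \<in> S" "x < y" "e = {parab x, parab y}"
proof -
  obtain x y where "x \<in> S" "y \<in> S" "x \<noteq> y" "e = {parab x, parab y}" using assms by (auto simp: parabola_graph_def)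
  then show ?thesis using that by (metis insert_commute linorder_less_linear)
qed

lemma Re_parab [simp]: "Re (parab x) = x" by (simp add: parab_def)

lemma parabola_curve: "x < y \<Longrightarrow> curve (parabola_graph S) {parab x, parab y} = linepath (parab x) (parab y)"
  by (simp add: parabola_graph_def)

lemma parabola_curve_image: "x < y \<Longrightarrow> path_image (curve (parabola_graph S) {parab x, parab y}) = chord x y ` {x..y}"
  by (simp add: parabola_curve segment_parab)

text \<open>A chord has slope x + y and intercept - x y. Parallel chords with a common point would
  have ends with the same sum and the same product, hence the same ends.\<close>

lemma chords_common_point:
  assumes "x < y" "c < d" "(x, y) \<noteq> (c, d)" and "chord x y t = chord c d t"
  shows "x + y \<noteq> c + d"
proof
  assume s: "x + y = c + d"
  then have p: "x * y = c * d" using assms(4) by (simp add: chord_alt)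
  have "(x - c) * (x - d) = x * x - (c + d) * x + c * d" by (simp add: algebra_simps)
  also have "\<dots> = 0" unfolding s[symmetric] p[symmetric] by (simp add: algebra_simps)
  finally have "x = c \<or> x = d" by simp
  then show False using s assms(1-3) by auto
qed

lemma parabola_simple:
  assumes "finite S"
  shows "simple_topological_graph (parabola_graph S)"
proof -
  let ?G = "parabola_graph S"
  have inter: "edge_interior ?G {parab x, parab y} = chord x y ` {x<..<y}" if "x < y" for x y
  proof -
    have "chord x y x = parab x" "chord x y y = parab y" by (simp_all add: chord_def parab_def)
    moreover have "{x..y} = insert x (insert y {x<..<y})" using that by auto
    moreover have "parab x \<notin> chord x y ` {x<..<y}" "parab y \<notin> chord x y ` {x<..<y}" by (auto simp: parab_eq_chord)
    ultimately show ?thesis unfolding edge_interior_def parabola_curve_image[OF that] by auto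
  qed
  have crossing: "\<exists>t. p = chord x y t \<and> p = chord c d t \<and> t \<in> I \<and> t \<in> J"
    if "p \<in> chord x y ` I" "p \<in> chord c d ` J" for p x y c d I J using that by (auto simp: chord_eq_iff)
  have "topological_graph ?G" unfolding topological_graph_def
  proof (intro conjI ballI impI)
    show "finite (verts ?G)" using assms by (simp add: parabola_graph_def)
    fix e assume e: "e \<in> edges ?G"
    then obtain x y where xy: "x \<in> S" "y \<in> S" "x < y" "e = {parab x, parab y}" by (rule parabola_edgeE)
    show "e \<subseteq> verts ?G" using xy by (simp add: parabola_graph_def)
    show "arc (curve ?G e)" "{pathstart (curve ?G e), pathfinish (curve ?G e)} = e"
      unfolding xy(4) parabola_curve[OF xy(3)] using xy(3) by (simp_all add: arc_linepath)
    show "edge_interior ?G e \<inter> verts ?G = {}"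
    proof -
      have "w \<notin> chord x y ` {x<..<y}" if "w \<in> parab ` S" for w using that by (auto simp: parab_eq_chord)
      moreover have "verts ?G = parab ` S" by (simp add: parabola_graph_def)
      ultimately show ?thesis unfolding xy(4) inter[OF xy(3)] by blast
    qed
    fix f p assume f: "f \<in> edges ?G" "e \<noteq> f" and p: "p \<in> edge_interior ?G e \<inter> edge_interior ?G f"
    obtain c d where cd: "c \<in> S" "d \<in> S" "c < d" "f = {parab c, parab d}" using f(1) by (rule parabola_edgeE)
    have "p \<in> chord x y ` {x<..<y}" "p \<in> chord c d ` {c<..<d}" using p unfolding xy(4) cd(4) inter[OF xy(3)] inter[OF cd(3)] by auto
    from crossing[OF this] obtain t where t: "p = chord x y t" "p = chord c d t" "t \<in> {x<..<y}" "t \<in> {c<..<d}" by blast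
    have "(x, y) \<noteq> (c, d)" using f(2) xy cd by auto
    moreover have eq: "chord x y t = chord c d t" using t(1,2) by simp
    ultimately have "x + y \<noteq> c + d" by (rule chords_common_point[OF xy(3) cd(3)])
    then show "proper_crossing (path_image (curve ?G e)) (path_image (curve ?G f)) p"
      unfolding xy(4) cd(4) parabola_curve_image[OF xy(3)] parabola_curve_image[OF cd(3)] t(1)
      using t(3,4) eq by (intro proper_crossing_chords) auto
  qed
  moreover have "p = q" if e: "e \<in> edges ?G" "f \<in> edges ?G" "e \<noteq> f"
    and pq: "p \<in> path_image (curve ?G e) \<inter> path_image (curve ?G f)" "q \<in> path_image (curve ?G e) \<inter> path_image (curve ?G f)" for e f p q
  proof -
    obtain x y where xy: "x \<in> S" "y \<in> S" "x < y" "e = {parab x, parab y}" using e(1) by (rule parabola_edgeE)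
    obtain c d where cd: "c \<in> S" "d \<in> S" "c < d" "f = {parab c, parab d}" using e(2) by (rule parabola_edgeE)
    have pq': "p \<in> chord x y ` {x..y}" "p \<in> chord c d ` {c..d}" "q \<in> chord x y ` {x..y}" "q \<in> chord c d ` {c..d}"
      using pq unfolding xy(4) cd(4) parabola_curve_image[OF xy(3)] parabola_curve_image[OF cd(3)] by auto
    obtain t where t: "p = chord x y t" "p = chord c d t" using crossing[OF pq'(1,2)] by blast
    obtain s where s: "q = chord x y s" "q = chord c d s" using crossing[OF pq'(3,4)] by blast
    have "(x, y) \<noteq> (c, d)" using e(3) xy cd by auto
    moreover have "chord x y t = chord c d t" using t by simp
    ultimately have slope: "x + y \<noteq> c + d" by (rule chords_common_point[OF xy(3) cd(3)])
    \<comment> \<open>The real part of a common point solves a linear equation whose leading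
      coefficient is the nonzero difference of the slopes.\<close>
    have "(x + y - (c + d)) * t = x * y - c * d" "(x + y - (c + d)) * s = x * y - c * d"
      using t s by (auto simp: chord_alt algebra_simps)
    then have "(x + y - (c + d)) * (t - s) = 0" by (simp add: algebra_simps)
    then have "t = s" using slope by simp
    then show "p = q" using t s by simp
  qed
  ultimately show ?thesis unfolding simple_topological_graph_def by blast
qed

lemma parabola_complete: "complete_graph (parabola_graph S)"
  by (simp add: complete_graph_def parabola_graph_def)

lemma parabola_convex:
  assumes "finite S"
  shows "complete_convex_geometric_graph (card S) (parabola_graph S)"
  unfolding complete_convex_geometric_graph_def
proof (intro conjI ballI impI)
  show "topological_graph (parabola_graph S)"
    using parabola_simple[OF assms] by (simp add: simple_topological_graph_def)
  show "complete_graph (parabola_graph S)" by (rule parabola_complete)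
  show "card (verts (parabola_graph S)) = card S"
    by (simp add: parabola_graph_def card_image inj_on_def)
  show "convex_position (verts (parabola_graph S))"
    unfolding convex_position_def
  proof
    fix v assume "v \<in> verts (parabola_graph S)"
    then obtain x where x: "x \<in> S" "v = parab x" by (auto simp: parabola_graph_def)
    \<comment> \<open>The open half plane above the tangent at \<open>parab x\<close>; a point
      \<open>parab y\<close> lies (y - x)^2 above this tangent.\<close>
    let ?H = "{z. 2 * x * Re z - Im z < x\<^sup>2}"
    have "convex {z. inner (Complex (2 * x) (- 1)) z < x\<^sup>2}" by (rule convex_halfspace_lt)
    then have "convex ?H" by (simp add: inner_complex_def)
    moreover have "verts (parabola_graph S) - {v} \<subseteq> ?H"
    proof
      fix w assume "w \<in> verts (parabola_graph S) - {v}"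
      then obtain y where y: "w = parab y" "y \<noteq> x" using x by (auto simp: parabola_graph_def)
      have "0 < (y - x)\<^sup>2" using y by simp
      then show "w \<in> ?H" by (simp add: y parab_def power2_eq_square algebra_simps)
    qed
    ultimately have "convex hull (verts (parabola_graph S) - {v}) \<subseteq> ?H" by (intro hull_minimal) auto
    moreover have "v \<notin> ?H" by (simp add: x parab_def power2_eq_square)
    ultimately show "v \<notin> convex hull (verts (parabola_graph S) - {v})" by blast
  qed
  fix u v assume "u \<in> verts (parabola_graph S)" "v \<in> verts (parabola_graph S)" "u \<noteq> v"
  then obtain x y where xy: "u = parab x" "v = parab y" "x \<noteq> y" by (auto simp: parabola_graph_def)
  show "path_image (curve (parabola_graph S) {u, v}) = closed_segment u v"
  proof (cases "x < y")
    case True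
    then show ?thesis using xy by (simp add: parabola_curve)
  next
    case False
    then have "curve (parabola_graph S) {parab y, parab x} = linepath (parab y) (parab x)" using xy by (intro parabola_curve) auto
    then show ?thesis using xy by (simp add: insert_commute closed_segment_commute)
  qed
qed

lemma chords_meet_iff:
  assumes "x < y" "c < d" "distinct [x,y,c,d]"
  shows "chord x y ` {x..y} \<inter> chord c d ` {c..d} \<noteq> {} \<longleftrightarrow> (x < c \<and> c < y \<and> y < d) \<or> (c < x \<and> x < d \<and> d < y)"
proof -
  have meet: "chord x y ` {x..y} \<inter> chord c d ` {c..d} \<noteq> {}" if "x < c" "c < y" "y < d" for x y c d :: real
  proof -
    \<comment> \<open>The real part of the point where the two lines meet; the inequalities below
      place it on both chords.\<close>
    define t where "t = (c * d - x * y) / (c + d - (x + y))"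
    have D: "c + d - (x + y) > 0" using that by simp
    have tt: "(c + d - (x + y)) * t = c * d - x * y" using D by (simp add: t_def)
    have "(c + d - (x + y)) * (t - c) = (y - c) * (c - x)" using tt by (simp add: algebra_simps)
    moreover have "(y - c) * (c - x) > 0" using that by simp
    ultimately have "c \<le> t" using D by (metis diff_gt_0_iff_gt less_eq_real_def zero_less_mult_pos)
    have "(c + d - (x + y)) * (y - t) = (d - y) * (y - c)" using tt by (simp add: algebra_simps)
    moreover have "(d - y) * (y - c) > 0" using that by simp
    ultimately have "t \<le> y" using D by (metis diff_gt_0_iff_gt less_eq_real_def zero_less_mult_pos)
    have "chord x y t = chord c d t" using tt by (simp add: chord_alt algebra_simps)
    moreover have "t \<in> {x..y}" "t \<in> {c..d}" using \<open>c \<le> t\<close> \<open>t \<le> y\<close> that by auto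
    ultimately show ?thesis by (metis IntI empty_iff imageI)
  qed
  have nested: "chord x y ` {x..y} \<inter> chord c d ` {c..d} = {}" if "x < c" "d < y" "c < d" for x y c d :: real
  proof -
    \<comment> \<open>Over the inner interval the outer chord is strictly higher above the
      parabola.\<close>
    have "(t - x) * (y - t) \<noteq> (t - c) * (d - t)" if "t \<in> {c..d}" for t
    proof -
      have "(t - c) * (d - t) \<le> (t - x) * (d - t)" using that \<open>x < c\<close> by (intro mult_right_mono) auto
      also have "\<dots> < (t - x) * (y - t)" using that \<open>x < c\<close> \<open>d < y\<close> by (intro mult_strict_left_mono) auto
      finally show ?thesis by simp
    qed
    then show ?thesis by (auto simp: chord_eq_iff)
  qed
  have apart: "chord x y ` {x..y} \<inter> chord c d ` {c..d} = {}" if "y < c" for x y c d :: real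
    using that by (auto simp: chord_eq_iff)
  consider "x < c \<and> c < y \<and> y < d" | "c < x \<and> x < d \<and> d < y" | "x < c \<and> d < y" | "c < x \<and> y < d" | "y < c" | "d < x"
    using assms by fastforce
  then show ?thesis
  proof cases
    case 1 then show ?thesis using meet[of x c y d] by blast
  next
    case 2 then show ?thesis using meet[of c x d y] by blast
  next
    case 3 then show ?thesis using nested[of x c d y] assms by auto
  next
    case 4 then show ?thesis using nested[of c x y d] assms by auto
  next
    case 5 then show ?thesis using apart[of y c x d] assms by auto
  next
    case 6 then show ?thesis using apart[of d x c y] assms by auto
  qed
qed

section \<open>Unavoidable patterns\<close>

context crossing_system
begin

definition color :: "'a \<Rightarrow> (nat \<Rightarrow> 'a) \<Rightarrow> nat \<Rightarrow> nat \<Rightarrow> nat \<Rightarrow> nat" where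
  "color v f i j k = (if X v (f i) (f j) (f k) then 1 else if X v (f j) (f i) (f k) then 2
     else if X v (f k) (f i) (f j) then 3 else 0)"

context
  fixes v f and N :: nat
  assumes v: "v \<in> V" and inj: "inj_on f {..<N}" and fV: "f ` {..<N} \<subseteq> V - {v}"
    and sep: "\<And>i j k l. i < j \<Longrightarrow> j < k \<Longrightarrow> k < l \<Longrightarrow> l < N \<Longrightarrow> sep v (f i) (f k) (f j) (f l)"
begin

lemma four_points:
  assumes "i < j" "j < k" "k < l" "l < N"
  shows "{v, f i, f j, f k, f l} \<subseteq> V" (is ?G1) "distinct [v, f i, f j, f k, f l]" (is ?G2)
proof -
  have "{i,j,k,l} \<subseteq> {..<N}" "distinct [i,j,k,l]" using assms by auto
  moreover from this have "distinct [f i, f j, f k, f l]" using inj_on_eq_iff[OF inj] by auto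
  ultimately show ?G1 ?G2 using v fV by auto
qed

lemma color_iff:
  assumes "i < j" "j < k" "k < N"
  shows "color v f i j k = 1 \<longleftrightarrow> X v (f i) (f j) (f k)" (is ?G1) "color v f i j k = 2 \<longleftrightarrow> X v (f j) (f i) (f k)" (is ?G2)
    "color v f i j k = 3 \<longleftrightarrow> X v (f k) (f i) (f j)" (is ?G3)
    "color v f i j k = 0 \<longleftrightarrow> \<not> (X v (f i) (f j) (f k) \<or> X v (f j) (f i) (f k) \<or> X v (f k) (f i) (f j))" (is ?G4)
    "color v f i j k \<in> {0,3} \<longleftrightarrow> \<not> (X v (f i) (f j) (f k) \<or> X v (f j) (f i) (f k))" (is ?G5)
proof -
  have "{i,j,k} \<subseteq> {..<N}" "distinct [i,j,k]" using assms by auto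
  moreover from this have "distinct [f i, f j, f k]" using inj_on_eq_iff[OF inj] by auto
  ultimately have "{v, f i, f j, f k} \<subseteq> V" "distinct [v, f i, f j, f k]" using v fV by auto
  note one = at_most_one_crossing[OF this]
  show ?G1 ?G2
    ?G3
    ?G4
    ?G5
    using one unfolding color_def by auto
qed

lemma triple_coloring_color: "triple_coloring N (color v f)"
proof
  show "color v f i j k \<le> 3" for i j k by (simp add: color_def)
  fix i j k l assume l: "i < j" "j < k" "k < l" "l < N"
  note F = K5_color_rules[OF four_points[OF l]] and S = sep[OF l]
  have l': "j < l" "i < k" "k < N" "j < N" using l by auto
  note C = color_iff[OF l(1,2) l'(3)] color_iff[OF l(1) l'(1) l(4)] color_iff[OF l'(2) l(3,4)] color_iff[OF l(2,3,4)]
  show "color v f i k l = 1" if "color v f i j k = 1" "color v f i j l = 1" "color v f j k l = 1"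
    using F(3)[OF S] that unfolding C by blast
  show "color v f i k l = 2" if "color v f i j k = 2" "color v f i j l = 2" "color v f j k l = 2"
    using F(4)[OF S] that unfolding C by blast
  show "color v f i k l = 3" if "color v f i j k = 3" "color v f i j l = 3" "color v f j k l = 3"
    using F(5)[OF S] that unfolding C by blast
  show "color v f i k l \<in> {0,3}" if "color v f i j k \<in> {0,3}" "color v f i j l \<in> {0,3}" "color v f j k l \<in> {0,3}"
    using F(6)[OF S] that unfolding C by blast
  show "color v f j k l = 0" if "color v f i j k = 0" "color v f i j l = 0" "color v f i k l = 0" "color v f j k l \<in> {0,3}"
    using F(7)[OF S] that unfolding C by blast
qed

text \<open>The order around v makes exactly one of the three values of \<open>sep\<close> true. In
  each of them the color determines the four terms that involve v, so the fifth, a crossing inside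
  the quadruple, can be solved for.\<close>

lemma monochromatic_pattern:
  assumes l: "i < j" "j < k" "k < l" "l < N"
    and c: "color v f i j k = \<kappa>" "color v f i j l = \<kappa>" "color v f i k l = \<kappa>" "color v f j k l = \<kappa>"
  shows "\<kappa> \<in> {0, 2} \<Longrightarrow> X (f i) (f k) (f j) (f l) \<and> \<not> X (f i) (f j) (f k) (f l) \<and> \<not> X (f i) (f l) (f j) (f k)"
    "\<kappa> \<in> {1, 3} \<Longrightarrow> \<not> X (f i) (f k) (f j) (f l) \<and> \<not> X (f i) (f j) (f k) (f l) \<and> X (f i) (f l) (f j) (f k)"
proof -
  note F = K5_color_rules(1,2)[OF four_points[OF l]] and S = sep[OF l]
  have l': "j < l" "i < k" "k < N" "j < N" using l by auto
  note C = color_iff(1-3)[OF l(1,2) l'(3), unfolded c, symmetric] color_iff(1-3)[OF l(1) l'(1) l(4), unfolded c, symmetric]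
    color_iff(1-3)[OF l'(2) l(3,4), unfolded c, symmetric] color_iff(1-3)[OF l(2,3,4), unfolded c, symmetric]
  have seps: "sep v (f i) (f k) (f j) (f l)" "\<not> sep v (f i) (f j) (f k) (f l)" "\<not> sep v (f i) (f l) (f j) (f k)"
    using F S by argo+
  note seps' = seps[unfolded sep_def C]
  show "X (f i) (f k) (f j) (f l) \<and> \<not> X (f i) (f j) (f k) (f l) \<and> \<not> X (f i) (f l) (f j) (f k)" if "\<kappa> \<in> {0, 2}"
  proof -
    have "\<kappa> = 0 \<or> \<kappa> = 2" using that by simp
    then show ?thesis using seps' by (elim disjE) simp_all
  qed
  show "\<not> X (f i) (f k) (f j) (f l) \<and> \<not> X (f i) (f j) (f k) (f l) \<and> X (f i) (f l) (f j) (f k)" if "\<kappa> \<in> {1, 3}"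
  proof -
    have "\<kappa> = 1 \<or> \<kappa> = 3" using that by simp
    then show ?thesis using seps' by (elim disjE) simp_all
  qed
qed

end

definition convex_pattern :: "nat \<Rightarrow> (nat \<Rightarrow> 'a) \<Rightarrow> bool" where
  "convex_pattern m w \<longleftrightarrow> (\<forall>i j k l. i < j \<longrightarrow> j < k \<longrightarrow> k < l \<longrightarrow> l < m \<longrightarrow>
     X (w i) (w k) (w j) (w l) \<and> \<not> X (w i) (w j) (w k) (w l) \<and> \<not> X (w i) (w l) (w j) (w k))"

definition twisted_pattern :: "nat \<Rightarrow> (nat \<Rightarrow> 'a) \<Rightarrow> bool" where
  "twisted_pattern m w \<longleftrightarrow> (\<forall>i j k l. i < j \<longrightarrow> j < k \<longrightarrow> k < l \<longrightarrow> l < m \<longrightarrow>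
     \<not> X (w i) (w k) (w j) (w l) \<and> \<not> X (w i) (w j) (w k) (w l) \<and> X (w i) (w l) (w j) (w k))"

theorem unavoidable_patterns:
  assumes fin: "finite V" and card: "2 * N + 3 \<le> card V"
    and m: "m1 > 0" "m2 > 0" and p: "m1 \<le> 2 ^ p1" "m2 \<le> 2 ^ p2"
    and N: "(2 * 4 ^ (p1 * p2 + p2)) ^ Suc (((m1 - 1) * (m2 - 1))\<^sup>2) \<le> N"
  shows "\<exists>w. inj_on w {..<m1} \<and> w ` {..<m1} \<subseteq> V \<and> convex_pattern m1 w \<or>
    inj_on w {..<m2} \<and> w ` {..<m2} \<subseteq> V \<and> twisted_pattern m2 w"
proof -
  have "V \<noteq> {}" using card by auto
  then obtain v where v: "v \<in> V" by blast
  obtain f where f: "inj_on f {..<N}" "f ` {..<N} \<subseteq> V - {v}"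
    and s: "\<And>i j k l. i < j \<Longrightarrow> j < k \<Longrightarrow> k < l \<Longrightarrow> l < N \<Longrightarrow> sep v (f i) (f k) (f j) (f l)"
    using sep_order[OF fin v card] by blast
  interpret triple_coloring N "color v f" by (rule triple_coloring_color[OF v f s])
  have "found m1 m2" by (rule homogeneous_subset[OF m p N])
  then obtain C \<kappa> m where C: "C \<subseteq> {..<N}" "card C = m" "homogeneous C \<kappa>" "m = m1 \<and> \<kappa> \<in> {0,2} \<or> m = m2 \<and> \<kappa> \<in> {1,3}"
    unfolding found_def by blast
  have "finite C" using C(1) finite_subset by blast
  then obtain h where h: "bij_betw h {..<m} C" "strict_mono_on {..<m} h"
    using ex_bij_betw_strict_mono_card C(2) by blast
  let ?w = "f \<circ> h"
  have hC: "h i \<in> C" if "i < m" for i using h(1) that by (auto simp: bij_betw_def)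
  have inj: "inj_on ?w {..<m}"
    using h(1) f(1) C(1) by (intro comp_inj_on) (auto simp: bij_betw_def intro: inj_on_subset)
  have sub: "?w ` {..<m} \<subseteq> V" using hC C(1) f(2) by (auto simp: image_subset_iff)
  have mono: "h i < h j" if "i < j" "j < m" for i j using strict_mono_onD[OF h(2)] that by simp
  have pat: "(\<kappa> \<in> {0, 2} \<longrightarrow> X (?w i) (?w k) (?w j) (?w l) \<and> \<not> X (?w i) (?w j) (?w k) (?w l) \<and> \<not> X (?w i) (?w l) (?w j) (?w k)) \<and>
     (\<kappa> \<in> {1, 3} \<longrightarrow> \<not> X (?w i) (?w k) (?w j) (?w l) \<and> \<not> X (?w i) (?w j) (?w k) (?w l) \<and> X (?w i) (?w l) (?w j) (?w k))"
    if l: "i < j" "j < k" "k < l" "l < m" for i j k l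
  proof -
    have l': "j < m" "k < m" "i < m" using l by auto
    have hh: "h i < h j" "h j < h k" "h k < h l" "h j < h l" "h i < h k"
      using mono[OF l(1) l'(1)] mono[OF l(2) l'(2)] mono[OF l(3) l(4)] by auto
    have hN: "h l < N" using hC[OF l(4)] C(1) by auto
    have col: "color v f (h i) (h j) (h k) = \<kappa>" "color v f (h i) (h j) (h l) = \<kappa>"
      "color v f (h i) (h k) (h l) = \<kappa>" "color v f (h j) (h k) (h l) = \<kappa>"
      using C(3) hh hC[OF l'(3)] hC[OF l'(1)] hC[OF l'(2)] hC[OF l(4)] unfolding homogeneous_def by blast+
    show ?thesis using monochromatic_pattern[OF v f s hh(1-3) hN col] by simp
  qed
  have "m = m1 \<Longrightarrow> \<kappa> \<in> {0,2} \<Longrightarrow> convex_pattern m1 ?w" unfolding convex_pattern_def using pat by simp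
  moreover have "m = m2 \<Longrightarrow> \<kappa> \<in> {1,3} \<Longrightarrow> twisted_pattern m2 ?w" unfolding twisted_pattern_def using pat by simp
  ultimately show ?thesis using C(4) inj sub by blast
qed

end

section \<open>Induced subgraphs and weak isomorphism\<close>

definition induced_subgraph :: "topgraph \<Rightarrow> complex set \<Rightarrow> topgraph" where
  "induced_subgraph G W = \<lparr>verts = W, edges = {{u, v} | u v. u \<in> W \<and> v \<in> W \<and> u \<noteq> v}, curve = curve G\<rparr>"

lemma edges_cross_induced_subgraph: "edges_cross (induced_subgraph G W) e f = edges_cross G e f"
  by (simp add: edges_cross_def edge_interior_def induced_subgraph_def)

lemma weakly_isomorphic_by_enumeration:
  fixes m :: nat
  assumes G: "simple_topological_graph G" "complete_graph G" and H: "simple_topological_graph H" "complete_graph H"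
    and w: "bij_betw w {..<m} (verts G)" and z: "bij_betw z {..<m} (verts H)"
    and cross: "\<And>i j k l. i < j \<Longrightarrow> j < m \<Longrightarrow> k < l \<Longrightarrow> l < m \<Longrightarrow>
       edges_cross G {w i, w j} {w k, w l} \<longleftrightarrow> edges_cross H {z i, z j} {z k, z l}"
  shows "weakly_isomorphic G H"
proof -
  define \<phi> where "\<phi> = z \<circ> inv_into {..<m} w"
  have \<phi>: "bij_betw \<phi> (verts G) (verts H)"
    unfolding \<phi>_def using bij_betw_inv_into[OF w] z by (rule bij_betw_trans)
  have \<phi>w: "\<phi> (w i) = z i" if "i < m" for i
    unfolding \<phi>_def using that w by (simp add: bij_betw_def)
  have edgeE: "\<exists>i j. i < j \<and> j < m \<and> e = {u i, u j}"
    if e: "e \<in> edges K" and K: "complete_graph K" "bij_betw u {..<m} (verts K)" for e u and K :: topgraph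
  proof -
    obtain x y where xy: "x \<in> verts K" "y \<in> verts K" "x \<noteq> y" "e = {x, y}"
      using e K(1) unfolding complete_graph_def by blast
    obtain i j where ij: "i < m" "j < m" "x = u i" "y = u j"
      using K(2) xy(1,2) unfolding bij_betw_def by blast
    have "i \<noteq> j" using ij xy(3) by blast
    then consider "i < j" | "j < i" by linarith
    then show ?thesis
    proof cases
      case 1 then show ?thesis using xy(4) ij by blast
    next
      case 2
      moreover have "e = {u j, u i}" using xy(4) ij by blast
      ultimately show ?thesis using ij by blast
    qed
  qed
  have edgeI: "{u i, u j} \<in> edges K"
    if "i < j" "j < m" and K: "complete_graph K" "bij_betw u {..<m} (verts K)" for i j u and K :: topgraph
  proof -
    have "u i \<in> verts K" "u j \<in> verts K" "u i \<noteq> u j"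
      using that unfolding bij_betw_def inj_on_def by auto
    then show ?thesis using K(1) unfolding complete_graph_def by blast
  qed
  have sub: "e \<subseteq> verts G" if "e \<in> edges G" for e
    using that unfolding G(2)[unfolded complete_graph_def] by blast
  have \<psi>: "bij_betw ((`) \<phi>) (edges G) (edges H)"
  proof (rule bij_betw_imageI)
    show "inj_on ((`) \<phi>) (edges G)"
      using inj_on_image_eq_iff[OF bij_betw_imp_inj_on[OF \<phi>]] sub by (intro inj_onI) blast
    show "(`) \<phi> ` edges G = edges H"
    proof (intro equalityI subsetI)
      fix e assume "e \<in> (`) \<phi> ` edges G"
      then obtain e' where e': "e' \<in> edges G" "e = \<phi> ` e'" by blast
      obtain i j where ij: "i < j" "j < m" "e' = {w i, w j}" using edgeE[OF e'(1) G(2) w] by blast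
      then have "e = {z i, z j}" using e'(2) \<phi>w by simp
      then show "e \<in> edges H" using edgeI[OF ij(1,2) H(2) z] by simp
    next
      fix e assume "e \<in> edges H"
      then obtain i j where ij: "i < j" "j < m" "e = {z i, z j}" using edgeE[OF _ H(2) z] by blast
      then have "e = \<phi> ` {w i, w j}" using \<phi>w by simp
      then show "e \<in> (`) \<phi> ` edges G" using edgeI[OF ij(1,2) G(2) w] by blast
    qed
  qed
  have inc: "v \<in> e \<longleftrightarrow> \<phi> v \<in> \<phi> ` e" if "v \<in> verts G" "e \<in> edges G" for v e
    using inj_on_image_mem_iff[OF bij_betw_imp_inj_on[OF \<phi>] that(1) sub[OF that(2)]] by simp
  have cr: "edges_cross G e f \<longleftrightarrow> edges_cross H (\<phi> ` e) (\<phi> ` f)" if e: "e \<in> edges G" and f: "f \<in> edges G" for e f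
  proof -
    obtain i j where ij: "i < j" "j < m" "e = {w i, w j}" using edgeE[OF e G(2) w] by blast
    obtain k l where kl: "k < l" "l < m" "f = {w k, w l}" using edgeE[OF f G(2) w] by blast
    have "\<phi> ` e = {z i, z j}" "\<phi> ` f = {z k, z l}" using ij kl \<phi>w by simp_all
    then show ?thesis using cross[OF ij(1,2) kl(1,2)] ij kl by simp
  qed
  show ?thesis unfolding weakly_isomorphic_def
    using G(1) H(1) \<phi> \<psi> inc cr by (intro conjI exI[of _ \<phi>] exI[of _ "(`) \<phi>"]) auto
qed

lemma (in simple_complete_drawing) induced_subgraph_props:
  assumes "W \<subseteq> V"
  shows "topological_subgraph (induced_subgraph G W) G" "simple_topological_graph (induced_subgraph G W)" "complete_graph (induced_subgraph G W)"
proof -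
  let ?H = "induced_subgraph G W"
  have e: "edges ?H \<subseteq> edges G"
  proof
    fix e assume "e \<in> edges ?H"
    then obtain u v where "u \<in> W" "v \<in> W" "u \<noteq> v" "e = {u,v}" by (auto simp: induced_subgraph_def)
    then show "e \<in> edges G" using edge_iff[of u v] assms by auto
  qed
  have c: "curve ?H = curve G" "verts ?H = W" by (simp_all add: induced_subgraph_def)
  have i: "edge_interior ?H e = edge_interior G e" for e by (simp add: edge_interior_def c)
  have sub: "e \<subseteq> W" if "e \<in> edges ?H" for e using that by (auto simp: induced_subgraph_def)
  have "topological_graph ?H" unfolding topological_graph_def c i
  proof (intro conjI ballI impI)
    show "finite W" using finite_V assms finite_subset by blast
    fix e assume e': "e \<in> edges ?H"
    then have eG: "e \<in> edges G" using e by blast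
    then obtain u v where uv: "e = {u,v}" using complete unfolding complete_graph_def by blast
    note ep = edge_props[OF eG[unfolded uv]]
    show "e \<subseteq> W" using sub[OF e'] .
    show "arc (curve G e)" "{pathstart (curve G e), pathfinish (curve G e)} = e" using ep uv by simp_all
    show "edge_interior G e \<inter> W = {}" using ep(3) assms uv by blast
    fix f p assume "f \<in> edges ?H" "e \<noteq> f" "p \<in> edge_interior G e \<inter> edge_interior G f"
    then show "proper_crossing (path_image (curve G e)) (path_image (curve G f)) p"
      using topological e eG unfolding topological_graph_def by (meson subsetD)
  qed
  then show "topological_subgraph ?H G" unfolding topological_subgraph_def c using e assms by simp
  show "simple_topological_graph ?H" unfolding simple_topological_graph_def c
    using \<open>topological_graph ?H\<close> simple e unfolding simple_topological_graph_def by (meson subsetD)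
  show "complete_graph ?H" by (simp add: complete_graph_def induced_subgraph_def)
qed

text \<open>The patterns speak of four increasing indices, while the target graphs are described by
  two pairs i < j and k < l. Pairs with a common index never cross; otherwise they are apart,
  interleaved or nested, in two ways each.\<close>

lemma (in simple_complete_drawing) crossing_system_patterns:
  fixes m :: nat
  assumes w: "inj_on w {..<m}" "w ` {..<m} \<subseteq> V" and l: "i < j" "j < m" "k < l" "l < m"
  shows "crossing_system.convex_pattern X m w \<Longrightarrow>
      edges_cross G {w i, w j} {w k, w l} \<longleftrightarrow> i < k \<and> k < j \<and> j < l \<or> k < i \<and> i < l \<and> l < j"
    "crossing_system.twisted_pattern X m w \<Longrightarrow>
      edges_cross G {w i, w j} {w k, w l} \<longleftrightarrow> i < k \<and> k < l \<and> l < j \<or> k < i \<and> i < j \<and> j < l"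
proof -
  have lm: "i < m" "k < m" using l by auto
  have wV: "w i \<in> V" "w j \<in> V" "w k \<in> V" "w l \<in> V" using w(2) l lm by auto
  have weq: "w s = w t \<longleftrightarrow> s = t" if "s < m" "t < m" for s t using inj_on_eq_iff[OF w(1)] that by simp
  have ne: "w i \<noteq> w j" "w k \<noteq> w l" using weq l lm by auto
  have iff: "edges_cross G {w i, w j} {w k, w l} \<longleftrightarrow> distinct [i,j,k,l] \<and> X (w i) (w j) (w k) (w l)"
    using edges_cross_iff[OF wV(1,2) ne(1) wV(3,4) ne(2)] weq l lm by auto
  have sym: "X b a c d = X a b c d" "X a b d c = X a b c d" "X c d a b = X a b c d" for a b c d
    unfolding X_def E_sym[of b a] E_sym[of d c] by (simp_all add: Int_commute)
  interpret crossing_system V X by (rule crossing_system)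
  consider "\<not> distinct [i,j,k,l]" | "i < j \<and> j < k \<and> k < l" | "k < l \<and> l < i \<and> i < j" | "i < k \<and> k < j \<and> j < l"
    | "k < i \<and> i < l \<and> l < j" | "i < k \<and> k < l \<and> l < j" | "k < i \<and> i < j \<and> j < l"
    using l(1,3) by fastforce
  note cs = this
  show "edges_cross G {w i, w j} {w k, w l} \<longleftrightarrow> i < k \<and> k < j \<and> j < l \<or> k < i \<and> i < l \<and> l < j" if c: "convex_pattern m w"
    using cs
  proof cases
    case 1 then show ?thesis using iff by auto
  next
    case 2 then show ?thesis using iff c l unfolding convex_pattern_def by auto
  next
    case 3 then show ?thesis using iff c l sym(3)[of "w i" "w j" "w k" "w l"] unfolding convex_pattern_def by auto
  next
    case 4 then show ?thesis using iff c l unfolding convex_pattern_def by auto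
  next
    case 5 then show ?thesis using iff c l sym(3)[of "w i" "w j" "w k" "w l"] unfolding convex_pattern_def by auto
  next
    case 6 then show ?thesis using iff c l unfolding convex_pattern_def by auto
  next
    case 7 then show ?thesis using iff c l sym(3)[of "w i" "w j" "w k" "w l"] unfolding convex_pattern_def by auto
  qed
  show "edges_cross G {w i, w j} {w k, w l} \<longleftrightarrow> i < k \<and> k < l \<and> l < j \<or> k < i \<and> i < j \<and> j < l" if c: "twisted_pattern m w"
    using cs
  proof cases
    case 1 then show ?thesis using iff by auto
  next
    case 2 then show ?thesis using iff c l unfolding twisted_pattern_def by auto
  next
    case 3 then show ?thesis using iff c l sym(3)[of "w i" "w j" "w k" "w l"] unfolding twisted_pattern_def by auto
  next
    case 4 then show ?thesis using iff c l unfolding twisted_pattern_def by auto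
  next
    case 5 then show ?thesis using iff c l sym(3)[of "w i" "w j" "w k" "w l"] unfolding twisted_pattern_def by auto
  next
    case 6 then show ?thesis using iff c l unfolding twisted_pattern_def by auto
  next
    case 7 then show ?thesis using iff c l sym(3)[of "w i" "w j" "w k" "w l"] unfolding twisted_pattern_def by auto
  qed
qed

text \<open>The parabola drawing over 0, ..., m - 1 has the convex pattern itself, so
  \<open>crossing_system_patterns\<close> reads off the same crossing condition for both
  drawings.\<close>

lemma (in simple_complete_drawing) convex_subgraph:
  fixes m :: nat
  assumes w: "inj_on w {..<m}" "w ` {..<m} \<subseteq> V" and pat: "crossing_system.convex_pattern X m w"
  shows "\<exists>H C. topological_subgraph H G \<and> complete_convex_geometric_graph m C \<and> weakly_isomorphic H C"
proof -
  let ?H = "induced_subgraph G (w ` {..<m})" and ?S = "real ` {..<m}"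
  let ?C = "parabola_graph ?S" and ?z = "\<lambda>i. parab (real i)"
  note H = induced_subgraph_props[OF w(2)]
  have finS: "finite ?S" by simp
  interpret C: simple_complete_drawing ?C
    using parabola_simple[OF finS] parabola_complete by unfold_locales
  have vC: "verts ?C = ?z ` {..<m}" by (simp add: parabola_graph_def image_image)
  have injz: "inj_on ?z {..<m}" by (auto simp: inj_on_def)
  have meets: "C.X (?z i) (?z j) (?z k) (?z l) \<longleftrightarrow> i < k \<and> k < j \<and> j < l \<or> k < i \<and> i < l \<and> l < j"
    if "i < j" "k < l" "distinct [i,j,k,l]" for i j k l
  proof -
    have "C.E (?z i) (?z j) = chord i j ` {real i..real j}" "C.E (?z k) (?z l) = chord k l ` {real k..real l}"
      using that parabola_curve_image unfolding C.E_def by auto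
    then show ?thesis unfolding C.X_def using chords_meet_iff[of "real i" "real j" "real k" "real l"] that by simp
  qed
  interpret CC: crossing_system "verts ?C" C.X by (rule C.crossing_system)
  have patC: "CC.convex_pattern m ?z" unfolding CC.convex_pattern_def
  proof (intro allI impI)
    fix i j k l :: nat assume "i < j" "j < k" "k < l"
    then show "C.X (?z i) (?z k) (?z j) (?z l) \<and> \<not> C.X (?z i) (?z j) (?z k) (?z l) \<and> \<not> C.X (?z i) (?z l) (?z j) (?z k)"
      using meets[of i k j l] meets[of i j k l] meets[of i l j k] by simp
  qed
  have "weakly_isomorphic ?H ?C"
  proof (rule weakly_isomorphic_by_enumeration[OF H(2,3) parabola_simple[OF finS] parabola_complete])
    show "bij_betw w {..<m} (verts ?H)" using w(1) by (simp add: bij_betw_def induced_subgraph_def)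
    show "bij_betw ?z {..<m} (verts ?C)" using injz vC by (simp add: bij_betw_def)
    fix i j k l assume l: "i < j" "j < m" "k < l" "l < m"
    show "edges_cross ?H {w i, w j} {w k, w l} \<longleftrightarrow> edges_cross ?C {?z i, ?z j} {?z k, ?z l}"
      unfolding edges_cross_induced_subgraph crossing_system_patterns(1)[OF w l pat]
      using C.crossing_system_patterns(1)[OF injz _ l patC] vC by simp
  qed
  moreover have "complete_convex_geometric_graph m ?C"
    using parabola_convex[OF finS] by (simp add: card_image)
  ultimately show ?thesis using H(1) by blast
qed

text \<open>The twisted graph is characterised by its crossings alone, so the induced subgraph
  itself serves as T.\<close>

lemma (in simple_complete_drawing) twisted_subgraph:
  fixes m :: nat
  assumes w: "inj_on w {..<m}" "w ` {..<m} \<subseteq> V" and pat: "crossing_system.twisted_pattern X m w"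
  shows "\<exists>H T. topological_subgraph H G \<and> complete_twisted_graph m T \<and> weakly_isomorphic H T"
proof -
  let ?H = "induced_subgraph G (w ` {..<m})"
  note H = induced_subgraph_props[OF w(2)]
  have vH: "verts ?H = w ` {..<m}" by (simp add: induced_subgraph_def)
  have bw: "bij_betw w {..<m} (verts ?H)" using w(1) vH by (simp add: bij_betw_def)
  \<comment> \<open>The definition of the twisted graph numbers vertices from 1, the enumeration
    \<open>w\<close> from 0.\<close>
  have "bij_betw (\<lambda>i. i - 1) {1..m} {..<m}"
    by (rule bij_betwI[where g = Suc]) auto
  then have bij: "bij_betw (w \<circ> (\<lambda>i. i - 1)) {1..m} (verts ?H)" using bw by (rule bij_betw_trans)
  have "complete_twisted_graph m ?H" unfolding complete_twisted_graph_def
  proof (intro conjI exI[of _ "w \<circ> (\<lambda>i. i - 1)"] ballI impI)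
    show "card (verts ?H) = m" using bij_betw_same_card[OF bw] by simp
    fix i j k l assume l: "i \<in> {1..m}" "j \<in> {1..m}" "k \<in> {1..m}" "l \<in> {1..m}" "i < j" "k < l"
    then have "i - 1 < j - 1" "j - 1 < m" "k - 1 < l - 1" "l - 1 < m" by auto
    from crossing_system_patterns(2)[OF w this pat]
    show "edges_cross ?H {(w \<circ> (\<lambda>i. i - 1)) i, (w \<circ> (\<lambda>i. i - 1)) j} {(w \<circ> (\<lambda>i. i - 1)) k, (w \<circ> (\<lambda>i. i - 1)) l} \<longleftrightarrow>
       (i < k \<and> k < l \<and> l < j) \<or> (k < i \<and> i < j \<and> j < l)"
      unfolding edges_cross_induced_subgraph using l by auto
  qed (use H bij in simp_all)
  moreover have "weakly_isomorphic ?H ?H"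
    by (rule weakly_isomorphic_by_enumeration[OF H(2,3) H(2,3) bw bw]) simp
  ultimately show ?thesis using H(1) by blast
qed

section \<open>Arithmetic of the bound\<close>

lemma ceiling_log_bounds:
  fixes m :: nat
  assumes "m \<ge> 2"
  shows "m \<le> 2 ^ nat \<lceil>log 2 (real m)\<rceil>" "real (nat \<lceil>log 2 (real m)\<rceil>) \<le> 3 / 2 * log 2 (real m)"
proof -
  define p where "p = nat \<lceil>log 2 (real m)\<rceil>"
  have l1: "log 2 (real m) \<ge> 1" using assms by (simp add: le_log_iff)
  have p: "log 2 (real m) \<le> real p" "real p < log 2 (real m) + 1" unfolding p_def using l1 by linarith+
  have "real m = 2 powr log 2 (real m)" using assms by simp
  also have "\<dots> \<le> 2 powr real p" using p by (intro powr_mono) auto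
  also have "\<dots> = real (2 ^ p)" by (simp add: powr_realpow)
  finally show "m \<le> 2 ^ nat \<lceil>log 2 (real m)\<rceil>" unfolding p_def of_nat_le_iff .
  have "real p \<le> 3 / 2 * log 2 (real m)"
  proof -
    consider "p \<le> 1" | "p = 2" | "p \<ge> 3" by linarith
    then show ?thesis
    proof cases
      case 1 then show ?thesis using l1 by simp
    next
      case 2
      then have "log 2 (real m) > 1" using p by simp
      then have "real m > 2" using assms by (simp add: less_log_iff)
      then have "m \<ge> 3" by simp
      \<comment> \<open>Since 27 \<ge> 16, the logarithm of m is at least 4/3, which is exactly what
        p = 2 requires.\<close>
      then have "(3::real) ^ 3 \<le> real m ^ 3" by (intro power_mono) auto
      then have "log 2 16 \<le> log 2 (real m ^ 3)" using assms by (intro log_mono) auto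
      moreover have "log 2 (16::real) = 4" using log_pow_cancel[of 2 4] by simp
      ultimately have "4 \<le> 3 * log 2 (real m)" using assms by (simp add: log_nat_power)
      then show ?thesis using 2 by simp
    next
      case 3 then show ?thesis using p by linarith
    qed
  qed
  then show "real (nat \<lceil>log 2 (real m)\<rceil>) \<le> 3 / 2 * log 2 (real m)" unfolding p_def .
qed

text \<open>With N = 2^(e M) for the e and M below, 2 N + 3 \<le> 8 N because N \<ge> 1. So it is
  enough that 3 + e M < log n.\<close>

lemma size_bound:
  fixes m1 m2 n p1 p2 :: nat
  assumes m: "m1 \<ge> 2" "m2 \<ge> 2" and n: "n > 0"
    and log: "9 * (real m1 * real m2)\<^sup>2 * log 2 (real m1) * log 2 (real m2) < log 2 (real n)"
    and p: "real p1 \<le> 3 / 2 * log 2 (real m1)" "real p2 \<le> 3 / 2 * log 2 (real m2)"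
  shows "2 * (2 * 4 ^ (p1 * p2 + p2)) ^ Suc (((m1 - 1) * (m2 - 1))\<^sup>2) + 3 \<le> n"
proof -
  define e where "e = 1 + 2 * (p1 * p2 + p2)"
  define M where "M = Suc (((m1 - 1) * (m2 - 1))\<^sup>2)"
  define L where "L = log 2 (real m1) * log 2 (real m2)"
  define Q where "Q = m1 * m2"
  have l: "log 2 (real m1) \<ge> 1" "log 2 (real m2) \<ge> 1" using m by (simp_all add: le_log_iff)
  have L1: "L \<ge> 1" unfolding L_def using l mult_mono[of 1 "log 2 (real m1)" 1 "log 2 (real m2)"] by simp
  have lL: "log 2 (real m2) \<le> L" unfolding L_def using l mult_right_mono[of 1 "log 2 (real m1)" "log 2 (real m2)"] by simp
  have "real p1 * real p2 \<le> (3 / 2 * log 2 (real m1)) * (3 / 2 * log 2 (real m2))"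
    using p l by (intro mult_mono) auto
  then have "real p1 * real p2 \<le> 9 / 4 * L" by (simp add: L_def)
  \<comment> \<open>Here 1 + 2 (9/4 + 3/2) = 17/2; the summands 1 and p2 become multiples of L
    because both logarithms are at least 1.\<close>
  then have e: "real e \<le> 17 / 2 * L" using p(2) lL L1 unfolding e_def by simp
  have Q4: "Q \<ge> 4" using m mult_le_mono[of 2 m1 2 m2] by (simp add: Q_def)
  obtain a b where ab: "m1 = a + 2" "m2 = b + 2" using m by (metis le_add_diff_inverse2)
  \<comment> \<open>This uses m1 + m2 \<ge> 4. Then M \<le> (Q - 3)^2 + 1 = Q^2 - 6 Q + 10 \<le> Q^2
    - 14 for Q \<ge> 4, and the saved 14 pays for the additive 3.\<close>
  have "(m1 - 1) * (m2 - 1) + 3 \<le> Q" unfolding Q_def ab by simp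
  then have MQ: "(m1 - 1) * (m2 - 1) \<le> Q - 3" by simp
  have "M \<le> Suc ((Q - 3)\<^sup>2)" unfolding M_def using MQ by (simp add: power_mono)
  moreover obtain c where c: "Q = c + 4" using Q4 by (metis le_add_diff_inverse2)
  have "Suc ((Q - 3)\<^sup>2) + 14 \<le> Q\<^sup>2" unfolding c by (simp add: power2_eq_square algebra_simps)
  ultimately have "M + 14 \<le> Q\<^sup>2" by simp
  then have M: "real M + 14 \<le> (real Q)\<^sup>2" by (metis of_nat_add of_nat_le_iff of_nat_numeral of_nat_power)
  have "real e * real M \<le> 17 / 2 * L * real M" using e by (rule mult_right_mono) simp
  then have "real (3 + e * M) \<le> 3 + 17 / 2 * L * real M" by simp
  also have "\<dots> \<le> 3 + 17 / 2 * L * ((real Q)\<^sup>2 - 14)" using M L1 by simp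
  also have "\<dots> \<le> 9 * (real Q)\<^sup>2 * L"
  proof -
    define K where "K = L * (real Q)\<^sup>2"
    have K: "17 / 2 * L * ((real Q)\<^sup>2 - 14) = 17 / 2 * K - 119 * L" "9 * (real Q)\<^sup>2 * L = 9 * K"
      by (simp_all add: K_def right_diff_distrib)
    have "0 \<le> K" using L1 by (simp add: K_def)
    then show ?thesis unfolding K using L1 by linarith
  qed
  also have "\<dots> < log 2 (real n)" using log by (simp add: L_def Q_def mult_ac)
  finally have "2 powr real (3 + e * M) < real n" using n by (simp add: less_log_iff)
  moreover have "2 powr real (3 + e * M) = (2::real) ^ (3 + e * M)" by (rule powr_realpow) simp
  ultimately have "real (2 ^ (3 + e * M)) < real n" by (simp only: of_nat_power of_nat_numeral)
  then have "2 ^ (3 + e * M) < n" unfolding of_nat_less_iff .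
  then have "8 * 2 ^ (e * M) < n" by (simp add: power_add)
  moreover have N: "(2 * 4 ^ (p1 * p2 + p2)) ^ M = (2::nat) ^ (e * M)"
  proof -
    have "2 * 4 ^ (p1 * p2 + p2) = (2::nat) ^ e" unfolding e_def power_add power_mult by simp
    then show ?thesis by (simp only: power_mult)
  qed
  moreover have "(2::nat) ^ (e * M) \<ge> 1" by simp
  ultimately show ?thesis unfolding M_def[symmetric] N by linarith
qed

theorem theorem4:
  fixes m1 m2 n :: nat and G :: topgraph
  assumes "m1 > 0" and "m2 > 0" and "n > 0"
    and "9 * (real m1 * real m2)\<^sup>2 * log 2 (real m1) * log 2 (real m2) < log 2 (real n)"
    and "simple_topological_graph G" and "complete_graph G" and "card (verts G) = n"
  shows "\<exists>H. topological_subgraph H G \<and>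
           ((\<exists>C. complete_convex_geometric_graph m1 C \<and> weakly_isomorphic H C) \<or>
            (\<exists>T. complete_twisted_graph m2 T \<and> weakly_isomorphic H T))"
proof -
  interpret simple_complete_drawing G using assms(5,6) by unfold_locales
  interpret crossing_system V X by (rule crossing_system)
  have "\<exists>w. inj_on w {..<m1} \<and> w ` {..<m1} \<subseteq> V \<and> convex_pattern m1 w \<or>
    inj_on w {..<m2} \<and> w ` {..<m2} \<subseteq> V \<and> twisted_pattern m2 w"
  \<comment> \<open>If m1 or m2 is 1, a logarithm vanishes and the hypothesis says no more about the
    size than log n > 0. A single vertex is then already the wanted pattern.\<close>
  proof (cases "m1 = 1 \<or> m2 = 1")
    case True
    have "V \<noteq> {}" using assms(3,7) by auto
    then obtain u where "u \<in> V" by blast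
    then have "inj_on (\<lambda>_. u) {..<1::nat} \<and> (\<lambda>_. u) ` {..<1::nat} \<subseteq> V \<and> convex_pattern 1 (\<lambda>_. u) \<and> twisted_pattern 1 (\<lambda>_. u)"
      by (auto simp: convex_pattern_def twisted_pattern_def inj_on_def)
    then show ?thesis using True by (intro exI[of _ "\<lambda>_. u"]) auto
  next
    case False
    then have m: "m1 \<ge> 2" "m2 \<ge> 2" using assms(1,2) by auto
    note p = ceiling_log_bounds[OF m(1)] ceiling_log_bounds[OF m(2)]
    show ?thesis
      by (rule unavoidable_patterns[OF finite_V size_bound[OF m assms(3,4) p(2,4), folded assms(7)] assms(1,2) p(1,3) order.refl])
  qed
  then obtain w where "inj_on w {..<m1} \<and> w ` {..<m1} \<subseteq> V \<and> convex_pattern m1 w \<or>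
    inj_on w {..<m2} \<and> w ` {..<m2} \<subseteq> V \<and> twisted_pattern m2 w" by (rule exE)
  then show ?thesis
  proof (elim disjE conjE)
    assume "inj_on w {..<m1}" "w ` {..<m1} \<subseteq> V" "convex_pattern m1 w"
    from convex_subgraph[OF this] show ?thesis by blast
  next
    assume "inj_on w {..<m2}" "w ` {..<m2} \<subseteq> V" "twisted_pattern m2 w"
    from twisted_subgraph[OF this] show ?thesis by blast
  qed
qed

end
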